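(* Let $E$ be the figure-eight knot, let $u$ be a real number with $0<u<\operatorname{arccosh}(3/2)$, let $p$ be a positive integer, and put $\xi:=u+2p\pi\sqrt{-1}$. Then $$ \frac{J_N\left(E;e^{\xi/N}\right)}{J_p\left(E;e^{4N\pi^2/\xi}\right)} \underset{N\to\infty}{\sim} \frac{\sqrt{-\pi}}{2\sinh(u/2)}\,T_E(u)^{1/2} \left(\frac{N}{\xi}\right)^{1/2} e^{\frac{N}{\xi}S_E(u)}, $$ i.e. the ratio of the two sides tends to $1$ as $N\to\infty$ through the positive integers ($u$, $p$ fixed).
   Context: For a positive integer $N$, $J_N(E;q)$ is the $N$-dimensional colored Jones polynomial of the figure-eight knot $E$, normalized to be $1$ for the unknot. It is given explicitly by $$ J_N(E;q)=\sum_{k=0}^{N-1}q^{-kN}\prod_{l=1}^{k}\left(1-q^{N+l}\right)\left(1-q^{N-l}\right). $$ Put $$ \varphi(u):=\log\left(\cosh u-\tfrac12-\tfrac12\sqrt{(2\cosh u+1)(2\cosh u-3)}\right), $$ $$ S_E(u):=\operatorname{Li}_2\left(e^{-u-\varphi(u)}\right)-\operatorname{Li}_2\left(e^{-u+\varphi(u)}\right)+u\bigl(\varphi(u)+2\pi\sqrt{-1}\bigr), \qquad T_E(u):=\frac{2}{\sqrt{(2\cosh u+1)(2\cosh u-3)}}, $$ where $\operatorname{Li}_2(z):=-\int_0^z\frac{\log(1-w)}{w}\,dw$. Since $0<u<\operatorname{arccosh}(3/2)$, the number $(2\cosh u+1)(2\cosh u-3)$ is negative, and its square root is taken to be a positive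 multiple of $\sqrt{-1}$. $\log$ is the principal branch, $\sqrt{-\pi}=\sqrt{\pi}\sqrt{-1}$, and $T_E(u)^{1/2}$, $(N/\xi)^{1/2}$ are principal square roots. *)

theory Defs
  imports "HOL-Complex_Analysis.Complex_Analysis"
begin

(* Habiro--Le formula for the N-dimensional colored Jones polynomial of the
   figure-eight knot, evaluated at q \<noteq> 0 and normalized to 1 for the unknot.
   Since l \<le> k < N, the subtraction N - l on naturals is never truncated. *)
definition colored_jones_fig8 :: "nat \<Rightarrow> complex \<Rightarrow> complex" where
  "colored_jones_fig8 N q =
     (\<Sum>k<N. q powi (- (int k * int N)) * (\<Prod>l=1..k. (1 - q ^ (N + l)) * (1 - q ^ (N - l))))"

(* Principal dilogarithm, integrated along the straight segment from 0 to z.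
   The singularity of the integrand at w = 0 is removable; the junk value there does not
   affect the integral. *)
definition Li2 :: "complex \<Rightarrow> complex" where
  "Li2 z = - contour_integral (linepath 0 z) (\<lambda>w. Ln (1 - w) / w)"

(* csqrt of a negative real is a positive multiple of \<i>, which is the branch needed for
   0 < u < arcosh (3/2). *)
definition fig8_root :: "real \<Rightarrow> complex" where
  "fig8_root u = csqrt (complex_of_real ((2 * cosh u + 1) * (2 * cosh u - 3)))"

definition \<phi>_fig8 :: "real \<Rightarrow> complex" where
  "\<phi>_fig8 u = Ln (complex_of_real (cosh u) - 1/2 - 1/2 * fig8_root u)"

definition S_fig8 :: "real \<Rightarrow> complex" where
  "S_fig8 u =
     Li2 (exp (- complex_of_real u - \<phi>_fig8 u)) - Li2 (exp (- complex_of_real u + \<phi>_fig8 u))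
     + complex_of_real u * (\<phi>_fig8 u + 2 * complex_of_real pi * \<i>)"

definition T_fig8 :: "real \<Rightarrow> complex" where
  "T_fig8 u = 2 / fig8_root u"

end

(*
Put h = xi/N and f(v) = 2 cosh u - 2 cosh v. The Habiro--Le formula says that J_N(E; e^h) is the sum
over k < N of the products f(h) f(2h) ... f(kh), and that J_p(E; e^a) is asymptotic to e^(p(p-1)a) as
Re a tends to infinity, since its last summand dominates.

Let P be the primitive of log f that is given by dilogarithms for |Re v| < u. By the midpoint rule
the k-th summand is exp((P((k+1/2)h) - P(h/2))/h + O(1/N)). The absolute values of these summands do not
show the saddle point, as the summation path from 0 to xi is far from the path of steepest descent. So the
summands are interpolated holomorphically: the Abel--Plana formula yields E with E(V+h) - E(V) = log f(V+h) up to
an exponentially small error, and E = P/h + (log f)/2 + O(1/N). The residue theorem turns the sum into the integral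
of exp(E(V))/(1 - exp(2 pi i V/h)) over the boundary of a rectangle with left side on the imaginary axis, one
period below xi. On that side f is real and positive, the kernel is close to 1, and the modulus has
its only maximum at the saddle point phi = - i theta with cos theta = cosh u - 1/2, so that the Laplace method
applies. The other three sides and the omitted summands are exponentially smaller.
*)
theory Submission
  imports Defs "HOL-Probability.Probability" "HOL-Real_Asymp.Real_Asymp"
begin

section \<open>The colored Jones polynomial at an exponential\<close>

text \<open>Cancellation shapes the proof: the summands are bounded only by 23^N, so an interpolant
  that matches them up to a relative error O(1/N) would not do. The difference equation is therefore
  solved up to exp (- (ln 23 + 1) N), which leaves an absolute error of order N exp (- N) per
  summand, while the main term has modulus at least 1. The expansion of E up to O(1/N) is used only
  once the sum has become an integral. The right side lies at Re v = 3u. In units of N/|\<xi>|^2 the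
  rate of exp E grows along a horizontal line by at most 4u + 2 \<pi>^2 p per unit length, and
  beyond Re v = u the kernel decays by 4 \<pi>^2 p; at Re v = a u the balance is u (4 a u + 2
  \<pi>^2 p (2 - a)), negative for a = 3 but not for a = 2. The condition cosh u < 3/2 makes
  \<theta> real and keeps |f| at most 1 on the last part of the path, so that nothing grows again
  after the saddle point. J_p enters through periodicity: the p periods of the shift change the
  exponent N S_E/\<xi> by p (p - 1) 4 \<pi>^2 N/\<xi>, up to a multiple of 2 \<pi> i.\<close>

lemma colored_jones_fig8_exp:
  "colored_jones_fig8 N (exp h) =
    (\<Sum>k<N. \<Prod>l=1..k. 2 * cosh (of_nat N * h) - 2 * cosh (of_nat l * h))"
proof -
  have "exp h powi (- (int k * int N)) * (\<Prod>l=1..k. (1 - exp h ^ (N + l)) * (1 - exp h ^ (N - l)))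
     = (\<Prod>l=1..k. 2 * cosh (of_nat N * h) - 2 * cosh (of_nat l * h))" if "k < N" for k
  proof -
    \<comment> \<open>Each of the k factors receives one q^(-N): q^(-N) (1 - q^(N+l)) (1 - q^(N-l))
      = q^N + q^(-N) - q^l - q^(-l).\<close>
    have "exp h powi (- (int k * int N)) = exp (- (of_nat N * h)) ^ k"
      by (simp add: exp_power_int power_int_minus flip: exp_of_nat_mult exp_minus) (simp add: mult_ac)
    also have "\<dots> = (\<Prod>l=1..k. exp (- (of_nat N * h)))"
      by simp
    finally have "exp h powi (- (int k * int N)) * (\<Prod>l=1..k. (1 - exp h ^ (N + l)) * (1 - exp h ^ (N - l)))
      = (\<Prod>l=1..k. exp (- (of_nat N * h)) * ((1 - exp h ^ (N + l)) * (1 - exp h ^ (N - l))))"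
      by (simp only: prod.distrib)
    also have "\<dots> = (\<Prod>l=1..k. 2 * cosh (of_nat N * h) - 2 * cosh (of_nat l * h))"
    proof (rule prod.cong)
      fix l assume "l \<in> {1..k}"
      then have l: "of_nat (N - l) = (of_nat N - of_nat l :: complex)" using that by (simp add: of_nat_diff)
      define A where "A = exp (of_nat N * h)"
      define B where "B = exp (of_nat l * h)"
      have nz: "A \<noteq> 0" "B \<noteq> 0" by (auto simp: A_def B_def)
      have 1: "exp h ^ (N + l) = A * B" by (simp add: A_def B_def power_add exp_of_nat_mult)
      have 2: "exp h ^ (N - l) = A / B"
        by (simp add: A_def B_def l left_diff_distrib exp_diff flip: exp_of_nat_mult)
      have 3: "exp (- (of_nat N * h)) = 1 / A" "exp (- (of_nat l * h)) = 1 / B"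
        by (simp_all add: A_def B_def exp_minus field_simps)
      show "exp (- (of_nat N * h)) * ((1 - exp h ^ (N + l)) * (1 - exp h ^ (N - l))) =
         2 * cosh (of_nat N * h) - 2 * cosh (of_nat l * h)"
        unfolding 1 2 cosh_def 3 A_def[symmetric] B_def[symmetric] using nz
        by (simp add: scaleR_conv_of_real field_simps)
    qed simp
    finally show ?thesis .
  qed
  then show ?thesis unfolding colored_jones_fig8_def by (intro sum.cong) auto
qed

lemma exp_Re_at_bot_tendsto_0:
  fixes g :: "'a \<Rightarrow> complex"
  assumes "filterlim (\<lambda>n. Re (g n)) at_bot F"
  shows "((\<lambda>n. exp (g n)) \<longlongrightarrow> 0) F"
proof -
  have "((\<lambda>n. exp (Re (g n))) \<longlongrightarrow> 0) F"
    using filterlim_compose[OF exp_at_bot assms] .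
  then show ?thesis by (simp add: tendsto_norm_zero_iff[symmetric, where f = "\<lambda>n. exp (g n)"])
qed

lemma colored_jones_fig8_leading:
  fixes a :: "nat \<Rightarrow> complex"
  assumes "p > 0" and a: "filterlim (\<lambda>N. Re (a N)) at_top sequentially"
  shows "(\<lambda>N. colored_jones_fig8 p (exp (a N)) / exp (of_nat (p * (p - 1)) * a N)) \<longlonglongrightarrow> 1"
proof -
  \<comment> \<open>The l-th factor divided by its leading exponential; for l < p all other
    exponents have negative real part.\<close>
  define g where "g l N = (2 * cosh (of_nat p * a N) - 2 * cosh (of_nat l * a N)) / exp (of_nat p * a N)" for l N
  have ex0: "(\<lambda>N. exp (- (of_real c * a N))) \<longlonglongrightarrow> 0" if "c > 0" for c
  proof (rule exp_Re_at_bot_tendsto_0)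
    have "filterlim (\<lambda>N. c * Re (a N)) at_top sequentially"
      using a that by (rule filterlim_tendsto_pos_mult_at_top[OF tendsto_const, rotated])
    then show "filterlim (\<lambda>N. Re (- (of_real c * a N))) at_bot sequentially"
      by (simp add: filterlim_uminus_at_bot)
  qed
  have g: "g l \<longlonglongrightarrow> 1" if "l < p" for l
  proof -
    have *: "g l N = 1 + exp (- (of_real (2 * real p) * a N)) - exp (- (of_real (real p - real l) * a N))
       - exp (- (of_real (real p + real l) * a N))" for N
      unfolding g_def cosh_def
      by (simp add: scaleR_conv_of_real field_simps flip: exp_add exp_diff)
    show ?thesis unfolding *
      by (rule tendsto_eq_intros ex0 | use that in simp)+
  qed
  \<comment> \<open>Relative to the leading term the k-th summand carries exp (- (p - 1 - k) p a),
    which survives only for k = p - 1.\<close>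
  have 1: "(\<lambda>N. (\<Prod>l=1..k. g l N) * exp (- (of_real (real (p - 1 - k) * p) * a N)))
       \<longlonglongrightarrow> (if k = p - 1 then 1 else 0)" if "k < p" for k
  proof -
    have A: "(\<lambda>N. (\<Prod>l=1..k. g l N)) \<longlonglongrightarrow> (\<Prod>l=1..k. 1)"
      by (rule tendsto_prod, rule g) (use that in auto)
    show ?thesis
    proof (cases "k = p - 1")
      case True
      then show ?thesis using A by simp
    next
      case False
      then have "real (p - 1 - k) * p > 0" using that assms by simp
      from tendsto_mult[OF A ex0[OF this]] show ?thesis using False by simp
    qed
  qed
  have 2: "colored_jones_fig8 p (exp (a N)) / exp (of_nat (p * (p - 1)) * a N)
     = (\<Sum>k<p. (\<Prod>l=1..k. g l N) * exp (- (of_real (real (p - 1 - k) * p) * a N)))" for N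
    unfolding colored_jones_fig8_exp sum_divide_distrib
  proof (rule sum.cong)
    fix k assume "k \<in> {..<p}"
    then have k: "k < p" by simp
    have "(\<Prod>l=1..k. g l N) = (\<Prod>l=1..k. 2 * cosh (of_nat p * a N) - 2 * cosh (of_nat l * a N))
         / exp (of_nat p * a N) ^ k"
      by (simp add: g_def prod_dividef)
    moreover have E: "exp (of_nat p * a N) ^ k * exp (of_real (real (p - 1 - k) * p) * a N) = exp (of_nat (p * (p - 1)) * a N)"
    proof -
      have "p - 1 = k + (p - 1 - k)" using k by simp
      then have "of_nat (p * (p - 1)) = (of_nat k * of_nat p + of_nat (p - 1 - k) * of_nat p :: complex)"
        by (metis (no_types) mult.commute of_nat_add of_nat_mult distrib_right)
      then show ?thesis by (simp add: exp_add ring_distribs flip: exp_of_nat_mult) (simp add: mult_ac)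
    qed
    ultimately show "(\<Prod>l=1..k. 2 * cosh (of_nat p * a N) - 2 * cosh (of_nat l * a N)) / exp (of_nat (p * (p - 1)) * a N)
      = (\<Prod>l=1..k. g l N) * exp (- (of_real (real (p - 1 - k) * p) * a N))"
      by (simp only: E[symmetric] exp_minus divide_inverse inverse_mult_distrib) (simp add: mult_ac)
  qed simp
  have "(\<lambda>N. \<Sum>k<p. (\<Prod>l=1..k. g l N) * exp (- (of_real (real (p - 1 - k) * p) * a N))) \<longlonglongrightarrow>
     (\<Sum>k<p. if k = p - 1 then 1 else 0)"
    by (rule tendsto_sum, rule 1) auto
  also have "(\<Sum>k<p. if k = p - 1 then 1 else 0) = (1::complex)"
    using assms by (simp add: sum.delta)
  finally show ?thesis unfolding 2 .
qed

section \<open>Gaussian integrals and the Laplace method\<close>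

lemma holomorphic_primitive_exists:
  fixes f :: "complex \<Rightarrow> complex"
  assumes "convex S" "open S" "f holomorphic_on S"
  shows "\<exists>g. \<forall>x\<in>S. (g has_field_derivative f x) (at x)"
proof (rule holomorphic_convex_primitive'[OF assms])
  fix g assume "\<And>x. x \<in> S \<Longrightarrow> (g has_field_derivative f x) (at x within S)"
  then show ?thesis using at_within_open[OF _ assms(2)] by metis
qed

text \<open>The normal density of variance 1 / (2 c) has total mass 1.\<close>

lemma has_integral_real_gaussian:
  assumes "c > (0::real)"
  shows "((\<lambda>x. exp (- c * x\<^sup>2)) has_integral sqrt (pi / c)) UNIV"
proof -
  define \<sigma> where "\<sigma> = 1 / sqrt (2 * c)"
  have \<sigma>: "\<sigma> > 0" "\<sigma>\<^sup>2 = 1 / (2 * c)" using assms by (auto simp: \<sigma>_def power_divide)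
  have *: "normal_density 0 \<sigma> x = exp (- c * x\<^sup>2) / sqrt (pi / c)" for x
    using assms by (simp add: normal_density_def \<sigma> field_simps)
  have "(normal_density 0 \<sigma> has_integral 1) UNIV"
    using has_integral_integral_lborel[OF integrable_normal_density[OF \<sigma>(1), of 0]] \<sigma>(1)
    by (simp add: integral_normal_density)
  then have "((\<lambda>x. sqrt (pi / c) * normal_density 0 \<sigma> x) has_integral sqrt (pi / c) * 1) UNIV"
    by (rule has_integral_mult_right)
  then show ?thesis using assms by (simp add: *)
qed

text \<open>Dominated convergence for truncation to [-n, n]; it allows an integral over the line to
  be computed from a primitive.\<close>

lemma integral_symmetric_interval_tendsto:
  fixes f :: "real \<Rightarrow> complex"
  assumes f: "continuous_on UNIV f" and h: "h integrable_on UNIV" and le: "\<And>x. norm (f x) \<le> h x"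
  shows "f integrable_on UNIV" "(\<lambda>n. integral {-real n..real n} f) \<longlonglongrightarrow> integral UNIV f"
proof -
  define g where "g n x = (if x \<in> {-real n..real n} then f x else 0)" for n x
  have h0: "h x \<ge> 0" for x using le[of x] norm_ge_zero order_trans by blast
  have "f integrable_on {-real n..real n}" for n
    by (rule integrable_continuous_real, rule continuous_on_subset[OF f]) auto
  then have 1: "g n integrable_on UNIV" for n
    unfolding g_def by (subst integrable_restrict_UNIV)
  have 2: "norm (g n x) \<le> h x" for n x using le h0 by (auto simp: g_def)
  have 3: "(\<lambda>n. g n x) \<longlonglongrightarrow> f x" for x
  proof (rule tendsto_eventually)
    obtain m :: nat where "\<bar>x\<bar> \<le> real m" using real_arch_simple by blast
    then show "\<forall>\<^sub>F n in sequentially. g n x = f x"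
      by (intro eventually_sequentiallyI[of m]) (auto simp: g_def)
  qed
  show "f integrable_on UNIV" using dominated_convergence[OF 1 h 2 3] by auto
  have "(\<lambda>n. integral UNIV (g n)) \<longlonglongrightarrow> integral UNIV f" using dominated_convergence[OF 1 h 2 3] by auto
  then show "(\<lambda>n. integral {-real n..real n} f) \<longlonglongrightarrow> integral UNIV f"
    unfolding g_def integral_restrict_UNIV .
qed

text \<open>Rotation of the line of integration. With w = csqrt \<gamma> the truncated integral is
  1/w times the integral of exp (- z^2) from - w n to w n. Up to two vertical segments this is the
  integral over the real interval [- a n, a n], where a = Re w > 0, and on these segments Re (z^2)
  is at least n^2 Re \<gamma>.\<close>

lemma has_integral_complex_gaussian:
  fixes \<gamma> :: complex
  assumes "Re \<gamma> > 0"
  shows "((\<lambda>s::real. exp (- \<gamma> * (of_real s)\<^sup>2)) has_integral csqrt (pi / \<gamma>)) UNIV"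
proof -
  define w where "w = csqrt \<gamma>"
  define a where "a = Re w"
  have w2: "w\<^sup>2 = \<gamma>" by (simp add: w_def)
  have g0: "\<gamma> \<noteq> 0" using assms by auto
  have "Re \<gamma> = (Re w)\<^sup>2 - (Im w)\<^sup>2" by (simp add: w2[symmetric] Re_power2)
  then have ab: "(Re w)\<^sup>2 - (Im w)\<^sup>2 = Re \<gamma>" by simp
  have "Re w \<noteq> 0"
  proof
    assume "Re w = 0"
    then have "Re \<gamma> = - (Im w)\<^sup>2" using ab by simp
    then show False using assms zero_le_power2[of "Im w"] by linarith
  qed
  moreover have "Re w \<ge> 0" using csqrt_principal[of \<gamma>] by (auto simp: w_def)
  ultimately have a: "a > 0" by (simp add: a_def)
  have w0: "w \<noteq> 0" using a by (auto simp: a_def)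
  have "(\<lambda>z::complex. exp (- z\<^sup>2)) holomorphic_on UNIV" by (intro holomorphic_intros)
  from holomorphic_primitive_exists[OF convex_UNIV open_UNIV this]
  obtain G :: "complex \<Rightarrow> complex" where G: "\<And>x. (G has_field_derivative exp (- x\<^sup>2)) (at x)" by auto
  have I: "integral {-real n..real n} (\<lambda>s::real. exp (- v\<^sup>2 * (complex_of_real s)\<^sup>2)) = (G (v * of_nat n) - G (- (v * of_nat n))) / v"
    if "v \<noteq> 0" for v :: complex and n :: nat
  proof -
    have "((\<lambda>s. G (v * of_real s) / v) has_vector_derivative exp (- v\<^sup>2 * (of_real s)\<^sup>2)) (at s within {-real n..real n})" for s
    proof -
      have "((\<lambda>s. v * s) has_field_derivative v) (at (of_real s))" by (auto intro!: derivative_eq_intros)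
      from DERIV_cdivide[OF DERIV_chain2[OF G this], of v]
      have "((\<lambda>s. G (v * s) / v) has_field_derivative exp (- (v * of_real s)\<^sup>2)) (at (of_real s))"
        using that by simp
      from has_vector_derivative_real_field[OF this] show ?thesis
        by (simp add: power_mult_distrib has_vector_derivative_at_within)
    qed
    from fundamental_theorem_of_calculus[OF _ this]
    have "((\<lambda>s. exp (- v\<^sup>2 * (of_real s)\<^sup>2)) has_integral (G (v * n) / v - G (v * of_real (- real n)) / v)) {-real n..real n}"
      by simp
    then show ?thesis by (simp add: integral_unique diff_divide_distrib)
  qed
  have gi: "(\<lambda>x. exp (- c * x\<^sup>2)) integrable_on UNIV" if "c > 0" for c :: real
    using has_integral_real_gaussian[OF that] by blast
  have lim_a: "(\<lambda>n. (G (complex_of_real a * of_nat n) - G (- (complex_of_real a * of_nat n))) / of_real a) \<longlonglongrightarrow> of_real (sqrt (pi / a\<^sup>2))"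
  proof -
    let ?f = "\<lambda>s::real. exp (- (of_real a)\<^sup>2 * (of_real s)\<^sup>2) :: complex"
    have f: "?f s = of_real (exp (- a\<^sup>2 * s\<^sup>2))" for s by (simp flip: exp_of_real)
    have "integral UNIV ?f = of_real (sqrt (pi / a\<^sup>2))"
      unfolding f using has_integral_real_gaussian[of "a\<^sup>2"] a by (intro integral_unique has_integral_of_real) auto
    moreover have "(\<lambda>n. integral {-real n..real n} ?f) \<longlonglongrightarrow> integral UNIV ?f"
      by (rule integral_symmetric_interval_tendsto(2)[OF _ gi[of "a\<^sup>2"]]) (use a in \<open>auto intro!: continuous_intros simp: f\<close>)
    ultimately have "(\<lambda>n. integral {-real n..real n} ?f) \<longlonglongrightarrow> of_real (sqrt (pi / a\<^sup>2))" by (simp only:)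
    moreover have "integral {-real n..real n} ?f = (G (complex_of_real a * of_nat n) - G (- (complex_of_real a * of_nat n))) / of_real a" for n
      by (rule I) (use a in simp)
    ultimately show ?thesis by (simp only:)
  qed
  have seg: "norm (G (w * of_nat n) - G (complex_of_real a * of_nat n)) \<le> exp (- Re \<gamma> * (real n)\<^sup>2) * (real n * \<bar>Im w\<bar>)"
     "norm (G (- (w * of_nat n)) - G (- (complex_of_real a * of_nat n))) \<le> exp (- Re \<gamma> * (real n)\<^sup>2) * (real n * \<bar>Im w\<bar>)" for n :: nat
  proof -
    define S where "S = {z. \<bar>Im z\<bar> \<le> real n * \<bar>Im w\<bar> \<and> (Re z)\<^sup>2 = (real n * a)\<^sup>2}"
    have bd: "norm (exp (- x\<^sup>2)) \<le> exp (- Re \<gamma> * (real n)\<^sup>2)" if "x \<in> S" for x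
    proof -
      have "(Im x)\<^sup>2 \<le> (real n * Im w)\<^sup>2" using that
        by (metis (mono_tags, lifting) S_def abs_le_square_iff abs_mult abs_of_nat mem_Collect_eq)
      moreover have "(Re x)\<^sup>2 = (real n * Re w)\<^sup>2" using that by (simp add: S_def a_def)
      ultimately have "Re \<gamma> * (real n)\<^sup>2 \<le> Re (x\<^sup>2)" unfolding ab[symmetric]
        by (simp add: power_mult_distrib algebra_simps Re_power2)
      then show ?thesis by simp
    qed
    have sub: "closed_segment (w * of_nat n) (complex_of_real a * of_nat n) \<subseteq> S" "closed_segment (- (w * of_nat n)) (- (complex_of_real a * of_nat n)) \<subseteq> S"
    proof -
      have *: "\<bar>(1 - t) * (real n * Im w)\<bar> \<le> real n * \<bar>Im w\<bar>" if "0 \<le> t" "t \<le> 1" for t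
        using that by (simp add: abs_mult mult_left_le_one_le)
      show "closed_segment (w * of_nat n) (complex_of_real a * of_nat n) \<subseteq> S"
      proof
        fix z assume "z \<in> closed_segment (w * of_nat n) (complex_of_real a * of_nat n)"
        then obtain t where t: "0 \<le> t" "t \<le> 1" "z = (1 - t) *\<^sub>R (w * of_nat n) + t *\<^sub>R (complex_of_real a * of_nat n)"
          by (auto simp: in_segment)
        have "Im z = (1 - t) * (real n * Im w)" "Re z = real n * a"
          unfolding t(3) by (simp_all add: a_def algebra_simps)
        then show "z \<in> S" using *[OF t(1,2)] by (simp add: S_def)
      qed
      then have "uminus ` closed_segment (w * of_nat n) (complex_of_real a * of_nat n) \<subseteq> uminus ` S" by blast
      moreover have "uminus ` closed_segment (w * of_nat n) (complex_of_real a * of_nat n) = closed_segment (- (w * of_nat n)) (- (complex_of_real a * of_nat n))"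
        by (rule closed_segment_linear_image[symmetric]) (rule linear_uminus)
      moreover have "uminus ` S \<subseteq> S" by (auto simp: S_def)
      ultimately show "closed_segment (- (w * of_nat n)) (- (complex_of_real a * of_nat n)) \<subseteq> S" by blast
    qed
    have d: "norm (w * of_nat n - complex_of_real a * of_nat n) = real n * \<bar>Im w\<bar>"
    proof -
      have "w * of_nat n - complex_of_real a * of_nat n = of_real (real n * Im w) * \<i>" by (simp add: complex_eq_iff a_def)
      then show ?thesis by (simp add: norm_mult abs_mult del: of_real_mult)
    qed
    show "norm (G (w * of_nat n) - G (complex_of_real a * of_nat n)) \<le> exp (- Re \<gamma> * (real n)\<^sup>2) * (real n * \<bar>Im w\<bar>)"
      unfolding d[symmetric]
      by (rule field_differentiable_bound[of "closed_segment (w * of_nat n) (complex_of_real a * of_nat n)"])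
         (use bd sub in \<open>auto intro: has_field_derivative_at_within G\<close>)
    have d': "norm (- (w * of_nat n) - - (complex_of_real a * of_nat n)) = real n * \<bar>Im w\<bar>" using d by (metis minus_diff_minus norm_minus_cancel)
    show "norm (G (- (w * of_nat n)) - G (- (complex_of_real a * of_nat n))) \<le> exp (- Re \<gamma> * (real n)\<^sup>2) * (real n * \<bar>Im w\<bar>)"
      unfolding d'[symmetric]
      by (rule field_differentiable_bound[of "closed_segment (- (w * of_nat n)) (- (complex_of_real a * of_nat n))"])
         (use bd sub in \<open>auto intro: has_field_derivative_at_within G\<close>)
  qed
  have z: "(\<lambda>n. exp (- Re \<gamma> * (real n)\<^sup>2) * (real n * \<bar>Im w\<bar>)) \<longlonglongrightarrow> 0"
  proof -
    have "(\<lambda>n. exp (- Re \<gamma> * (real n)\<^sup>2) * real n) \<longlonglongrightarrow> 0" using assms by real_asymp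
    from tendsto_mult_left_zero[OF this, of "\<bar>Im w\<bar>"] show ?thesis by (simp add: mult.assoc)
  qed
  have d1: "(\<lambda>n. G (w * of_nat n) - G (complex_of_real a * of_nat n)) \<longlonglongrightarrow> 0"
    by (rule Lim_null_comparison[OF _ z]) (use seg in auto)
  have d2: "(\<lambda>n. G (- (w * of_nat n)) - G (- (complex_of_real a * of_nat n))) \<longlonglongrightarrow> 0"
    by (rule Lim_null_comparison[OF _ z]) (use seg in auto)
  have "(\<lambda>n. of_real a * ((G (complex_of_real a * of_nat n) - G (- (complex_of_real a * of_nat n))) / of_real a) + (G (w * of_nat n) - G (complex_of_real a * of_nat n)) -
       (G (- (w * of_nat n)) - G (- (complex_of_real a * of_nat n)))) \<longlonglongrightarrow> of_real a * of_real (sqrt (pi / a\<^sup>2)) + 0 - 0"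
    by (intro tendsto_intros lim_a d1 d2)
  moreover have "of_real a * ((G (complex_of_real a * of_nat n) - G (- (complex_of_real a * of_nat n))) / of_real a) + (G (w * of_nat n) - G (complex_of_real a * of_nat n)) -
       (G (- (w * of_nat n)) - G (- (complex_of_real a * of_nat n))) = G (w * of_nat n) - G (- (w * of_nat n))" for n :: nat
    using a by (simp add: field_simps)
  moreover have "of_real a * of_real (sqrt (pi / a\<^sup>2)) + 0 - 0 = complex_of_real (sqrt pi)"
    using a by (simp add: real_sqrt_divide)
  ultimately have "(\<lambda>n. G (w * of_nat n) - G (- (w * of_nat n))) \<longlonglongrightarrow> of_real (sqrt pi)" by (simp only:)
  then have "(\<lambda>n. (G (w * of_nat n) - G (- (w * of_nat n))) / w) \<longlonglongrightarrow> of_real (sqrt pi) / w"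
    by (intro tendsto_intros w0)
  then have L: "(\<lambda>n. integral {-real n..real n} (\<lambda>s. exp (- \<gamma> * (of_real s)\<^sup>2))) \<longlonglongrightarrow> of_real (sqrt pi) / w"
    unfolding w2[symmetric] I[OF w0] .
  have c: "continuous_on UNIV (\<lambda>s::real. exp (- \<gamma> * (of_real s)\<^sup>2))" by (intro continuous_intros)
  have n: "norm (exp (- \<gamma> * (of_real s)\<^sup>2)) \<le> exp (- Re \<gamma> * s\<^sup>2)" for s :: real
    by simp
  note T = integral_symmetric_interval_tendsto[OF c gi[OF assms] n]
  have "integral UNIV (\<lambda>s. exp (- \<gamma> * (of_real s)\<^sup>2)) = of_real (sqrt pi) / w"
    using LIMSEQ_unique[OF T(2) L] .
  \<comment> \<open>\<open>csqrt\<close> selects the root with positive real part, which sqrt \<pi>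
    / w has because Re w > 0.\<close>
  moreover have "csqrt (pi / \<gamma>) = of_real (sqrt pi) / w"
  proof (rule csqrt_unique)
    show "(of_real (sqrt pi) / w)\<^sup>2 = of_real pi / \<gamma>"
      by (simp add: power_divide w2 flip: of_real_power)
    show "0 < Re (of_real (sqrt pi) / w) \<or> Re (of_real (sqrt pi) / w) = 0 \<and> 0 \<le> Im (of_real (sqrt pi) / w)"
      using a by (simp add: Re_divide a_def) (intro divide_pos_pos mult_pos_pos add_pos_nonneg; simp)
  qed
  ultimately show ?thesis using T(1) by (simp add: has_integral_integrable_integral)
qed

text \<open>Substitution y = y0 + s / sqrt N and dominated convergence: the Gaussian bound becomes
  an integrable function of s that does not depend on N. The interval may vary with N as long as it
  contains a fixed neighbourhood of \<open>y0\<close>.\<close>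

lemma laplace_method:
  fixes H :: "nat \<Rightarrow> real \<Rightarrow> complex" and b \<gamma> :: complex and c :: real
  assumes c: "c > 0" and \<gamma>: "Re \<gamma> > 0"
    and cont: "\<forall>\<^sub>F N in sequentially. continuous_on {A N..B N} (H N)"
    and bound: "\<forall>\<^sub>F N in sequentially. \<forall>y\<in>{A N..B N}. norm (H N y) \<le> C * exp (- c * real N * (y - y0)\<^sup>2)"
    and lim: "\<And>s. (\<lambda>N. H N (y0 + s / sqrt (real N))) \<longlonglongrightarrow> b * exp (- \<gamma> * (of_real s)\<^sup>2)"
    and ends: "a' < y0" "y0 < b'" "\<forall>\<^sub>F N in sequentially. A N \<le> a' \<and> b' \<le> B N"
  shows "(\<lambda>N. of_real (sqrt (real N)) * integral {A N..B N} (H N)) \<longlonglongrightarrow> b * csqrt (pi / \<gamma>)"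
proof -
  have "\<forall>\<^sub>F N in sequentially. continuous_on {A N..B N} (H N) \<and>
     (\<forall>y\<in>{A N..B N}. norm (H N y) \<le> C * exp (- c * real N * (y - y0)\<^sup>2)) \<and> A N \<le> a' \<and> b' \<le> B N"
    using cont bound ends(3) by eventually_elim auto
  then obtain M where M: "\<And>N. N \<ge> M \<Longrightarrow> continuous_on {A N..B N} (H N) \<and>
     (\<forall>y\<in>{A N..B N}. norm (H N y) \<le> C * exp (- c * real N * (y - y0)\<^sup>2)) \<and> A N \<le> a' \<and> b' \<le> B N"
    by (auto simp: eventually_sequentially)
  define g where "g N s = (if y0 + s / sqrt (real N) \<in> {A N..B N} then H N (y0 + s / sqrt (real N)) else 0)" for N s
  have C: "C \<ge> 0"
  proof -
    have "y0 \<in> {A M..B M}" using M[of M] ends by auto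
    then have "norm (H M y0) \<le> C * exp (- c * real M * (y0 - y0)\<^sup>2)" using M[of M] by blast
    from order_trans[OF norm_ge_zero this] show ?thesis by simp
  qed
  have g1: "(g N has_integral of_real (sqrt (real N)) * integral {A N..B N} (H N)) UNIV" if N: "N \<ge> M" "N > 0" for N
  proof -
    have s: "sqrt (real N) > 0" using N by simp
    have "(H N has_integral integral {A N..B N} (H N)) (cbox (A N) (B N))"
      using M[OF N(1)] by (simp add: integrable_integral integrable_continuous_real)
    from has_integral_affinity'[OF this, of "1 / sqrt (real N)" y0]
    have I: "((\<lambda>s. H N (y0 + s / sqrt (real N))) has_integral of_real (sqrt (real N)) * integral {A N..B N} (H N))
        {(A N - y0) * sqrt (real N)..(B N - y0) * sqrt (real N)}"
      using s by (simp add: add.commute mult.commute scaleR_conv_of_real)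
    have "s \<in> {(A N - y0) * sqrt (real N)..(B N - y0) * sqrt (real N)} \<longleftrightarrow> y0 + s / sqrt (real N) \<in> {A N..B N}" for s
      using \<open>sqrt (real N) > 0\<close> by (auto simp: field_simps)
    then have "g N = (\<lambda>s. if s \<in> {(A N - y0) * sqrt (real N)..(B N - y0) * sqrt (real N)}
        then H N (y0 + s / sqrt (real N)) else 0)"
      by (auto simp: g_def fun_eq_iff)
    with I show ?thesis by (simp only: has_integral_restrict_UNIV)
  qed
  have g2: "norm (g N s) \<le> C * exp (- c * s\<^sup>2)" if N: "N \<ge> M" "N > 0" for N s
  proof (cases "y0 + s / sqrt (real N) \<in> {A N..B N}")
    case True
    then have "norm (H N (y0 + s / sqrt (real N))) \<le> C * exp (- c * real N * (y0 + s / sqrt (real N) - y0)\<^sup>2)"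
      using M[OF N(1)] by blast
    also have "\<dots> = C * exp (- c * s\<^sup>2)" using N by (simp add: power_divide)
    finally show ?thesis using True by (simp add: g_def)
  qed (use C in \<open>auto simp: g_def\<close>)
  have g3: "(\<lambda>N. g N s) \<longlonglongrightarrow> b * exp (- \<gamma> * (of_real s)\<^sup>2)" for s
  proof (rule Lim_transform_eventually[OF lim[of s]])
    have "(\<lambda>N. y0 + s / sqrt (real N)) \<longlonglongrightarrow> y0" by real_asymp
    then have "\<forall>\<^sub>F N in sequentially. y0 + s / sqrt (real N) \<in> {a'<..<b'}"
      by (rule topological_tendstoD) (use ends in auto)
    with ends(3) show "\<forall>\<^sub>F N in sequentially. H N (y0 + s / sqrt (real N)) = g N s"
      by eventually_elim (auto simp: g_def)
  qed
  \<comment> \<open>N = 0 has to be skipped, since the substitution divides by sqrt N.\<close>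
  define M' where "M' = Suc M"
  have "(\<lambda>n. integral UNIV (g (n + M'))) \<longlonglongrightarrow> integral UNIV (\<lambda>s. b * exp (- \<gamma> * (of_real s)\<^sup>2))"
  proof (rule dominated_convergence(2))
    show "g (n + M') integrable_on UNIV" for n using g1[of "n + M'"] by (auto simp: M'_def)
    show "(\<lambda>s. C * exp (- c * s\<^sup>2)) integrable_on UNIV"
      by (intro integrable_on_mult_right) (use has_integral_real_gaussian[OF c] in blast)
    show "norm (g (n + M') s) \<le> C * exp (- c * s\<^sup>2)" for n s using g2[of "n + M'" s] by (simp add: M'_def)
    show "(\<lambda>n. g (n + M') s) \<longlonglongrightarrow> b * exp (- \<gamma> * (of_real s)\<^sup>2)" for s
      using LIMSEQ_ignore_initial_segment[OF g3] .
  qed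
  moreover have "integral UNIV (g (n + M')) = of_real (sqrt (real (n + M'))) * integral {A (n + M')..B (n + M')} (H (n + M'))" for n
    by (rule integral_unique, rule g1) (auto simp: M'_def)
  moreover have "integral UNIV (\<lambda>s. b * exp (- \<gamma> * (of_real s)\<^sup>2)) = b * csqrt (pi / \<gamma>)"
    using has_integral_mult_right[OF has_integral_complex_gaussian[OF \<gamma>], of b] by (rule integral_unique)
  ultimately have "(\<lambda>n. of_real (sqrt (real (n + M'))) * integral {A (n + M')..B (n + M')} (H (n + M'))) \<longlonglongrightarrow> b * csqrt (pi / \<gamma>)"
    by (simp only:)
  then show ?thesis by (rule LIMSEQ_offset)
qed

section \<open>The dilogarithm and the midpoint rule\<close>

text \<open>With the value -1 at 0 the integrand of \<open>Li2\<close> is holomorphic on the unit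
  disc, and \<open>Li2\<close> is minus a primitive of it. The point 0 is excluded because the
  quotient takes its default value 0 there, whereas the derivative is 1.\<close>

lemma Li2_has_field_derivative:
  assumes "norm z < 1" "z \<noteq> 0"
  shows "(Li2 has_field_derivative - Ln (1 - z) / z) (at z)"
proof -
  define g :: "complex \<Rightarrow> complex" where "g w = (if w = 0 then -1 else Ln (1 - w) / w)" for w
  have nz: "1 - w \<notin> \<real>\<^sub>\<le>\<^sub>0" if "w \<in> ball 0 1" for w :: complex
  proof
    assume "1 - w \<in> \<real>\<^sub>\<le>\<^sub>0"
    then have "Re (1 - w) \<le> 0" by (auto simp: complex_nonpos_Reals_iff)
    then show False using that complex_Re_le_cmod[of w] by simp
  qed
  have hol: "(\<lambda>w. Ln (1 - w)) holomorphic_on ball 0 1"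
    using nz by (intro holomorphic_intros) auto
  have "((\<lambda>w. Ln (1 - w)) has_field_derivative -1) (at 0)"
    by (auto intro!: derivative_eq_intros)
  then have lim: "((\<lambda>w. Ln (1 - w) / w) \<longlongrightarrow> -1) (at 0)"
    by (simp add: has_field_derivative_iff)
  have g: "g holomorphic_on ball 0 1"
  proof (rule no_isolated_singularity[of _ _ "{0}"])
    show "g holomorphic_on ball 0 1 - {0}"
      by (rule holomorphic_transform[of "\<lambda>w. Ln (1 - w) / w"])
         (auto simp: g_def intro!: holomorphic_intros holomorphic_on_subset[OF hol])
    have "isCont g w" if "w \<in> ball 0 1" for w
    proof (cases "w = 0")
      case True
      have "(g \<longlongrightarrow> -1) (at 0)"
        by (rule Lim_transform_eventually[OF lim]) (auto simp: g_def eventually_at_filter)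
      then show ?thesis by (simp add: True isCont_def) (simp add: g_def)
    next
      case False
      have "g holomorphic_on ball 0 1 - {0}" by fact
      then show ?thesis using False that
        by (intro continuous_on_interior[OF holomorphic_on_imp_continuous_on])
           (auto simp: interior_open open_delete)
    qed
    then show "continuous_on (ball 0 1) g" by (simp add: continuous_at_imp_continuous_on)
  qed auto
  from holomorphic_primitive_exists[OF convex_ball open_ball this]
  obtain G :: "complex \<Rightarrow> complex" where G: "\<forall>x\<in>ball 0 1. (G has_field_derivative g x) (at x)" by blast
  have Li2: "Li2 w = - (G w - G 0)" if w: "w \<in> ball 0 1" "w \<noteq> 0" for w
  proof -
    have "closed_segment 0 w \<subseteq> ball 0 1"
      using w by (intro closed_segment_subset) auto
    then have "(g has_contour_integral (G (pathfinish (linepath 0 w)) - G (pathstart (linepath 0 w)))) (linepath 0 w)"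
      using G by (intro contour_integral_primitive[of "ball 0 1", OF _ valid_path_linepath])
         (auto intro: has_field_derivative_at_within simp only: path_image_linepath)
    then have "((\<lambda>x. g (linepath 0 w x) * (w - 0)) has_integral (G w - G 0)) {0..1}"
      by (simp add: has_contour_integral_linepath)
    then have "((\<lambda>x. Ln (1 - linepath 0 w x) / linepath 0 w x * (w - 0)) has_integral (G w - G 0)) {0..1}"
      by (rule has_integral_spike_finite[of "{0}", rotated 2]) (use w in \<open>auto simp: g_def linepath_def\<close>)
    then have "((\<lambda>w. Ln (1 - w) / w) has_contour_integral (G w - G 0)) (linepath 0 w)"
      by (simp add: has_contour_integral_linepath)
    then show ?thesis unfolding Li2_def by (simp add: contour_integral_unique)
  qed
  have "((\<lambda>w. - (G w - G 0)) has_field_derivative - (g z - 0)) (at z)"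
    using G assms by (intro derivative_intros) auto
  then have "((\<lambda>w. - (G w - G 0)) has_field_derivative - Ln (1 - z) / z) (at z)"
    using assms by (simp add: g_def)
  then show ?thesis
    by (rule has_field_derivative_transform_within_open[of _ _ _ "ball 0 1 - {0}"])
       (use assms Li2 in \<open>auto simp: open_delete\<close>)
qed

text \<open>Taylor expansion at v in both directions: the constant and the quadratic terms cancel in
  the difference, and two cubic remainders B |d|^3 / 2 are left.\<close>

lemma midpoint_increment_bound:
  fixes P F F1 F2 :: "complex \<Rightarrow> complex"
  assumes S: "convex S" "v - d \<in> S" "v \<in> S" "v + d \<in> S"
    and P: "\<And>x. x \<in> S \<Longrightarrow> (P has_field_derivative F x) (at x within S)"
    and F: "\<And>x. x \<in> S \<Longrightarrow> (F has_field_derivative F1 x) (at x within S)"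
    and F1: "\<And>x. x \<in> S \<Longrightarrow> (F1 has_field_derivative F2 x) (at x within S)"
    and B: "\<And>x. x \<in> S \<Longrightarrow> norm (F2 x) \<le> B"
  shows "norm (P (v + d) - P (v - d) - 2 * d * F v) \<le> B * norm d ^ 3"
proof -
  define f where "f i = (if i = 0 then P else if i = Suc 0 then F else if i = 2 then F1 else F2)" for i :: nat
  have T: "norm (f 0 z - (\<Sum>i\<le>2. f i v * (z - v) ^ i / fact i)) \<le> B * norm (z - v) ^ Suc 2 / fact 2" if "z \<in> S" for z
  proof (rule complex_Taylor[OF S(1) _ _ S(3) that])
    show "(f i has_field_derivative f (Suc i) x) (at x within S)" if "x \<in> S" "i \<le> 2" for i x
      using that P F F1 by (cases "i = 0"; cases "i = 1"; cases "i = 2") (auto simp: f_def numeral_2_eq_2)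
    show "cmod (f (Suc 2) x) \<le> B" if "x \<in> S" for x using B that by (simp add: f_def)
  qed
  have s: "(\<Sum>i\<le>2. f i v * (z - v) ^ i / fact i) = P v + F v * (z - v) + F1 v * (z - v)\<^sup>2 / 2" for z
    by (simp add: numeral_2_eq_2 f_def)
  have 1: "norm (P (v + d) - (P v + F v * d + F1 v * d\<^sup>2 / 2)) \<le> B * norm d ^ 3 / 2"
    using T[OF S(4)] unfolding s by (simp add: f_def numeral_3_eq_3 numeral_2_eq_2)
  have 2: "norm (P (v - d) - (P v - F v * d + F1 v * d\<^sup>2 / 2)) \<le> B * norm d ^ 3 / 2"
    using T[OF S(2)] unfolding s by (simp add: f_def numeral_3_eq_3 numeral_2_eq_2)
  have "P (v + d) - P (v - d) - 2 * d * F v = (P (v + d) - (P v + F v * d + F1 v * d\<^sup>2 / 2))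
     - (P (v - d) - (P v - F v * d + F1 v * d\<^sup>2 / 2))" by (simp add: algebra_simps)
  also have "norm \<dots> \<le> B * norm d ^ 3 / 2 + B * norm d ^ 3 / 2"
    by (rule order_trans[OF norm_triangle_ineq4 add_mono[OF 1 2]])
  finally show ?thesis by simp
qed

text \<open>The increments of P over the intervals of length h around l h telescope; after division
  by h each costs B |h|^2 / 8.\<close>

lemma midpoint_rule:
  fixes P F F1 F2 :: "complex \<Rightarrow> complex"
  assumes S: "convex S" "h / 2 \<in> S" "(of_nat k + 1/2) * h \<in> S" and h: "h \<noteq> 0"
    and P: "\<And>x. x \<in> S \<Longrightarrow> (P has_field_derivative F x) (at x within S)"
    and F: "\<And>x. x \<in> S \<Longrightarrow> (F has_field_derivative F1 x) (at x within S)"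
    and F1: "\<And>x. x \<in> S \<Longrightarrow> (F1 has_field_derivative F2 x) (at x within S)"
    and B: "\<And>x. x \<in> S \<Longrightarrow> norm (F2 x) \<le> B"
  shows "norm ((\<Sum>l=1..k. F (of_nat l * h)) - (P ((of_nat k + 1/2) * h) - P (h / 2)) / h) \<le> real k * B * norm h ^ 2 / 8"
proof -
  have inS: "of_real t * h \<in> S" if "1/2 \<le> t" "t \<le> real k + 1/2" for t
  proof (cases "k = 0")
    case True
    then have t: "t = 1/2" using that by simp
    show ?thesis unfolding t using S(2) by simp
  next
    case False
    define s where "s = (t - 1/2) / real k"
    have s: "0 \<le> s" "s \<le> 1" "s * real k = t - 1/2" using that False by (auto simp: s_def field_simps)
    have "(1 - s) *\<^sub>R (h / 2) + s *\<^sub>R ((of_nat k + 1/2) * h) \<in> S"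
      by (rule convexD[OF S]) (use s in auto)
    also have "(1 - s) *\<^sub>R (h / 2) + s *\<^sub>R ((of_nat k + 1/2) * h) = of_real (1/2 + s * real k) * h"
      by (simp add: scaleR_conv_of_real field_simps)
    also have "1/2 + s * real k = t" using s by simp
    finally show ?thesis .
  qed
  have step: "norm (F (of_nat l * h) - (P ((of_nat l + 1/2) * h) - P ((of_nat l - 1/2) * h)) / h) \<le> B * norm h ^ 2 / 8"
    if l: "1 \<le> l" "l \<le> k" for l
  proof -
    have "norm (P (of_nat l * h + h / 2) - P (of_nat l * h - h / 2) - 2 * (h / 2) * F (of_nat l * h)) \<le> B * norm (h / 2) ^ 3"
    proof (rule midpoint_increment_bound[OF S(1) _ _ _ P F F1 B])
      show "of_nat l * h - h / 2 \<in> S" using inS[of "real l - 1/2"] l by (simp add: algebra_simps)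
      show "of_nat l * h \<in> S" using inS[of "real l"] l by (simp add: algebra_simps)
      show "of_nat l * h + h / 2 \<in> S" using inS[of "real l + 1/2"] l by (simp add: algebra_simps)
    qed
    moreover have "(F (of_nat l * h) - (P ((of_nat l + 1/2) * h) - P ((of_nat l - 1/2) * h)) / h) * h
       = - (P (of_nat l * h + h / 2) - P (of_nat l * h - h / 2) - 2 * (h / 2) * F (of_nat l * h))"
    proof -
      have "(of_nat l + 1/2) * h = of_nat l * h + h / 2" "(of_nat l - 1/2) * h = of_nat l * h - h / 2"
        by (simp_all add: algebra_simps)
      moreover have "(X - D / h) * h = - (D - 2 * (h / 2) * X)" for X D using h by (simp add: field_simps)
      ultimately show ?thesis by (simp only:)
    qed
    ultimately have "norm ((F (of_nat l * h) - (P ((of_nat l + 1/2) * h) - P ((of_nat l - 1/2) * h)) / h) * h) \<le> B * norm (h / 2) ^ 3"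
      by (simp only: norm_minus_cancel)
    then have "norm (F (of_nat l * h) - (P ((of_nat l + 1/2) * h) - P ((of_nat l - 1/2) * h)) / h) * norm h \<le> B * norm h ^ 3 / 8"
      by (simp only: norm_mult) (simp add: norm_divide power_divide)
    also have "B * norm h ^ 3 / 8 = B * norm h ^ 2 / 8 * norm h" by (simp add: power3_eq_cube power2_eq_square)
    finally show ?thesis using h by (simp add: mult_le_cancel_right)
  qed
  have tel: "(\<Sum>l=1..k. (P ((of_nat l + 1/2) * h) - P ((of_nat l - 1/2) * h)) / h) = (P ((of_nat k + 1/2) * h) - P (h / 2)) / h"
  proof (induction k)
    case (Suc k)
    have "of_nat (Suc k) - 1/2 = (of_nat k + 1/2 :: complex)" by simp
    then show ?case using Suc by (simp add: diff_divide_distrib add.commute)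
  qed simp
  have "norm ((\<Sum>l=1..k. F (of_nat l * h)) - (P ((of_nat k + 1/2) * h) - P (h / 2)) / h)
     = norm (\<Sum>l=1..k. F (of_nat l * h) - (P ((of_nat l + 1/2) * h) - P ((of_nat l - 1/2) * h)) / h)"
    by (simp only: tel[symmetric] sum_subtractf)
  also have "\<dots> \<le> (\<Sum>l=1..k. B * norm h ^ 2 / 8)"
    by (rule sum_norm_le) (use step in auto)
  finally show ?thesis by simp
qed

section \<open>Holomorphic solutions of a difference equation\<close>

text \<open>The cone avoids the odd multiples of \<pi> i: for Re z \<le> 1 it forces |Im z| <
  \<pi>/2, so that exp z + 1 has real part at least 1, and for Re z > 1 the term exp z outweighs
  1.\<close>

lemma norm_exp_plus_1_ge:
  assumes "\<bar>Im z\<bar> \<le> Re z"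
  shows "norm (exp z + 1) \<ge> exp (Re z) / 3"
proof (cases "Re z \<le> 1")
  case True
  have "cos (Im z) \<ge> 0"
    using assms True pi_gt3 by (intro cos_ge_zero) auto
  then have "1 \<le> Re (exp z + 1)" by (simp add: Re_exp)
  also have "\<dots> \<le> norm (exp z + 1)" by (rule complex_Re_le_cmod)
  finally have "1 \<le> norm (exp z + 1)" .
  moreover have "exp (Re z) \<le> exp 1" using True by simp
  ultimately show ?thesis using exp_le by linarith
next
  case False
  then have "exp (Re z) \<ge> 2" using exp_ge_add_one_self[of "Re z"] by linarith
  moreover have "exp (Re z) - 1 \<le> norm (exp z + 1)"
    using norm_diff_ineq[of "exp z" 1] by simp
  ultimately show ?thesis by linarith
qed

text \<open>The opposite cone is reduced to the first one by exp z + 1 = exp z (exp (- z) +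
  1).\<close>

lemma norm_exp_plus_1_ge':
  assumes "\<bar>Im z\<bar> \<le> \<bar>Re z\<bar>"
  shows "norm (exp z + 1) \<ge> 1 / 3" "norm (exp z + 1) \<ge> exp (Re z) / 3"
proof -
  have "norm (exp z + 1) \<ge> 1 / 3 \<and> norm (exp z + 1) \<ge> exp (Re z) / 3"
  proof (cases "Re z \<ge> 0")
    case True
    then have "norm (exp z + 1) \<ge> exp (Re z) / 3" using norm_exp_plus_1_ge[of z] assms by simp
    moreover have "exp (Re z) \<ge> 1" using True by simp
    ultimately show ?thesis by linarith
  next
    case False
    then have "norm (exp (- z) + 1) \<ge> exp (Re (- z)) / 3" using norm_exp_plus_1_ge[of "- z"] assms by simp
    then have "norm (exp z) * norm (exp (- z) + 1) \<ge> norm (exp z) * (exp (Re (- z)) / 3)"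
      by (intro mult_left_mono) auto
    moreover have "norm (exp z) * norm (exp (- z) + 1) = norm (exp z + 1)"
      by (simp add: norm_mult[symmetric] ring_distribs exp_minus del: norm_exp_eq_Re) (simp add: add.commute)
    moreover have "norm (exp z) * (exp (Re (- z)) / 3) = 1 / 3"
      by (simp add: exp_minus)
    moreover have "exp (Re z) \<le> 1" using False by simp
    ultimately show ?thesis by linarith
  qed
  then show "norm (exp z + 1) \<ge> 1 / 3" "norm (exp z + 1) \<ge> exp (Re z) / 3" by auto
qed

lemma contour_integral_horizontal:
  assumes "R > 0" "continuous_on {0..R} (\<lambda>t. f (c + of_real t))"
  shows "(f has_contour_integral integral {0..R} (\<lambda>t. f (c + of_real t))) (linepath c (c + of_real R))"
proof -
  have "((\<lambda>t. f (c + of_real t)) has_integral integral {0..R} (\<lambda>t. f (c + of_real t))) {0..R}"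
    using assms(2) by (intro integrable_integral integrable_continuous_real)
  from has_integral_mult_left[OF has_integral_stretch_real[OF this, of R], of "of_real R"]
  have "((\<lambda>x. f (c + of_real (R * x)) * of_real R) has_integral integral {0..R} (\<lambda>t. f (c + of_real t))) ((\<lambda>x. x / R) ` {0..R})"
    using assms(1) by (simp add: scaleR_conv_of_real)
  moreover have "(\<lambda>x. x / R) ` {0..R} = {0..1}"
    using assms(1) by (simp add: image_divide_atLeastAtMost)
  moreover have "linepath c (c + of_real R) x = c + of_real (R * x)" for x
    by (simp add: linepath_def scaleR_conv_of_real algebra_simps)
  ultimately show ?thesis by (simp add: has_contour_integral_linepath)
qed

lemma integral_t_exp_le:
  fixes a R :: real
  assumes "a > 0" "R > 0"
  shows "((\<lambda>t. t * exp (- a * t)) has_integral (1 / a\<^sup>2 - (R / a + 1 / a\<^sup>2) * exp (- a * R))) {0..R}"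
proof -
  have "((\<lambda>t. - (t / a + 1 / a\<^sup>2) * exp (- a * t)) has_vector_derivative t * exp (- a * t)) (at t within {0..R})" for t
    unfolding has_real_derivative_iff_has_vector_derivative[symmetric]
    by (rule derivative_eq_intros refl | use assms in \<open>simp add: field_simps power2_eq_square\<close>)+
  from fundamental_theorem_of_calculus[OF _ this] show ?thesis using assms by (simp add: algebra_simps)
qed

text \<open>A primitive of the kernel in the half plane where the exponential is small; it serves
  the two slanted sides of the contour around a pole.\<close>

lemma Ln_one_minus_exp_deriv:
  fixes c v V :: complex
  assumes "norm (exp (c * (v - V))) < 1" "c \<noteq> 0"
  shows "((\<lambda>v. Ln (1 - exp (c * (v - V))) / c) has_field_derivative
    - (exp (c * (v - V)) / (1 - exp (c * (v - V))))) (at v)"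
proof -
  define z where "z = exp (c * (v - V))"
  have z: "norm z < 1" using assms(1) by (simp add: z_def)
  have "1 - z \<notin> \<real>\<^sub>\<le>\<^sub>0"
    using z complex_Re_le_cmod[of z] by (auto simp: complex_nonpos_Reals_iff)
  then have 1: "(Ln has_field_derivative inverse (1 - z)) (at (1 - exp (c * (v - V))))"
    unfolding z_def by (rule has_field_derivative_Ln)
  have "((\<lambda>v. 1 - exp (c * (v - V))) has_field_derivative - (z * c)) (at v)"
    unfolding z_def by (auto intro!: derivative_eq_intros)
  from DERIV_cdivide[OF DERIV_chain2[OF 1 this], of c] assms(2) show ?thesis
    unfolding z_def[symmetric] by (simp add: inverse_eq_divide)
qed

text \<open>
  \<open>E\<close> is a holomorphic approximate solution of \<open>E (V + h) - E V = F (V + h)\<close>: the midpoint rule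
  with the correction term of the Abel--Plana formula, the integral being cut off at \<open>R\<close>, which
  costs an error \<open>O(exp (- Re \<kappa> * R))\<close>.
\<close>

locale abel_plana =
  fixes F P :: "complex \<Rightarrow> complex" and b0 b1 R :: real and h \<kappa> :: complex
  assumes F: "F holomorphic_on {v. b0 < Im v \<and> Im v < b1}"
    and P: "\<And>v. b0 < Im v \<Longrightarrow> Im v < b1 \<Longrightarrow> (P has_field_derivative F v) (at v)"
    and R: "R > 0" and h: "Im h > 0" and lam: "\<kappa> * h = 2 * of_real pi * \<i>" "\<bar>Im \<kappa>\<bar> \<le> Re \<kappa>"
begin

abbreviation "W \<equiv> {v. b0 < Im v \<and> Im v < b1}"

text \<open>On a line halfway between two lattice points the kernel 1 / (exp (\<kappa> s) - 1) turns
  into - 1 / (exp (\<kappa> t) + 1), which has no pole for real t. This is the origin of the sign +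
  in the denominator.\<close>

definition "X c = integral {0..R} (\<lambda>t. (F (c + of_real t) - F (c - of_real t)) / (exp (\<kappa> * of_real t) + 1))"

definition "E V = (P (V + h / 2) + X (V + h / 2)) / h"

lemma W_open: "open W"
  by (simp add: Collect_conj_eq open_Int open_halfspace_Im_lt open_halfspace_Im_gt)

lemma W_convex: "convex W"
  by (simp add: Collect_conj_eq convex_Int convex_halfspace_Im_lt convex_halfspace_Im_gt)

lemma h_nz: "h \<noteq> 0" and kappa_nz: "\<kappa> \<noteq> 0" and Re_kappa: "Re \<kappa> > 0"
proof -
  show "h \<noteq> 0" using h by auto
  show n: "\<kappa> \<noteq> 0" using lam(1) by auto
  show "Re \<kappa> > 0" using lam(2) n by (cases "Re \<kappa> = 0") (auto simp: complex_eq_iff)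
qed

lemma kernel_ge: "t \<ge> 0 \<Longrightarrow> norm (exp (\<kappa> * of_real t) + 1) \<ge> exp (Re \<kappa> * t) / 3"
  using norm_exp_plus_1_ge[of "\<kappa> * of_real t"] lam(2) by (simp add: abs_mult mult_right_mono)

lemma kernel_nz: "t \<ge> 0 \<Longrightarrow> exp (\<kappa> * of_real t) + 1 \<noteq> 0"
proof
  assume "t \<ge> 0" "exp (\<kappa> * of_real t) + 1 = 0"
  then have "0 \<ge> exp (Re \<kappa> * t) / 3" using kernel_ge[of t] by simp
  then show False using exp_gt_zero[of "Re \<kappa> * t"] by linarith
qed

lemma F_cont: "continuous_on A g \<Longrightarrow> g ` A \<subseteq> W \<Longrightarrow> continuous_on A (\<lambda>x. F (g x))"
  by (rule continuous_on_compose2[OF holomorphic_on_imp_continuous_on[OF F]])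

lemma X_holomorphic: "X holomorphic_on W"
proof -
  have dF: "(F has_field_derivative deriv F v) (at v)" if "v \<in> W" for v
    using F W_open that by (rule holomorphic_derivI)
  have cdF: "continuous_on W (deriv F)"
    by (intro holomorphic_on_imp_continuous_on holomorphic_deriv F W_open)
  let ?f = "\<lambda>c t. (F (c + of_real t) - F (c - of_real t)) / (exp (\<kappa> * of_real t) + 1)"
  let ?f' = "\<lambda>c t. (deriv F (c + of_real t) - deriv F (c - of_real t)) / (exp (\<kappa> * of_real t) + 1)"
  have "(\<lambda>c. integral (cbox 0 R) (?f c)) holomorphic_on W"
  proof (rule leibniz_rule_holomorphic[where fx = ?f'])
    show "((\<lambda>x. ?f x t) has_field_derivative ?f' x t) (at x within W)" if "x \<in> W" for x t
    proof -
      have 1: "((\<lambda>x. F (x + of_real t)) has_field_derivative deriv F (x + of_real t)) (at x)"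
        using dF[of "x + of_real t"] that by (simp add: DERIV_shift)
      have "((\<lambda>x. F (x + of_real (- t))) has_field_derivative deriv F (x + of_real (- t))) (at x)"
        using dF[of "x + of_real (- t)"] that by (simp only: DERIV_shift) simp
      then have 2: "((\<lambda>x. F (x - of_real t)) has_field_derivative deriv F (x - of_real t)) (at x)" by simp
      show ?thesis
        by (rule has_field_derivative_at_within, rule DERIV_cdivide, rule DERIV_diff[OF 1 2])
    qed
    show "?f x integrable_on cbox 0 R" if "x \<in> W" for x
      using that kernel_nz
      by (intro integrable_continuous continuous_intros F_cont) auto
    have c: "continuous_on A (\<lambda>x. deriv F (g x))" if "continuous_on A g" "g ` A \<subseteq> W" for g :: "complex \<times> real \<Rightarrow> complex" and A
      by (rule continuous_on_compose2[OF cdF that])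
    show "continuous_on (W \<times> cbox 0 R) (\<lambda>(x, t). ?f' x t)"
      using kernel_nz unfolding case_prod_beta
      by (intro continuous_intros c) auto
  qed (rule W_convex)
  then show ?thesis by (simp add: X_def[abs_def])
qed

text \<open>The numerator is at most 2 t M by the mean value inequality, the denominator is at least
  exp (Re \<kappa> t) / 3, and the integral of t exp (- a t) is at most 1 / a^2. With Re \<kappa> of
  order N and h of order 1/N this makes X / h of order 1/N.\<close>

lemma X_bound:
  assumes "c \<in> W" and M: "\<And>t. \<bar>t\<bar> \<le> R \<Longrightarrow> norm (deriv F (c + of_real t)) \<le> M"
  shows "norm (X c) \<le> 6 * M / (Re \<kappa>)\<^sup>2"
proof -
  have M0: "M \<ge> 0" using order_trans[OF norm_ge_zero M[of 0]] R by simp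
  have dF: "(F has_field_derivative deriv F v) (at v)" if "v \<in> W" for v
    using F W_open that by (rule holomorphic_derivI)
  have diff: "norm (F (c + of_real t) - F (c - of_real t)) \<le> M * (2 * t)" if t: "t \<in> {0..R}" for t
  proof -
    have "norm (F (c + of_real t) - F (c - of_real t)) \<le> M * norm ((c + of_real t) - (c - of_real t))"
    proof (rule field_differentiable_bound[of "closed_segment (c - of_real t) (c + of_real t)"])
      have *: "\<exists>s. \<bar>s\<bar> \<le> R \<and> z = c + of_real s" if z: "z \<in> closed_segment (c - of_real t) (c + of_real t)" for z
      proof -
        from z obtain r where r: "0 \<le> r" "r \<le> 1" "z = (1 - r) *\<^sub>R (c - of_real t) + r *\<^sub>R (c + of_real t)"
          by (auto simp: in_segment)
        have "z = c + of_real ((2 * r - 1) * t)"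
          unfolding r(3) by (simp add: scaleR_conv_of_real algebra_simps)
        moreover have "\<bar>(2 * r - 1) * t\<bar> \<le> 1 * R"
          unfolding abs_mult using r t by (intro mult_mono) auto
        ultimately show ?thesis by auto
      qed
      fix z assume z: "z \<in> closed_segment (c - of_real t) (c + of_real t)"
      from *[OF z] obtain s where s: "\<bar>s\<bar> \<le> R" "z = c + of_real s" by blast
      show "norm (deriv F z) \<le> M" using M s by simp
      show "(F has_field_derivative deriv F z) (at z within closed_segment (c - of_real t) (c + of_real t))"
        using dF[of z] s assms(1) by (simp add: has_field_derivative_at_within)
    qed auto
    also have "norm ((c + of_real t) - (c - of_real t)) = 2 * t"
      using t by (simp add: norm_mult[of 2 "complex_of_real t", simplified] mult_2[symmetric] flip: of_real_add)
    finally show ?thesis .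
  qed
  have int: "(\<lambda>t. (F (c + of_real t) - F (c - of_real t)) / (exp (\<kappa> * of_real t) + 1)) integrable_on {0..R}"
    using assms(1) kernel_nz by (intro integrable_continuous_real continuous_intros F_cont) auto
  note I = integral_t_exp_le[OF Re_kappa R]
  have "norm (X c) \<le> integral {0..R} (\<lambda>t. 6 * M * (t * exp (- Re \<kappa> * t)))"
    unfolding X_def
  proof (rule integral_norm_bound_integral[OF int])
    show "(\<lambda>t. 6 * M * (t * exp (- Re \<kappa> * t))) integrable_on {0..R}"
      using I by (intro integrable_on_mult_right) auto
    fix t assume t: "t \<in> {0..R}"
    have "norm ((F (c + of_real t) - F (c - of_real t)) / (exp (\<kappa> * of_real t) + 1))
        \<le> M * (2 * t) / (exp (Re \<kappa> * t) / 3)"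
      unfolding norm_divide using t M0 by (intro frac_le diff kernel_ge) auto
    also have "\<dots> = 6 * M * (t * exp (- Re \<kappa> * t))" by (simp add: exp_minus field_simps)
    finally show "norm ((F (c + of_real t) - F (c - of_real t)) / (exp (\<kappa> * of_real t) + 1)) \<le> 6 * M * (t * exp (- Re \<kappa> * t))" .
  qed
  also have "\<dots> = 6 * M * (1 / (Re \<kappa>)\<^sup>2 - (R / Re \<kappa> + 1 / (Re \<kappa>)\<^sup>2) * exp (- Re \<kappa> * R))"
    using has_integral_mult_right[OF I, of "6 * M"] by (rule integral_unique)
  also have "\<dots> \<le> 6 * M * (1 / (Re \<kappa>)\<^sup>2)"
    using M0 Re_kappa R by (intro mult_left_mono) auto
  finally show ?thesis by simp
qed

section \<open>The h-periodic kernel and the contour around one of its poles\<close>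

definition "K s = 1 / (exp (\<kappa> * s) - 1)"

lemma exp_shift: "exp (\<kappa> * (s + h)) = exp (\<kappa> * s)"
  using lam(1) by (simp add: ring_distribs exp_add)

lemma exp_half: "exp (\<kappa> * (h / 2)) = - 1"
proof -
  have "\<kappa> * (h / 2) = of_real pi * \<i>" using lam(1) by simp
  then show ?thesis by (simp add: exp_eq_polar)
qed

lemma K_periodic: "K (s + h) = K s"
  by (simp add: K_def exp_shift)

lemma exp_horizontal: "exp (\<kappa> * (h / 2 + s)) = - exp (\<kappa> * s)"
  by (simp only: ring_distribs(1) exp_add exp_half) simp

text \<open>At distance t to the right of the centre the kernel is - 1 / (exp (\<kappa> t) + 1), at
  distance t to the left it is - 1 + 1 / (exp (\<kappa> t) + 1). The constant - 1 produces the
  increment of P, the rest is - X.\<close>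

lemma horizontal_integral:
  assumes c: "V + h / 2 \<in> W"
  shows "contour_integral (linepath (V + h / 2 - of_real R) (V + h / 2 + of_real R)) (\<lambda>v. F v * K (v - V))
     = P (V + h / 2 - of_real R) - P (V + h / 2) - X (V + h / 2)"
proof -
  define c where "c = V + h / 2"
  have cW: "c \<in> W" using c by (simp add: c_def)
  let ?G = "\<lambda>v. F v * K (v - V)"
  have G1: "?G (c + of_real t) = - (F (c + of_real t) / (exp (\<kappa> * of_real t) + 1))" for t
  proof -
    have "c + of_real t - V = h / 2 + of_real t" by (simp add: c_def)
    then have "exp (\<kappa> * (c + of_real t - V)) = - exp (\<kappa> * of_real t)"
      by (simp only: exp_horizontal)
    moreover have "1 / (- z - 1) = - (1 / (z + 1))" for z :: complex
      by (metis minus_add_distrib minus_divide_right diff_conv_add_uminus)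
    ultimately show ?thesis by (simp add: K_def)
  qed
  have G2: "?G (c - of_real t) = - F (c - of_real t) + F (c - of_real t) / (exp (\<kappa> * of_real t) + 1)"
    if t: "t \<ge> 0" for t
  proof -
    have "c - of_real t - V = h / 2 + of_real (- t)" by (simp add: c_def)
    then have "exp (\<kappa> * (c - of_real t - V)) = - (1 / exp (\<kappa> * of_real t))"
      by (simp only: exp_horizontal) (simp add: exp_minus inverse_eq_divide)
    moreover have "1 / (- (1 / z) - 1) = - 1 + 1 / (z + 1)" if "z \<noteq> 0" "z + 1 \<noteq> 0" for z :: complex
    proof -
      have "- (1 / z) - 1 = - ((z + 1) / z)" using that by (simp add: field_simps)
      then have "1 / (- (1 / z) - 1) = - (z / (z + 1))" using that by simp
      also have "\<dots> = - 1 + 1 / (z + 1)" using that by (simp add: field_simps)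
      finally show ?thesis .
    qed
    ultimately have "K (c - of_real t - V) = - 1 + 1 / (exp (\<kappa> * of_real t) + 1)"
      using kernel_nz[OF t] by (simp add: K_def)
    then show ?thesis by (simp add: ring_distribs)
  qed
  have cont1: "continuous_on {0..R} (\<lambda>t. ?G (c + of_real t))"
    unfolding G1 using cW kernel_nz by (intro continuous_intros F_cont) auto
  have cont2: "continuous_on {0..R} (\<lambda>t. ?G (c - of_real t))"
  proof (subst continuous_on_cong[OF refl G2])
    show "continuous_on {0..R} (\<lambda>t. - F (c - of_real t) + F (c - of_real t) / (exp (\<kappa> * of_real t) + 1))"
      using cW kernel_nz by (intro continuous_intros F_cont) auto
  qed simp
  have J1: "(?G has_contour_integral integral {0..R} (\<lambda>t. ?G (c + of_real t))) (linepath c (c + of_real R))"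
    by (rule contour_integral_horizontal[OF R cont1])
  have J2: "(?G has_contour_integral integral {0..R} (\<lambda>t. ?G (c - of_real t))) (linepath (c - of_real R) c)"
  proof -
    have "((\<lambda>v. ?G (c - (v - c))) has_contour_integral integral {0..R} (\<lambda>t. ?G (c - (c + of_real t - c)))) (linepath c (c + of_real R))"
      by (rule contour_integral_horizontal[OF R]) (use cont2 in simp)
    then have "((\<lambda>x. ?G (c - (linepath c (c + of_real R) x - c)) * of_real R) has_integral integral {0..R} (\<lambda>t. ?G (c - of_real t))) {0..1}"
      by (simp add: has_contour_integral_linepath)
    moreover have "c - (linepath c (c + of_real R) x - c) = linepath c (c - of_real R) x" for x
      by (simp add: linepath_def scaleR_conv_of_real algebra_simps)
    ultimately have "((\<lambda>x. ?G (linepath c (c - of_real R) x) * of_real R) has_integral integral {0..R} (\<lambda>t. ?G (c - of_real t))) {0..1}"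
      by simp
    from has_integral_neg[OF this]
    have "(?G has_contour_integral - integral {0..R} (\<lambda>t. ?G (c - of_real t))) (linepath c (c - of_real R))"
      by (simp add: has_contour_integral_linepath)
    from has_contour_integral_reversepath[OF _ this] show ?thesis by simp
  qed
  have dP: "((\<lambda>t. - P (c - of_real t)) has_vector_derivative F (c - of_real t)) (at t within {0..R})" for t
  proof -
    have "((\<lambda>z. - P (c - z)) has_field_derivative - (F (c - of_real t) * (0 - 1))) (at (of_real t))"
      by (rule DERIV_minus, rule DERIV_chain2[OF P]) (use cW in \<open>auto intro!: derivative_eq_intros\<close>)
    from has_vector_derivative_real_field[OF this] show ?thesis by (simp add: has_vector_derivative_at_within)
  qed
  have IP: "((\<lambda>t. F (c - of_real t)) has_integral (P c - P (c - of_real R))) {0..R}"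
    using fundamental_theorem_of_calculus[OF _ dP] R by simp
  have IX: "((\<lambda>t. (F (c + of_real t) - F (c - of_real t)) / (exp (\<kappa> * of_real t) + 1)) has_integral X c) {0..R}"
    unfolding X_def using cW kernel_nz
    by (intro integrable_integral integrable_continuous_real continuous_intros F_cont) auto
  have "((\<lambda>t. ?G (c + of_real t) + ?G (c - of_real t)) has_integral (- X c - (P c - P (c - of_real R)))) {0..R}"
  proof (rule has_integral_eq[OF _ has_integral_diff[OF has_integral_neg[OF IX] IP]])
    fix t assume t: "t \<in> {0..R}"
    then have "t \<ge> 0" by simp
    show "- ((F (c + of_real t) - F (c - of_real t)) / (exp (\<kappa> * of_real t) + 1)) - F (c - of_real t)
      = ?G (c + of_real t) + ?G (c - of_real t)"
      unfolding G1 G2[OF \<open>t \<ge> 0\<close>] by (simp add: diff_divide_distrib)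
  qed
  then have "integral {0..R} (\<lambda>t. ?G (c + of_real t) + ?G (c - of_real t)) = - X c - (P c - P (c - of_real R))"
    by (rule integral_unique)
  moreover have "integral {0..R} (\<lambda>t. ?G (c + of_real t) + ?G (c - of_real t))
     = integral {0..R} (\<lambda>t. ?G (c + of_real t)) + integral {0..R} (\<lambda>t. ?G (c - of_real t))"
    by (intro integral_add integrable_continuous_real cont1 cont2)
  moreover have "contour_integral (linepath (c - of_real R) (c + of_real R)) ?G
     = integral {0..R} (\<lambda>t. ?G (c - of_real t)) + integral {0..R} (\<lambda>t. ?G (c + of_real t))"
  proof -
    have "(?G has_contour_integral integral {0..R} (\<lambda>t. ?G (c - of_real t)) + integral {0..R} (\<lambda>t. ?G (c + of_real t)))
      (linepath (c - of_real R) (c + of_real R))"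
      by (rule has_contour_integral_split[OF J2 J1, of "1/2"]) (simp_all add: scaleR_conv_of_real)
    then show ?thesis by (rule contour_integral_unique)
  qed
  ultimately have "contour_integral (linepath (c - of_real R) (c + of_real R)) ?G
      = - X c - (P c - P (c - of_real R))"
    by (simp only: add.commute)
  then show ?thesis unfolding c_def[symmetric] by simp
qed

text \<open>The solutions are V + n h with n an integer, and the open strip of height 2 Im h leaves
  only n = 1.\<close>

lemma exp_eq_1_strip:
  assumes "exp (\<kappa> * (v - V)) = 1" "Im V < Im v" "Im v < Im V + 2 * Im h"
  shows "v = V + h"
proof -
  from assms(1) obtain n :: int where "Re (\<kappa> * (v - V)) = 0" "Im (\<kappa> * (v - V)) = of_int (2 * n) * pi"
    unfolding exp_eq_1 by blast
  then have n: "\<kappa> * (v - V) = of_int n * (2 * of_real pi * \<i>)"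
    by (simp add: complex_eq_iff)
  then have "\<kappa> * (v - V) = \<kappa> * (of_int n * h)" by (simp add: lam(1)[symmetric])
  then have e: "v - V = of_int n * h" using kappa_nz by simp
  have "Im v - Im V = Im (of_int n * h)" by (simp only: e[symmetric] minus_complex.simps)
  then have "Im v - Im V = of_int n * Im h" by simp
  with assms have q: "0 < of_int n * Im h" "of_int n * Im h < 2 * Im h" by linarith+
  have "real_of_int n < 2" using mult_right_less_imp_less[OF q(2)] h by simp
  moreover have "real_of_int n > 0" using q(1) h by (simp add: zero_less_mult_iff)
  ultimately have "n = 1" by simp
  then show ?thesis using e by (simp add: algebra_simps)
qed

text \<open>Subtracting F (V + h) makes the pole of the kernel removable, so that Cauchy's theorem
  for convex sets applies. The integrals of the kernel alone can then be evaluated by explicit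
  primitives, which spares winding numbers of a slanted parallelogram.\<close>

lemma kernel_cauchy:
  assumes V: "b0 \<le> Im V" "Im V + 2 * Im h \<le> b1"
  defines "U \<equiv> {v. Im V < Im v \<and> Im v < Im V + 2 * Im h}"
  assumes A: "A1 \<in> U" "A2 \<in> U" "A3 \<in> U" "A4 \<in> U"
    and edges: "V + h \<notin> closed_segment A1 A2" "V + h \<notin> closed_segment A2 A3"
      "V + h \<notin> closed_segment A3 A4" "V + h \<notin> closed_segment A4 A1"
  shows "contour_integral (linepath A1 A2) (\<lambda>v. (F v - F (V + h)) * K (v - V)) +
    contour_integral (linepath A2 A3) (\<lambda>v. (F v - F (V + h)) * K (v - V)) +
    contour_integral (linepath A3 A4) (\<lambda>v. (F v - F (V + h)) * K (v - V)) +
    contour_integral (linepath A4 A1) (\<lambda>v. (F v - F (V + h)) * K (v - V)) = 0"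
proof -
  define p where "p = V + h"
  \<comment> \<open>The value at the pole is the limit: the derivative of F over that of exp
    (\<kappa> (v - V)), which is \<kappa> there.\<close>
  define D where "D v = (if v = p then deriv F p / \<kappa> else (F v - F p) * K (v - V))" for v
  have UW: "U \<subseteq> W" using V by (auto simp: U_def)
  have pU: "p \<in> U" using h by (simp add: U_def p_def)
  have Uo: "open U"
    by (simp add: U_def Collect_conj_eq open_Int open_halfspace_Im_lt open_halfspace_Im_gt)
  have Uc: "convex U"
    by (simp add: U_def Collect_conj_eq convex_Int convex_halfspace_Im_lt convex_halfspace_Im_gt)
  have nz: "exp (\<kappa> * (v - V)) - 1 \<noteq> 0" if "v \<in> U - {p}" for v
    using exp_eq_1_strip[of v V] that by (auto simp: U_def p_def)
  have hol: "D holomorphic_on U - {p}"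
  proof (rule holomorphic_transform)
    show "(\<lambda>v. (F v - F p) * K (v - V)) holomorphic_on U - {p}"
      unfolding K_def using nz UW by (intro holomorphic_intros holomorphic_on_subset[OF F]) auto
  qed (auto simp: D_def)
  have "isCont D v" if v: "v \<in> U" for v
  proof (cases "v = p")
    case True
    have "((\<lambda>v. (F v - F p) / (v - p)) \<longlongrightarrow> deriv F p) (at p)"
      using holomorphic_derivI[OF F W_open, of p] pU UW by (auto simp: has_field_derivative_iff)
    moreover have "((\<lambda>v. (exp (\<kappa> * (v - V)) - 1) / (v - p)) \<longlongrightarrow> \<kappa>) (at p)"
    proof -
      have "((\<lambda>v. exp (\<kappa> * (v - V))) has_field_derivative exp (\<kappa> * (p - V)) * \<kappa>) (at p)"
        by (auto intro!: derivative_eq_intros)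
      moreover have "exp (\<kappa> * (p - V)) = 1" using exp_shift[of 0] by (simp add: p_def)
      ultimately show ?thesis by (simp add: has_field_derivative_iff)
    qed
    ultimately have "((\<lambda>v. ((F v - F p) / (v - p)) / ((exp (\<kappa> * (v - V)) - 1) / (v - p))) \<longlongrightarrow> deriv F p / \<kappa>) (at p)"
      by (rule tendsto_divide) (rule kappa_nz)
    then have "(D \<longlongrightarrow> deriv F p / \<kappa>) (at p)"
      by (rule Lim_transform_eventually) (auto simp: D_def K_def eventually_at_filter)
    then show ?thesis by (simp add: True isCont_def) (simp add: D_def)
  next
    case False
    then show ?thesis using hol v Uo
      by (intro continuous_on_interior[OF holomorphic_on_imp_continuous_on[OF hol]]) (auto simp: interior_open open_delete)
  qed
  then have cD: "continuous_on U D" by (simp add: continuous_at_imp_continuous_on)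
  have seg: "closed_segment a b \<subseteq> U" if "a \<in> U" "b \<in> U" for a b
    using that Uc by (simp add: closed_segment_subset)
  have int: "(D has_contour_integral contour_integral (linepath a b) (\<lambda>v. (F v - F p) * K (v - V))) (linepath a b)"
    if "a \<in> U" "b \<in> U" "p \<notin> closed_segment a b" for a b
  proof -
    have "(D has_contour_integral contour_integral (linepath a b) D) (linepath a b)"
      by (intro has_contour_integral_integral contour_integrable_continuous_linepath continuous_on_subset[OF cD] seg that)
    moreover have "contour_integral (linepath a b) D = contour_integral (linepath a b) (\<lambda>v. (F v - F p) * K (v - V))"
      by (rule contour_integral_cong) (use that in \<open>auto simp: D_def\<close>)
    ultimately show ?thesis by simp
  qed
  have vp: "valid_path (linepath A1 A2 +++ linepath A2 A3 +++ linepath A3 A4 +++ linepath A4 A1)"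
    by simp
  have C1: "(D has_contour_integral 0) (linepath A1 A2 +++ linepath A2 A3 +++ linepath A3 A4 +++ linepath A4 A1)"
  proof (rule Cauchy_theorem_convex[OF cD Uc, of "{p}"])
    show "D field_differentiable at x" if "x \<in> interior U - {p}" for x
      using hol that Uo by (auto simp: interior_open open_delete holomorphic_on_imp_differentiable_at)
    show "path_image (linepath A1 A2 +++ linepath A2 A3 +++ linepath A3 A4 +++ linepath A4 A1) \<subseteq> U"
      using seg A by (simp add: path_image_join)
  qed auto
  have C2: "(D has_contour_integral (contour_integral (linepath A1 A2) (\<lambda>v. (F v - F p) * K (v - V)) +
    (contour_integral (linepath A2 A3) (\<lambda>v. (F v - F p) * K (v - V)) +
    (contour_integral (linepath A3 A4) (\<lambda>v. (F v - F p) * K (v - V)) +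
    contour_integral (linepath A4 A1) (\<lambda>v. (F v - F p) * K (v - V))))))
     (linepath A1 A2 +++ linepath A2 A3 +++ linepath A3 A4 +++ linepath A4 A1)"
    using edges A by (intro has_contour_integral_join int) (auto simp: p_def)
  show ?thesis
    using has_contour_integral_unique[OF C2 C1] unfolding p_def by (simp only: add.assoc)
qed

text \<open>F times the kernel is integrated over the parallelogram with centre V + h and sides h
  and 2 R. The pole gives h F (V + h). The two rows give h (E (V + h) - E V) and two boundary values
  of P, which the left side cancels since the kernel is close to - 1 there. The deviation on the
  left and the whole right side are of order exp (- Re \<kappa> R).\<close>

lemma E_functional_equation:
  assumes V: "b0 < Im V" "Im V + 2 * Im h < b1" and eR: "exp (- Re \<kappa> * R) \<le> 1 / 2"
    and B: "\<And>s. 0 \<le> s \<Longrightarrow> s \<le> 1 \<Longrightarrow> norm (F (V + h / 2 - of_real R + of_real s * h)) \<le> B"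
      "\<And>s. 0 \<le> s \<Longrightarrow> s \<le> 1 \<Longrightarrow> norm (F (V + h / 2 + of_real R + of_real s * h)) \<le> B"
  shows "norm (E (V + h) - E V - F (V + h)) \<le> 4 * B * exp (- Re \<kappa> * R)"
proof -
  define c p where "c = V + h / 2" and "p = V + h"
  define A1 A2 A3 A4 where "A1 = c - of_real R" and "A2 = c + of_real R"
    and "A3 = c + h + of_real R" and "A4 = c + h - of_real R"
  define \<epsilon> where "\<epsilon> = exp (- Re \<kappa> * R)"
  have \<epsilon>: "0 < \<epsilon>" "\<epsilon> \<le> 1 / 2" using eR by (auto simp: \<epsilon>_def)
  have e1: "1 / \<epsilon> > 1" "\<epsilon> < 1" using \<epsilon> by auto
  let ?J = "\<lambda>a b. contour_integral (linepath a b) (\<lambda>v. F v * K (v - V))"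
  let ?k = "\<lambda>a b. contour_integral (linepath a b) (\<lambda>v. K (v - V))"
  let ?U = "{v. Im V < Im v \<and> Im v < Im V + 2 * Im h}"
  have cW: "c \<in> W" "c + h \<in> W" using V h by (auto simp: c_def)
  have Im_hor: "Im v = Im a" if "v \<in> closed_segment a b" "Im b = Im a" for a b v
  proof -
    from that(1) obtain t where t: "v = (1 - t) *\<^sub>R a + t *\<^sub>R b" by (auto simp: in_segment)
    show ?thesis unfolding t using that(2) by (simp add: algebra_simps)
  qed
  have side: "\<exists>s. 0 \<le> s \<and> s \<le> 1 \<and> v = a + of_real s * h" if "v \<in> closed_segment a (a + h)" for a v
  proof -
    from that obtain t where "0 \<le> t" "t \<le> 1" "v = (1 - t) *\<^sub>R a + t *\<^sub>R (a + h)" by (auto simp: in_segment)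
    then show ?thesis by (intro exI[of _ t]) (simp add: scaleR_conv_of_real algebra_simps)
  qed
  have e_side: "norm (exp (\<kappa> * (c - of_real R + of_real s * h - V))) = \<epsilon>"
     "norm (exp (\<kappa> * (c + of_real R + of_real s * h - V))) = 1 / \<epsilon>" for s
  proof -
    have sh: "\<kappa> * (c + x + of_real s * h - V) = \<kappa> * x + of_real ((1/2 + s) * (2 * pi)) * \<i>" for x
    proof -
      have "\<kappa> * (c + x + of_real s * h - V) = \<kappa> * x + of_real (1/2 + s) * (\<kappa> * h)"
        by (simp add: c_def algebra_simps)
      then show ?thesis unfolding lam(1) by (simp add: algebra_simps)
    qed
    show "norm (exp (\<kappa> * (c - of_real R + of_real s * h - V))) = \<epsilon>"
      using sh[of "- of_real R"] by (simp add: \<epsilon>_def)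
    show "norm (exp (\<kappa> * (c + of_real R + of_real s * h - V))) = 1 / \<epsilon>"
      unfolding sh by (simp add: \<epsilon>_def exp_minus inverse_eq_divide)
  qed
  have left: "\<exists>s. 0 \<le> s \<and> s \<le> 1 \<and> v = V + h / 2 - of_real R + of_real s * h"
     "norm (exp (\<kappa> * (v - V))) = \<epsilon>" if v: "v \<in> closed_segment A1 A4" for v
  proof -
    have "A4 = A1 + h" by (simp add: A1_def A4_def)
    with side[of v A1] v obtain s where s: "0 \<le> s" "s \<le> 1" "v = A1 + of_real s * h" by auto
    then show "\<exists>s. 0 \<le> s \<and> s \<le> 1 \<and> v = V + h / 2 - of_real R + of_real s * h"
      by (auto simp: A1_def c_def)
    show "norm (exp (\<kappa> * (v - V))) = \<epsilon>" unfolding s(3) A1_def by (rule e_side)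
  qed
  have right: "\<exists>s. 0 \<le> s \<and> s \<le> 1 \<and> v = V + h / 2 + of_real R + of_real s * h"
     "norm (exp (\<kappa> * (v - V))) = 1 / \<epsilon>" if v: "v \<in> closed_segment A2 A3" for v
  proof -
    have "A3 = A2 + h" by (simp add: A2_def A3_def)
    with side[of v A2] v obtain s where s: "0 \<le> s" "s \<le> 1" "v = A2 + of_real s * h" by auto
    then show "\<exists>s. 0 \<le> s \<and> s \<le> 1 \<and> v = V + h / 2 + of_real R + of_real s * h"
      by (auto simp: A2_def c_def)
    show "norm (exp (\<kappa> * (v - V))) = 1 / \<epsilon>" unfolding s(3) A2_def by (rule e_side)
  qed
  have AW: "A1 \<in> W" "A2 \<in> W" "A3 \<in> W" "A4 \<in> W"
    using cW by (simp_all add: A1_def A2_def A3_def A4_def)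
  note segW = closed_segment_subset[OF _ _ W_convex]
  note leftW = segW[OF AW(1,4)] and rightW = segW[OF AW(2,3)]
  have hU: "A1 \<in> ?U" "A2 \<in> ?U" "A3 \<in> ?U" "A4 \<in> ?U"
    using h by (auto simp: A1_def A2_def A3_def A4_def c_def)
  have exp_p: "exp (\<kappa> * (p - V)) = 1" using exp_shift[of 0] by (simp add: p_def)
  have edges: "p \<notin> closed_segment A1 A2" "p \<notin> closed_segment A2 A3" "p \<notin> closed_segment A3 A4" "p \<notin> closed_segment A4 A1"
  proof -
    show "p \<notin> closed_segment A1 A2" using Im_hor[of p A1 A2] h by (auto simp: A1_def A2_def c_def p_def)
    show "p \<notin> closed_segment A3 A4" using Im_hor[of p A3 A4] h by (auto simp: A3_def A4_def c_def p_def)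
    show "p \<notin> closed_segment A2 A3" using right(2)[of p] exp_p \<epsilon> by auto
    show "p \<notin> closed_segment A4 A1" using left(2)[of p] exp_p \<epsilon> by (auto simp: closed_segment_commute)
  qed
  have segU: "closed_segment a b \<subseteq> ?U" if "a \<in> ?U" "b \<in> ?U" for a b
  proof (rule closed_segment_subset[OF that])
    show "convex ?U" by (simp add: Collect_conj_eq convex_Int convex_halfspace_Im_lt convex_halfspace_Im_gt)
  qed
  have nz: "exp (\<kappa> * (v - V)) - 1 \<noteq> 0" if "v \<in> ?U" "v \<noteq> p" for v
    using exp_eq_1_strip[of v V] that by (auto simp: p_def)
  have contK: "continuous_on (closed_segment a b) (\<lambda>v. K (v - V))" if "a \<in> ?U" "b \<in> ?U" "p \<notin> closed_segment a b" for a b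
    unfolding K_def using segU[OF that(1,2)] that(3) nz by (intro continuous_intros) blast
  have contF: "continuous_on (closed_segment a b) F" if "a \<in> ?U" "b \<in> ?U" for a b
    by (rule continuous_on_subset[OF holomorphic_on_imp_continuous_on[OF F]]) (use segU[OF that] V in auto)
  have split: "contour_integral (linepath a b) (\<lambda>v. (F v - F p) * K (v - V)) = ?J a b - F p * ?k a b"
    if "a \<in> ?U" "b \<in> ?U" "p \<notin> closed_segment a b" for a b
  proof -
    have 1: "(\<lambda>v. F v * K (v - V)) contour_integrable_on linepath a b"
      by (intro contour_integrable_continuous_linepath continuous_on_mult contF contK that)
    have 2: "(\<lambda>v. K (v - V)) contour_integrable_on linepath a b"
      by (intro contour_integrable_continuous_linepath contK that)
    have "((\<lambda>v. F v * K (v - V) - F p * K (v - V)) has_contour_integral (?J a b - F p * ?k a b)) (linepath a b)"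
      by (intro has_contour_integral_diff has_contour_integral_lmul has_contour_integral_integral 1 2)
    then show ?thesis by (simp add: left_diff_distrib contour_integral_unique)
  qed
  have "contour_integral (linepath A1 A2) (\<lambda>v. (F v - F p) * K (v - V)) +
    contour_integral (linepath A2 A3) (\<lambda>v. (F v - F p) * K (v - V)) +
    contour_integral (linepath A3 A4) (\<lambda>v. (F v - F p) * K (v - V)) +
    contour_integral (linepath A4 A1) (\<lambda>v. (F v - F p) * K (v - V)) = 0"
    unfolding p_def by (rule kernel_cauchy) (use V hU edges in \<open>auto simp: p_def\<close>)
  moreover have "a1 + a2 + a3 + a4 = f * (b1 + b2 + b3 + b4)"
    if "(a1 - f * b1) + (a2 - f * b2) + (a3 - f * b3) + (a4 - f * b4) = 0" for a1 a2 a3 a4 b1 b2 b3 b4 f :: complex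
    using that by algebra
  ultimately have cau: "?J A1 A2 + ?J A2 A3 + ?J A3 A4 + ?J A4 A1 = F p * (?k A1 A2 + ?k A2 A3 + ?k A3 A4 + ?k A4 A1)"
    unfolding split[OF hU(1,2) edges(1)] split[OF hU(2,3) edges(2)] split[OF hU(3,4) edges(3)] split[OF hU(4,1) edges(4)]
    by blast
  have rev: "?J A3 A4 = - ?J A4 A3" "?J A4 A1 = - ?J A1 A4" "?k A3 A4 = - ?k A4 A3" "?k A4 A1 = - ?k A1 A4"
    using contour_integral_reverse_linepath[OF continuous_on_mult[OF contF[OF hU(3,4)] contK[OF hU(3,4) edges(3)]]]
      contour_integral_reverse_linepath[OF continuous_on_mult[OF contF[OF hU(4,1)] contK[OF hU(4,1) edges(4)]]]
      contour_integral_reverse_linepath[OF contK[OF hU(3,4) edges(3)]]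
      contour_integral_reverse_linepath[OF contK[OF hU(4,1) edges(4)]]
    by simp_all
  have k_hor: "?k A4 A3 = ?k A1 A2"
  proof -
    have A: "A4 = A1 + h" "A3 = A2 + h" by (simp_all add: A1_def A2_def A3_def A4_def)
    have "linepath (A1 + h) (A2 + h) x = linepath A1 A2 x + h" for x
      by (simp add: linepath_def scaleR_conv_of_real algebra_simps)
    then have "K (linepath (A1 + h) (A2 + h) x - V) = K (linepath A1 A2 x - V)" for x
      using K_periodic[of "linepath A1 A2 x - V"] by (simp add: algebra_simps)
    then show ?thesis unfolding A contour_integral_integral by simp
  qed
  \<comment> \<open>On this side exp (- \<kappa> (v - V)) is small, and the logarithmic primitive
    has the period h.\<close>
  have k_right: "?k A2 A3 = 0"
  proof -
    let ?S = "{v. norm (exp (\<kappa> * (v - V))) > 1}"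
    let ?L = "\<lambda>v. Ln (1 - exp (- (\<kappa> * (v - V)))) / \<kappa>"
    have "((\<lambda>v. K (v - V)) has_contour_integral (?L (pathfinish (linepath A2 A3)) - ?L (pathstart (linepath A2 A3)))) (linepath A2 A3)"
    proof (rule contour_integral_primitive[OF _ valid_path_linepath])
      fix v assume "v \<in> ?S"
      then have n: "norm (exp (- (\<kappa> * (v - V)))) < 1" by (simp add: exp_minus norm_inverse inverse_less_1_iff)
      define z where "z = exp (- \<kappa> * (v - V))"
      have z: "norm z < 1" "z \<noteq> 0" "exp (\<kappa> * (v - V)) = 1 / z" using n by (auto simp: z_def exp_minus inverse_eq_divide)
      have "((\<lambda>v. - (Ln (1 - exp (- \<kappa> * (v - V))) / - \<kappa>)) has_field_derivative - (- (z / (1 - z)))) (at v)"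
        unfolding z_def by (intro DERIV_minus Ln_one_minus_exp_deriv) (use z kappa_nz in \<open>simp_all add: z_def\<close>)
      then have "(?L has_field_derivative z / (1 - z)) (at v)" by simp
      moreover have "z / (1 - z) = K (v - V)"
      proof -
        have "1 - z \<noteq> 0" using z(1) by auto
        moreover have "1 / z - 1 = (1 - z) / z" using z(2) by (simp add: field_simps)
        ultimately show ?thesis unfolding K_def z(3) by simp
      qed
      ultimately show "(?L has_field_derivative K (v - V)) (at v within ?S)"
        by (simp add: has_field_derivative_at_within)
    next
      show "path_image (linepath A2 A3) \<subseteq> ?S" using right(2) e1 unfolding path_image_linepath by (intro subsetI CollectI) (simp only: right(2) e1)
    qed
    moreover have "A3 - V = A2 - V + h" by (simp add: A2_def A3_def)
    then have "exp (- (\<kappa> * (A3 - V))) = exp (- (\<kappa> * (A2 - V)))"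
      by (simp only: exp_minus exp_shift)
    ultimately show ?thesis by (simp add: contour_integral_unique)
  qed
  \<comment> \<open>The primitive has the additional term - v here. Being the only part without the
    period h, it carries the whole contribution of the pole.\<close>
  have k_left: "?k A1 A4 = - h"
  proof -
    let ?S = "{v. norm (exp (\<kappa> * (v - V))) < 1}"
    let ?L = "\<lambda>v. - v + Ln (1 - exp (\<kappa> * (v - V))) / \<kappa>"
    have "((\<lambda>v. K (v - V)) has_contour_integral (?L (pathfinish (linepath A1 A4)) - ?L (pathstart (linepath A1 A4)))) (linepath A1 A4)"
    proof (rule contour_integral_primitive[OF _ valid_path_linepath])
      fix v assume v: "v \<in> ?S"
      define z where "z = exp (\<kappa> * (v - V))"
      have z: "norm z < 1" using v by (simp add: z_def)
      have "(?L has_field_derivative - 1 + - (z / (1 - z))) (at v)"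
        unfolding z_def by (intro DERIV_add DERIV_minus DERIV_ident Ln_one_minus_exp_deriv) (use z kappa_nz in \<open>simp_all add: z_def\<close>)
      moreover have "- 1 + - (z / (1 - z)) = K (v - V)"
      proof -
        have "1 - z \<noteq> 0" using z by auto
        then have "- 1 + - (z / (1 - z)) = - (1 / (1 - z))" by (simp add: field_simps)
        also have "\<dots> = 1 / (z - 1)" by (metis minus_diff_eq minus_divide_right)
        finally show ?thesis by (simp add: K_def z_def)
      qed
      ultimately show "(?L has_field_derivative K (v - V)) (at v within ?S)"
        by (simp add: has_field_derivative_at_within)
    next
      show "path_image (linepath A1 A4) \<subseteq> ?S" using left(2) e1 unfolding path_image_linepath by (intro subsetI CollectI) (simp only: left(2) e1)
    qed
    moreover have "exp (\<kappa> * (A4 - V)) = exp (\<kappa> * (A1 - V))"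
      using exp_shift[of "A1 - V"] by (simp add: A1_def A4_def algebra_simps)
    ultimately show ?thesis by (simp add: contour_integral_unique) (simp add: A1_def A4_def)
  qed
  have J12: "?J A1 A2 = P (c - of_real R) - P c - X c"
    unfolding A1_def A2_def c_def by (rule horizontal_integral) (use cW in \<open>simp add: c_def\<close>)
  have J43: "?J A4 A3 = P (c + h - of_real R) - P (c + h) - X (c + h)"
  proof -
    have "V + h + h / 2 \<in> W" using cW by (simp add: c_def algebra_simps)
    from horizontal_integral[OF this]
    have "contour_integral (linepath A4 A3) (\<lambda>v. F v * K (v - (V + h))) = P (c + h - of_real R) - P (c + h) - X (c + h)"
      by (simp add: A3_def A4_def c_def algebra_simps)
    moreover have "K (v - (V + h)) = K (v - V)" for v
      using K_periodic[of "v - (V + h)"] by (simp add: algebra_simps)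
    ultimately show ?thesis by simp
  qed
  define el er where "el = contour_integral (linepath A1 A4) (\<lambda>v. F v * (K (v - V) + 1))" and "er = ?J A2 A3"
  have J14: "?J A1 A4 = el - (P (c + h - of_real R) - P (c - of_real R))"
  proof -
    have 1: "(\<lambda>v. F v * K (v - V)) contour_integrable_on linepath A1 A4"
      by (intro contour_integrable_continuous_linepath continuous_on_mult contF contK hU) (use edges in \<open>auto simp: closed_segment_commute\<close>)
    have "(F has_contour_integral (P (pathfinish (linepath A1 A4)) - P (pathstart (linepath A1 A4)))) (linepath A1 A4)"
      by (rule contour_integral_primitive[OF _ valid_path_linepath, of W])
         (use P leftW in \<open>auto intro: has_field_derivative_at_within simp: path_image_linepath\<close>)
    then have 2: "(F has_contour_integral (P (c + h - of_real R) - P (c - of_real R))) (linepath A1 A4)"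
      by (simp add: A1_def A4_def)
    from has_contour_integral_add[OF has_contour_integral_integral[OF 1] 2]
    have "el = ?J A1 A4 + (P (c + h - of_real R) - P (c - of_real R))"
      unfolding el_def by (simp add: ring_distribs contour_integral_unique)
    then show ?thesis by simp
  qed
  have B0: "B \<ge> 0" using order_trans[OF norm_ge_zero B(1)[of 0]] by simp
  have nel: "norm el \<le> B * (2 * \<epsilon>) * norm (A4 - A1)"
    unfolding el_def
  proof (rule contour_integral_bound_linepath)
    show "(\<lambda>v. F v * (K (v - V) + 1)) contour_integrable_on linepath A1 A4"
      by (intro contour_integrable_continuous_linepath continuous_intros contF contK hU) (use edges in \<open>auto simp: closed_segment_commute\<close>)
    show "0 \<le> B * (2 * \<epsilon>)" using B0 \<epsilon> by simp
    fix v assume v: "v \<in> closed_segment A1 A4"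
    define z where "z = exp (\<kappa> * (v - V))"
    have z: "norm z = \<epsilon>" using left(2)[OF v] by (simp add: z_def)
    have d: "norm (z - 1) \<ge> 1 / 2" using norm_triangle_ineq2[of 1 z] z \<epsilon> by (simp add: norm_minus_commute)
    then have "z \<noteq> 1" by auto
    moreover have "K (v - V) = 1 / (z - 1)" by (simp only: K_def z_def)
    ultimately have "K (v - V) + 1 = z / (z - 1)" by (simp add: field_simps)
    then have "norm (K (v - V) + 1) \<le> \<epsilon> / (1 / 2)"
      using d \<epsilon> by (simp only: norm_divide z) (intro frac_le, auto)
    moreover have "norm (F v) \<le> B" using left(1)[OF v] B(1) by blast
    ultimately show "norm (F v * (K (v - V) + 1)) \<le> B * (2 * \<epsilon>)"
      unfolding norm_mult using B0 by (intro mult_mono) auto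
  qed
  have ner: "norm er \<le> B * (2 * \<epsilon>) * norm (A3 - A2)"
    unfolding er_def
  proof (rule contour_integral_bound_linepath)
    show "(\<lambda>v. F v * K (v - V)) contour_integrable_on linepath A2 A3"
      by (intro contour_integrable_continuous_linepath continuous_on_mult contF contK hU edges)
    show "0 \<le> B * (2 * \<epsilon>)" using B0 \<epsilon> by simp
    fix v assume v: "v \<in> closed_segment A2 A3"
    define z where "z = exp (\<kappa> * (v - V))"
    have z: "norm z = 1 / \<epsilon>" using right(2)[OF v] by (simp add: z_def)
    have "norm (z - 1) \<ge> 1 / \<epsilon> - 1" using norm_triangle_ineq2[of z 1] z by simp
    moreover have "1 / \<epsilon> \<ge> 2" using \<epsilon> by (simp add: field_simps)
    ultimately have d: "norm (z - 1) \<ge> 1 / (2 * \<epsilon>)" by (simp add: field_simps)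
    have "K (v - V) = 1 / (z - 1)" by (simp only: K_def z_def)
    then have "norm (K (v - V)) = 1 / norm (z - 1)" by (simp add: norm_divide)
    also have "\<dots> \<le> 1 / (1 / (2 * \<epsilon>))" using d \<epsilon> by (intro frac_le) auto
    finally have "norm (K (v - V)) \<le> 2 * \<epsilon>" by simp
    moreover have "norm (F v) \<le> B" using right(1)[OF v] B(2) by blast
    ultimately show "norm (F v * K (v - V)) \<le> B * (2 * \<epsilon>)"
      unfolding norm_mult using B0 by (intro mult_mono) auto
  qed
  have main: "P (c + h) + X (c + h) - (P c + X c) = h * F p - er + el"
    using cau unfolding rev k_hor k_right k_left J12 J43 J14 er_def[symmetric] by (simp add: algebra_simps)
  have "E (V + h) - E V = (P (c + h) + X (c + h) - (P c + X c)) / h"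
    by (simp add: E_def c_def diff_divide_distrib add_divide_distrib algebra_simps)
  also have "\<dots> = F p + (el - er) / h"
    unfolding main using h_nz by (simp add: field_simps)
  finally have "norm (E (V + h) - E V - F p) = norm (el - er) / norm h"
    by (simp add: norm_divide)
  also have "\<dots> \<le> (B * (2 * \<epsilon>) * norm h + B * (2 * \<epsilon>) * norm h) / norm h"
    using nel ner norm_triangle_ineq4[of el er]
    by (intro divide_right_mono) (auto simp: A1_def A2_def A3_def A4_def)
  also have "\<dots> = 4 * B * \<epsilon>" using h_nz by (simp add: field_simps)
  finally show ?thesis by (simp add: \<epsilon>_def p_def)
qed

end

section \<open>Sums over a lattice as contour integrals\<close>

text \<open>The kernel has residue - 1 / \<kappa> at each lattice point, and 2 \<pi> i / \<kappa> =
  h. The assumptions \<open>out\<close> keep the rectangle strictly between the rows k0 - 1 and k1 +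
  1, so that it encloses exactly the listed points. Only the left side is kept as an integral; the
  other three enter through B.\<close>

lemma lattice_sum_contour:
  fixes T :: "complex \<Rightarrow> complex" and h \<kappa> s :: complex and k0 k1 :: nat
  assumes D: "open D" "convex D" "T holomorphic_on D" "\<And>V. V \<in> D \<Longrightarrow> T V \<noteq> 0"
    and h: "Im h > 0" and lam: "\<kappa> * h = 2 * of_real pi * \<i>"
    and box: "xl < xr" "yb < yt" "cbox (Complex xl yb) (Complex xr yt) \<subseteq> D"
    and pts: "\<And>k. k0 \<le> k \<Longrightarrow> k \<le> k1 \<Longrightarrow> of_nat k * h - s \<in> box (Complex xl yb) (Complex xr yt)"
    and out: "yb > (real k0 - 1) * Im h - Im s" "yt < (real k1 + 1) * Im h - Im s"
  defines "G \<equiv> \<lambda>V. T V / (1 - exp (\<kappa> * (V + s)))"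
  assumes B: "B \<ge> 0"
     "\<And>x. xl \<le> x \<Longrightarrow> x \<le> xr \<Longrightarrow> norm (G (Complex x yb)) \<le> B"
     "\<And>x. xl \<le> x \<Longrightarrow> x \<le> xr \<Longrightarrow> norm (G (Complex x yt)) \<le> B"
     "\<And>y. yb \<le> y \<Longrightarrow> y \<le> yt \<Longrightarrow> norm (G (Complex xr y)) \<le> B"
  shows "continuous_on {yb..yt} (\<lambda>y. G (Complex xl y))"
    "norm (h * (\<Sum>k=k0..k1. T (of_nat k * h - s)) - \<i> * integral {yb..yt} (\<lambda>y. G (Complex xl y)))
     \<le> B * (2 * (xr - xl) + (yt - yb))"
proof -
  define a1 a2 a3 a4 where "a1 = Complex xl yb" and "a2 = Complex xr yb" and "a3 = Complex xr yt" and "a4 = Complex xl yt"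
  define pt where "pt k = of_nat k * h - s" for k :: nat
  \<comment> \<open>A convex neighbourhood of the rectangle that reaches just to the neighbouring
    rows and hence contains no further poles.\<close>
  define S where "S = D \<inter> {V. (real k0 - 1) * Im h - Im s < Im V \<and> Im V < (real k1 + 1) * Im h - Im s}"
  have k_nz: "\<kappa> \<noteq> 0" using lam by auto
  have h_nz: "h \<noteq> 0" using h by auto
  have So: "open S"
    unfolding S_def Collect_conj_eq by (intro open_Int D open_halfspace_Im_lt open_halfspace_Im_gt)
  have Sc: "convex S"
    unfolding S_def Collect_conj_eq by (intro convex_Int D convex_halfspace_Im_lt convex_halfspace_Im_gt)
  have inj: "inj_on pt {k0..k1}" using h_nz by (auto simp: inj_on_def pt_def)
  have exp_pt: "exp (\<kappa> * (pt k + s)) = 1" for k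
  proof -
    have "\<kappa> * (pt k + s) = of_nat k * (\<kappa> * h)" by (simp add: pt_def)
    also have "\<dots> = of_int (int k) * (2 * of_real pi * \<i>)" by (simp add: lam)
    finally show ?thesis by (simp add: exp_integer_2pi mult_ac)
  qed
  have zeros: "V \<in> pt ` {k0..k1}" if V: "V \<in> S" "exp (\<kappa> * (V + s)) = 1" for V
  proof -
    from V(2) obtain n :: int where "Re (\<kappa> * (V + s)) = 0" "Im (\<kappa> * (V + s)) = of_int (2 * n) * pi"
      unfolding exp_eq_1 by blast
    then have "\<kappa> * (V + s) = of_int n * (2 * of_real pi * \<i>)" by (simp add: complex_eq_iff)
    then have "\<kappa> * (V + s) = \<kappa> * (of_int n * h)" by (simp add: lam[symmetric])
    then have "V + s = of_int n * h" using k_nz by (metis mult_left_cancel)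
    then have e: "V = of_int n * h - s" by (simp add: eq_diff_eq)
    then have "Im V = of_int n * Im h - Im s" by simp
    with V(1) have "(real k0 - 1) * Im h < of_int n * Im h" "of_int n * Im h < (real k1 + 1) * Im h"
      by (auto simp: S_def)
    then have "real k0 - 1 < of_int n" "of_int n < real k1 + 1"
      using h by (auto simp: mult_less_cancel_right)
    then have n: "int k0 \<le> n" "n \<le> int k1" by linarith+
    then have "V = pt (nat n)" "nat n \<in> {k0..k1}" using e by (auto simp: pt_def)
    then show ?thesis by blast
  qed
  have ptS: "pt k \<in> S" if "k \<in> {k0..k1}" for k
  proof -
    have "pt k \<in> D" using pts[of k] that box(3) box_subset_cbox[of a1 a3] unfolding pt_def a1_def a3_def by auto
    moreover have "(real k0 - 1) * Im h < real k * Im h" "real k * Im h < (real k1 + 1) * Im h"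
      using that h by (auto intro!: mult_strict_right_mono)
    ultimately show ?thesis by (simp add: S_def pt_def)
  qed
  have hol: "G holomorphic_on S - pt ` {k0..k1}"
    unfolding G_def using zeros
    by (intro holomorphic_intros holomorphic_on_subset[OF D(3)]) (auto simp: S_def)
  have res: "residue G (pt k) = - T (pt k) / \<kappa>" if k: "k \<in> {k0..k1}" for k
  proof -
    have "residue (\<lambda>V. T V / (1 - exp (\<kappa> * (V + s)))) (pt k) = T (pt k) / - (exp (\<kappa> * (pt k + s)) * \<kappa>)"
    proof (rule residue_simple_pole_deriv[where s = S])
      show "connected S" using Sc by (rule convex_connected)
      show "T holomorphic_on S" by (rule holomorphic_on_subset[OF D(3)]) (auto simp: S_def)
      show "(\<lambda>V. 1 - exp (\<kappa> * (V + s))) holomorphic_on S" by (intro holomorphic_intros)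
      show "T (pt k) \<noteq> 0" using ptS[OF k] D(4) by (auto simp: S_def)
      show "((\<lambda>V. 1 - exp (\<kappa> * (V + s))) has_field_derivative - (exp (\<kappa> * (pt k + s)) * \<kappa>)) (at (pt k))"
        by (auto intro!: derivative_eq_intros)
    qed (use So ptS[OF k] exp_pt k_nz in auto)
    then show ?thesis by (simp add: G_def exp_pt)
  qed
  have le: "Re a1 \<le> Re a3" "Im a1 \<le> Im a3" using box by (auto simp: a1_def a3_def)
  have rectS: "cbox a1 a3 \<subseteq> S"
    using box(3) out by (auto simp: S_def a1_def a3_def in_cbox_complex_iff)
  have avoid: "path_image (rectpath a1 a3) \<subseteq> S - pt ` {k0..k1}"
  proof -
    have "path_image (rectpath a1 a3) = cbox a1 a3 - box a1 a3"
      by (rule path_image_rectpath_cbox_minus_box[OF le])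
    then show ?thesis using rectS pts by (auto simp: pt_def a1_def a3_def)
  qed
  have "contour_integral (rectpath a1 a3) G = 2 * pi * \<i> * (\<Sum>p\<in>pt ` {k0..k1}. winding_number (rectpath a1 a3) p * residue G p)"
  proof (rule Residue_theorem[OF So convex_connected[OF Sc] _ hol _ _ avoid])
    show "\<forall>z. z \<notin> S \<longrightarrow> winding_number (rectpath a1 a3) z = 0"
      using rectS le by (auto intro!: winding_number_rectpath_outside)
  qed auto
  also have "(\<Sum>p\<in>pt ` {k0..k1}. winding_number (rectpath a1 a3) p * residue G p) = (\<Sum>k=k0..k1. - T (pt k) / \<kappa>)"
    unfolding sum.reindex[OF inj] o_def
  proof (intro sum.cong refl)
    fix k assume k: "k \<in> {k0..k1}"
    then have "winding_number (rectpath a1 a3) (pt k) = 1"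
      using pts[of k] by (intro winding_number_rectpath) (auto simp: pt_def a1_def a3_def)
    then show "winding_number (rectpath a1 a3) (pt k) * residue G (pt k) = - T (pt k) / \<kappa>"
      using res[OF k] by simp
  qed
  also have "2 * pi * \<i> * (\<Sum>k=k0..k1. - T (pt k) / \<kappa>) = - h * (\<Sum>k=k0..k1. T (pt k))"
  proof -
    have "2 * pi * \<i> = \<kappa> * h" using lam by simp
    then show ?thesis unfolding sum_distrib_left using k_nz by (intro sum.cong) auto
  qed
  finally have main: "contour_integral (rectpath a1 a3) G = - h * (\<Sum>k=k0..k1. T (pt k))" .
  have cG: "continuous_on (path_image (rectpath a1 a3)) G"
    using hol avoid by (meson continuous_on_subset holomorphic_on_imp_continuous_on)
  have rp: "rectpath a1 a3 = linepath a1 a2 +++ linepath a2 a3 +++ linepath a3 a4 +++ linepath a4 a1"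
    by (simp add: rectpath_def Let_def a1_def a2_def a3_def a4_def)
  have im: "closed_segment a1 a2 \<subseteq> path_image (rectpath a1 a3)" "closed_segment a2 a3 \<subseteq> path_image (rectpath a1 a3)"
     "closed_segment a3 a4 \<subseteq> path_image (rectpath a1 a3)" "closed_segment a4 a1 \<subseteq> path_image (rectpath a1 a3)"
    unfolding rp by (auto simp: path_image_join)
  note ci = contour_integrable_continuous_linepath[OF continuous_on_subset[OF cG]]
  have sum4: "contour_integral (rectpath a1 a3) G = contour_integral (linepath a1 a2) G + (contour_integral (linepath a2 a3) G
      + (contour_integral (linepath a3 a4) G + contour_integral (linepath a4 a1) G))"
    unfolding rp
    by (rule contour_integral_unique, intro has_contour_integral_join has_contour_integral_integral ci im) auto
  have segx: "\<exists>x. xl \<le> x \<and> x \<le> xr \<and> v = Complex x y" if v: "v \<in> closed_segment (Complex c y) (Complex d y)" "{c, d} = {xl, xr}" for v c d y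
  proof -
    have "c \<in> {xl, xr}" "d \<in> {xl, xr}" using v(2) by auto
    then have "Re v \<in> {xl..xr}" "Im v = y" using v(1) box(1)
      by (auto simp: closed_segment_same_Im closed_segment_eq_real_ivl split: if_splits)
    then show ?thesis by (intro exI[of _ "Re v"]) (auto simp: complex_eq_iff)
  qed
  have b12: "norm (contour_integral (linepath a1 a2) G) \<le> B * norm (a2 - a1)"
  proof (rule contour_integral_bound_linepath[OF ci[OF im(1)] B(1)])
    fix v assume "v \<in> closed_segment a1 a2"
    then show "norm (G v) \<le> B" using segx[of v xl yb xr] B(2) by (auto simp: a1_def a2_def)
  qed
  have b34: "norm (contour_integral (linepath a3 a4) G) \<le> B * norm (a4 - a3)"
  proof (rule contour_integral_bound_linepath[OF ci[OF im(3)] B(1)])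
    fix v assume "v \<in> closed_segment a3 a4"
    then show "norm (G v) \<le> B" using segx[of v xr yt xl] B(3) by (auto simp: a3_def a4_def)
  qed
  have segy: "\<exists>y. yb \<le> y \<and> y \<le> yt \<and> v = Complex xr y" if v: "v \<in> closed_segment a2 a3" for v
  proof -
    have "Im v \<in> {yb..yt}" "Re v = xr" using v box(2)
      by (auto simp: a2_def a3_def closed_segment_same_Re closed_segment_eq_real_ivl split: if_splits)
    then show ?thesis by (intro exI[of _ "Im v"]) (auto simp: complex_eq_iff)
  qed
  have b23: "norm (contour_integral (linepath a2 a3) G) \<le> B * norm (a3 - a2)"
  proof (rule contour_integral_bound_linepath[OF ci[OF im(2)] B(1)])
    fix v assume "v \<in> closed_segment a2 a3"
    then show "norm (G v) \<le> B" using segy[of v] B(4) by auto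
  qed
  have cont: "continuous_on {yb..yt} (\<lambda>y. G (Complex xl y))"
  proof (rule continuous_on_compose2[OF continuous_on_subset[OF cG im(4)]])
    show "(\<lambda>y. Complex xl y) ` {yb..yt} \<subseteq> closed_segment a4 a1"
      using box(2) by (auto simp: a4_def a1_def closed_segment_same_Re closed_segment_eq_real_ivl)
    show "continuous_on {yb..yt} (\<lambda>y. Complex xl y)" unfolding Complex_eq by (intro continuous_intros)
  qed
  show "continuous_on {yb..yt} (\<lambda>y. G (Complex xl y))" by (rule cont)
  have b41: "contour_integral (linepath a4 a1) G = - \<i> * integral {yb..yt} (\<lambda>y. G (Complex xl y))"
  proof -
    have "contour_integral (linepath a1 a4) G = \<i> * integral {yb..yt} (\<lambda>y. G (Complex xl y))"
      by (rule contour_integral_linepath_same_Re) (use box in \<open>auto simp: a1_def a4_def\<close>)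
    moreover have "contour_integral (linepath a4 a1) G = - contour_integral (linepath a1 a4) G"
      by (rule contour_integral_reverse_linepath[OF continuous_on_subset[OF cG im(4)]])
    ultimately show ?thesis by simp
  qed
  have "h * (\<Sum>k=k0..k1. T (pt k)) - \<i> * integral {yb..yt} (\<lambda>y. G (Complex xl y))
     = - (contour_integral (linepath a1 a2) G + contour_integral (linepath a2 a3) G + contour_integral (linepath a3 a4) G)"
    using main unfolding sum4 b41 by (simp add: algebra_simps)
  also have "norm \<dots> \<le> B * norm (a2 - a1) + B * norm (a3 - a2) + B * norm (a4 - a3)"
    unfolding norm_minus_cancel by (intro order_trans[OF norm_triangle_ineq] add_mono b12 b23 b34)
  also have "\<dots> = B * (2 * (xr - xl) + (yt - yb))"
  proof -
    have "norm (a2 - a1) = xr - xl" "norm (a3 - a2) = yt - yb" "norm (a4 - a3) = xr - xl"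
      using box by (simp_all add: a1_def a2_def a3_def a4_def norm_complex_def)
    then show ?thesis by (simp only:) (simp add: algebra_simps)
  qed
  finally show "norm (h * (\<Sum>k=k0..k1. T (of_nat k * h - s)) - \<i> * integral {yb..yt} (\<lambda>y. G (Complex xl y)))
     \<le> B * (2 * (xr - xl) + (yt - yb))" by (simp add: pt_def)
qed

section \<open>The potential function of the figure-eight knot\<close>

locale fig8 =
  fixes u :: real and p :: nat
  assumes u: "0 < u" "cosh u < 3/2" and p: "p > 0"
begin

definition "\<xi> = complex_of_real u + of_real (2 * pi * real p) * \<i>"
definition "xi_norm2 = u\<^sup>2 + (2 * pi * real p)\<^sup>2"
text \<open>The solution of 2 cosh u - 2 cos \<theta> = 1, that is, of f = 1 on the imaginary axis,
  where log f and with it the derivative of the potential vanish. It is real since cosh u - 1/2 lies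
  between 1/2 and 1.\<close>

definition "\<theta> = arccos (cosh u - 1/2)"

lemma Re_xi [simp]: "Re \<xi> = u" and Im_xi [simp]: "Im \<xi> = 2 * pi * real p"
  by (simp_all add: \<xi>_def)

lemma xi_nz: "\<xi> \<noteq> 0"
  using u by (auto simp: complex_eq_iff)

lemma xi_norm2_pos: "xi_norm2 > 0"
  using u by (simp add: xi_norm2_def add_pos_nonneg)

lemma cmod_xi: "(cmod \<xi>)\<^sup>2 = xi_norm2"
  by (simp add: cmod_power2 xi_norm2_def)

lemma p_ge_1: "real p \<ge> 1"
  using p by simp

lemma cosh_gt_1: "cosh u > 1"
  using cosh_real_strict_mono[of 0 u] u by simp

text \<open>9/8 is a rational bound slightly above sqrt 5 / 2, the value of sinh where cosh is
  3/2.\<close>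

lemma sinh_less: "sinh u < 9/8"
proof -
  have "sinh u ^ 2 = cosh u ^ 2 - 1" using cosh_square_eq[of u] by simp
  also have "cosh u ^ 2 < (3/2)\<^sup>2" using u cosh_gt_1 by (intro power_strict_mono) auto
  finally have "sinh u ^ 2 < (9/8)\<^sup>2" by (simp add: power2_eq_square)
  then show ?thesis by (rule power2_less_imp_less) simp
qed

lemma u_less: "u < 9/8"
proof -
  have "u \<le> sinh u"
  proof -
    have "(\<lambda>x. sinh x - x) 0 \<le> (\<lambda>x. sinh x - x) u"
    proof (rule DERIV_nonneg_imp_nondecreasing[of 0 u "\<lambda>x. sinh x - x"])
      fix x :: real
      show "\<exists>y. ((\<lambda>x. sinh x - x) has_real_derivative y) (at x) \<and> 0 \<le> y"
        by (rule exI[of _ "cosh x - 1"]) (auto intro!: derivative_eq_intros cosh_real_ge_1)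
    qed (use u in simp)
    then show ?thesis by simp
  qed
  then show ?thesis using sinh_less by simp
qed

lemma cos_theta: "cos \<theta> = cosh u - 1/2" and theta: "0 < \<theta>" "\<theta> < pi / 3"
proof -
  show c: "cos \<theta> = cosh u - 1/2" unfolding \<theta>_def using cosh_gt_1 u by (intro cos_arccos) auto
  have r: "0 \<le> \<theta>" "\<theta> \<le> pi" unfolding \<theta>_def using cosh_gt_1 u by (auto intro!: arccos_lbound arccos_ubound)
  have "\<theta> \<noteq> 0" using c u by auto
  then show "0 < \<theta>" using r by simp
  have "cos (pi / 3) < cos \<theta>" using c cosh_gt_1 by (simp add: cos_60)
  then show "\<theta> < pi / 3" using cos_mono_less_eq[of "pi / 3" \<theta>] r by simp
qed

section \<open>Branches of log f and their primitives\<close>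

definition f :: "complex \<Rightarrow> complex" where "f v = 2 * of_real (cosh u) - 2 * cosh v"
definition F :: "complex \<Rightarrow> complex" where "F v = Ln (f v)"
text \<open>One period of f, between two consecutive horizontal lines through its zeros.\<close>

definition "Sig = {v :: complex. - 2 * pi < Im v \<and> Im v < 0}"
text \<open>The logarithm of the factorization f v = e^u (1 - e^(-u-v)) (1 - e^(-u+v)). It is
  holomorphic across the lines Im v = 2 \<pi> n, which the summation path meets when p > 1.\<close>

definition Fs :: "complex \<Rightarrow> complex" where
  "Fs v = of_real u + Ln (1 - exp (- of_real u - v)) + Ln (1 - exp (- of_real u + v))"
definition Ps :: "complex \<Rightarrow> complex" where
  "Ps v = of_real u * v + Li2 (exp (- of_real u - v)) - Li2 (exp (- of_real u + v))"

lemma Sig_open: "open Sig" and Sig_convex: "convex Sig"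
  unfolding Sig_def Collect_conj_eq
  by (intro open_Int convex_Int open_halfspace_Im_lt open_halfspace_Im_gt convex_halfspace_Im_lt convex_halfspace_Im_gt)+

lemma cosh_complex: "cosh v = Complex (cosh (Re v) * cos (Im v)) (sinh (Re v) * sin (Im v))"
  by (simp add: complex_eq_iff cosh_def sinh_def Re_exp Im_exp scaleR_conv_of_real field_simps)

lemma Re_f: "Re (f v) = 2 * cosh u - 2 * (cosh (Re v) * cos (Im v))"
  and Im_f: "Im (f v) = - 2 * (sinh (Re v) * sin (Im v))"
  unfolding f_def cosh_complex by simp_all

text \<open>In \<open>Sig\<close> the value f v is real only if Re v = 0 or Im v = - \<pi>, and
  there it is at least 2 cosh u - 2 or 2 cosh u + 2.\<close>

lemma f_nonpos:
  assumes "v \<in> Sig"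
  shows "f v \<notin> \<real>\<^sub>\<le>\<^sub>0"
proof
  assume "f v \<in> \<real>\<^sub>\<le>\<^sub>0"
  then have 1: "2 * cosh u - 2 * (cosh (Re v) * cos (Im v)) \<le> 0" "sinh (Re v) * sin (Im v) = 0"
    by (simp_all add: complex_nonpos_Reals_iff Re_f Im_f)
  consider "Re v = 0" | "Re v \<noteq> 0" "sin (Im v) = 0" using 1(2) by auto
  then show False
  proof cases
    case 1
    have "cos (Im v) \<le> 1" by simp
    with \<open>2 * cosh u - 2 * (cosh (Re v) * cos (Im v)) \<le> 0\<close> 1 cosh_gt_1 show False by simp
  next
    case 2
    have "sin (Im v + pi) = 0" using 2 by simp
    moreover have "- pi < Im v + pi" "Im v + pi < pi" using assms by (auto simp: Sig_def)
    ultimately have "Im v + pi = 0" using sin_eq_0_pi by blast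
    then have "Im v = - pi" by simp
    then have "cos (Im v) = - 1" by simp
    with 1(1) cosh_gt_1 cosh_real_pos[of "Re v"] show False by simp
  qed
qed

lemma f_holomorphic: "f holomorphic_on A"
proof -
  have "f = (\<lambda>v. 2 * of_real (cosh u) - (exp v + exp (- v)))"
    by (auto simp: f_def cosh_def scaleR_conv_of_real fun_eq_iff add_divide_distrib)
  then show ?thesis by (simp only:) (intro holomorphic_intros)
qed

lemma F_holomorphic: "F holomorphic_on Sig"
  unfolding F_def[abs_def] by (intro holomorphic_intros f_holomorphic) (rule f_nonpos)

lemma exp_F: "v \<in> Sig \<Longrightarrow> exp (F v) = f v"
  using f_nonpos[of v] by (auto simp: F_def intro!: exp_Ln)

lemma exp_less_1:
  assumes "\<bar>Re v\<bar> < u"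
  shows "norm (exp (- of_real u - v)) < 1" "norm (exp (- of_real u + v)) < 1"
  using assms by auto

lemma one_minus_nonpos: "norm z < 1 \<Longrightarrow> 1 - z \<notin> \<real>\<^sub>\<le>\<^sub>0" for z :: complex
  using complex_Re_le_cmod[of z] by (auto simp: complex_nonpos_Reals_iff)

lemma exp_Fs:
  assumes "\<bar>Re v\<bar> < u"
  shows "exp (Fs v) = f v"
proof -
  note e = exp_less_1[OF assms]
  have *: "1 - z \<noteq> 0" if "norm z < 1" for z :: complex using that by auto
  note n = *[OF e(1)] *[OF e(2)]
  have "exp (Fs v) = exp (of_real u) * (1 - exp (- of_real u - v)) * (1 - exp (- of_real u + v))"
    unfolding Fs_def using n by (simp add: exp_add)
  also have "\<dots> = f v"
  proof -
    define A B where "A = exp (complex_of_real u)" and "B = exp v"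
    have nz: "A \<noteq> 0" "B \<noteq> 0" by (auto simp: A_def B_def)
    have e: "exp (- of_real u - v) = 1 / (A * B)" "exp (- of_real u + v) = B / A"
      by (simp_all add: A_def B_def exp_add exp_diff exp_minus field_simps)
    have fv: "f v = A + 1 / A - (B + 1 / B)"
      by (simp add: f_def cosh_def scaleR_conv_of_real A_def B_def exp_minus exp_of_real inverse_eq_divide add_divide_distrib)
    show ?thesis unfolding e A_def[symmetric] fv using nz by (simp add: field_simps)
  qed
  finally show ?thesis .
qed

lemma Im_Ln_bound: "norm z < 1 \<Longrightarrow> \<bar>Im (Ln (1 - z))\<bar> < pi / 2" for z :: complex
  using Re_Ln_pos_lt[of "1 - z"] complex_Re_le_cmod[of z] by (cases "z = 1") auto

lemma Im_Fs: "\<bar>Re v\<bar> < u \<Longrightarrow> \<bar>Im (Fs v)\<bar> < pi"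
  using Im_Ln_bound[OF exp_less_1(1), of v] Im_Ln_bound[OF exp_less_1(2), of v]
  by (simp add: Fs_def)

text \<open>Each of the two logarithms has an imaginary part below \<pi>/2 in modulus, so their sum
  stays in the principal range.\<close>

lemma Fs_eq_F: "\<bar>Re v\<bar> < u \<Longrightarrow> Fs v = F v"
  using Im_Fs[of v] unfolding F_def exp_Fs[symmetric] by (subst Ln_exp) auto

lemma Ps_deriv:
  assumes "\<bar>Re v\<bar> < u"
  shows "(Ps has_field_derivative Fs v) (at v)"
proof -
  note e = exp_less_1[OF assms]
  have 1: "((\<lambda>v. Li2 (exp (- of_real u - v))) has_field_derivative
      (- Ln (1 - exp (- of_real u - v)) / exp (- of_real u - v)) * (- exp (- of_real u - v))) (at v)"
    by (rule DERIV_chain2[where f = Li2 and g = "\<lambda>v. exp (- of_real u - v)", OF Li2_has_field_derivative[OF e(1) exp_not_eq_zero]]) (auto intro!: derivative_eq_intros)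
  have 2: "((\<lambda>v. Li2 (exp (- of_real u + v))) has_field_derivative
      (- Ln (1 - exp (- of_real u + v)) / exp (- of_real u + v)) * (exp (- of_real u + v))) (at v)"
    by (rule DERIV_chain2[where f = Li2 and g = "\<lambda>v. exp (- of_real u + v)", OF Li2_has_field_derivative[OF e(2) exp_not_eq_zero]]) (auto intro!: derivative_eq_intros)
  have 3: "((\<lambda>v. of_real u * v) has_field_derivative of_real u) (at v)"
    by (auto intro!: derivative_eq_intros)
  from DERIV_diff[OF DERIV_add[OF 3 1] 2] show ?thesis
    unfolding Ps_def[abs_def] Fs_def by simp
qed

text \<open>Only the linear term sees the shift. Moving the lattice by p periods therefore costs a
  constant in the exponent, which \<open>peak\<close> incorporates.\<close>

lemma Ps_periodic: "Ps (v + of_nat m * (2 * of_real pi * \<i>)) = Ps v + of_nat m * (2 * of_real pi * \<i>) * of_real u"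
proof -
  have "exp (of_nat m * (2 * of_real pi * \<i>)) = 1"
    using exp_integer_2pi[of "of_nat m"] by (simp add: mult_ac)
  then have "exp (- of_real u - (v + of_nat m * (2 * of_real pi * \<i>))) = exp (- of_real u - v)"
    "exp (- of_real u + (v + of_nat m * (2 * of_real pi * \<i>))) = exp (- of_real u + v)"
    by (simp_all add: exp_diff exp_add)
  then show ?thesis by (simp only: Ps_def) (simp add: algebra_simps)
qed

text \<open>
  \<open>Fs\<close> and \<open>Ps\<close> are \<open>log f\<close> and its primitive on the vertical strip \<open>\<bar>Re v\<bar> < u\<close>. Near the zeros of \<open>f\<close>
  one has to leave that strip; on \<open>Sig\<close> the principal logarithm \<open>F\<close> of \<open>f\<close> still works, and \<open>P\<close> is the
  primitive of \<open>F\<close> that continues \<open>Ps\<close>.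
\<close>

definition P :: "complex \<Rightarrow> complex" where
  "P = (SOME g. \<forall>v\<in>Sig. (g has_field_derivative F v) (at v) \<and> (\<bar>Re v\<bar> < u \<longrightarrow> g v = Ps v))"

lemma P: "v \<in> Sig \<Longrightarrow> (P has_field_derivative F v) (at v)"
  and P_eq_Ps: "v \<in> Sig \<Longrightarrow> \<bar>Re v\<bar> < u \<Longrightarrow> P v = Ps v"
proof -
  define S where "S = Sig \<inter> ({v. - u < Re v} \<inter> {v. Re v < u})"
  have S: "convex S" "open S"
    unfolding S_def by (intro convex_Int open_Int Sig_open Sig_convex convex_halfspace_Re_gt convex_halfspace_Re_lt
      open_halfspace_Re_gt open_halfspace_Re_lt)+
  have SS: "v \<in> S \<longleftrightarrow> v \<in> Sig \<and> \<bar>Re v\<bar> < u" for v by (auto simp: S_def)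
  have "\<exists>g. \<forall>v\<in>Sig. (g has_field_derivative F v) (at v)"
    by (rule holomorphic_primitive_exists[OF Sig_convex Sig_open F_holomorphic])
  then obtain g where g: "\<And>v. v \<in> Sig \<Longrightarrow> (g has_field_derivative F v) (at v)" by blast
  \<comment> \<open>On the intersection of the two strips, which is convex, two primitives of the
    same function differ by a constant.\<close>
  have "((\<lambda>v. g v - Ps v) has_field_derivative 0) (at v within S)" if "v \<in> S" for v
    using DERIV_diff[OF g[of v] Ps_deriv[of v]] that Fs_eq_F[of v]
    by (auto simp: SS intro: has_field_derivative_at_within)
  then obtain c where c: "\<And>v. v \<in> S \<Longrightarrow> g v - Ps v = c"
    using has_field_derivative_zero_constant[OF S(1)] by metis
  have "\<exists>g. \<forall>v\<in>Sig. (g has_field_derivative F v) (at v) \<and> (\<bar>Re v\<bar> < u \<longrightarrow> g v = Ps v)"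
  proof (intro exI[of _ "\<lambda>v. g v - c"] ballI conjI impI)
    fix v assume v: "v \<in> Sig"
    show "((\<lambda>v. g v - c) has_field_derivative F v) (at v)"
      using DERIV_diff[OF g[OF v] DERIV_const[of c]] by simp
    show "g v - c = Ps v" if "\<bar>Re v\<bar> < u" using c[of v] that v by (simp add: SS algebra_simps)
  qed
  from someI_ex[OF this, folded P_def]
  show "v \<in> Sig \<Longrightarrow> (P has_field_derivative F v) (at v)" "v \<in> Sig \<Longrightarrow> \<bar>Re v\<bar> < u \<Longrightarrow> P v = Ps v" for v
    by blast+
qed

section \<open>The potential on the imaginary axis\<close>

definition "g y = ln (2 * cosh u - 2 * cos y)"
text \<open>A deformation of the Clausen function: for u = 0 the formula would give - 2
  Cl_2(y).\<close>

definition "Lam y = Im (Ps (Complex 0 y))"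
definition "\<phi> = Complex 0 (- \<theta>)"

lemma g_arg_pos: "2 * cosh u - 2 * cos y > 0"
  using cosh_gt_1 cos_le_one[of y] by linarith

lemma f_imag_axis: "f (Complex 0 y) = of_real (2 * cosh u - 2 * cos y)"
  by (simp add: complex_eq_iff Re_f Im_f)

lemma Fs_imag_axis: "Fs (Complex 0 y) = of_real (g y)"
  using Fs_eq_F[of "Complex 0 y"] u g_arg_pos[of y]
  by (simp add: F_def f_imag_axis g_def Ln_of_real del: of_real_diff of_real_mult)

lemma Ps_imag_deriv: "((\<lambda>y. Ps (Complex 0 y)) has_vector_derivative \<i> * of_real (g y)) (at y)"
proof -
  have "((\<lambda>z. Ps (\<i> * z)) has_field_derivative Fs (\<i> * of_real y) * \<i>) (at (of_real y))"
    by (rule DERIV_chain2[where f = Ps and g = "\<lambda>z. \<i> * z", OF Ps_deriv]) (use u in \<open>auto intro!: derivative_eq_intros\<close>)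
  from has_vector_derivative_real_field[OF this, of UNIV]
  have "((\<lambda>y. Ps (\<i> * of_real y)) has_vector_derivative Fs (\<i> * of_real y) * \<i>) (at y)" .
  moreover have "\<i> * of_real y = Complex 0 y" for y by (simp add: complex_eq_iff)
  ultimately show ?thesis by (simp add: Fs_imag_axis mult.commute)
qed

lemma Lam_deriv: "(Lam has_real_derivative g y) (at y)"
proof -
  have "((\<lambda>y. Im (Ps (Complex 0 y))) has_vector_derivative Im (\<i> * of_real (g y))) (at y)"
    by (rule bounded_linear.has_vector_derivative[OF bounded_linear_Im Ps_imag_deriv])
  then show ?thesis by (simp add: Lam_def[abs_def] has_real_derivative_iff_has_vector_derivative)
qed

text \<open>The derivative along the axis is i times a real number, and at 0 the two dilogarithms
  cancel.\<close>

lemma Ps_imag_axis: "Ps (Complex 0 y) = \<i> * of_real (Lam y)"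
proof -
  have "((\<lambda>y. Re (Ps (Complex 0 y))) has_vector_derivative Re (\<i> * of_real (g y))) (at y)" for y
    by (rule bounded_linear.has_vector_derivative[OF bounded_linear_Re Ps_imag_deriv])
  then have "\<forall>y. ((\<lambda>y. Re (Ps (Complex 0 y))) has_real_derivative 0) (at y)"
    by (simp add: has_real_derivative_iff_has_vector_derivative)
  then have "Re (Ps (Complex 0 y)) = Re (Ps (Complex 0 0))"
    by (rule DERIV_isconst_all)
  also have "\<dots> = 0" by (simp add: Complex_eq Ps_def)
  finally show ?thesis by (simp add: Lam_def complex_eq_iff)
qed

text \<open>Equivalently, log (2 cosh u - 2 cos y) has the mean value u over a period.\<close>

lemma Lam_periodic: "Lam (y + 2 * pi * real m) = Lam y + 2 * pi * real m * u"
proof -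
  have "Complex 0 (y + 2 * pi * real m) = Complex 0 y + of_nat m * (2 * of_real pi * \<i>)"
    by (simp add: complex_eq_iff)
  then show ?thesis unfolding Lam_def by (simp add: Ps_periodic)
qed

lemma Lam_0: "Lam 0 = 0"
  by (simp add: Lam_def Complex_eq Ps_def)

lemma g_neg: "cos y > cos \<theta> \<Longrightarrow> g y < 0"
  unfolding g_def using g_arg_pos[of y] by (subst ln_less_zero_iff) (auto simp: cos_theta)

lemma g_pos: "cos y < cos \<theta> \<Longrightarrow> g y > 0"
  unfolding g_def using g_arg_pos[of y] by (subst ln_gt_zero_iff) (auto simp: cos_theta)

lemma g_theta: "g (- \<theta>) = 0"
  by (simp add: g_def cos_theta)

lemma g_neg': "\<bar>y\<bar> < \<theta> \<Longrightarrow> g y < 0"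
  using cos_monotone_0_pi[of "\<bar>y\<bar>" \<theta>] theta g_neg[of y] by simp

lemma g_pos': "\<theta> < y \<Longrightarrow> y < 2 * pi - \<theta> \<Longrightarrow> g y > 0"
proof (rule g_pos)
  assume y: "\<theta> < y" "y < 2 * pi - \<theta>"
  show "cos y < cos \<theta>"
  proof (cases "y \<le> pi")
    case True
    then show ?thesis using cos_monotone_0_pi[of \<theta> y] theta y by simp
  next
    case False
    have "cos y = cos (2 * pi - y)" by (simp add: cos_diff)
    also have "\<dots> < cos \<theta>" using cos_monotone_0_pi[of \<theta> "2 * pi - y"] theta y False by simp
    finally show ?thesis .
  qed
qed

lemma g_pos'': "- 2 * pi + \<theta> < y \<Longrightarrow> y < - \<theta> \<Longrightarrow> g y > 0"
  using g_pos'[of "- y"] by (simp add: g_def)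

lemma Lam_decr:
  assumes "- \<theta> \<le> a" "a < b" "b \<le> \<theta>"
  shows "Lam b < Lam a"
proof -
  obtain z where z: "a < z" "z < b" "Lam b - Lam a = (b - a) * g z"
    using MVT2[OF assms(2), of Lam g] Lam_deriv by blast
  have "g z < 0" using z assms by (intro g_neg') auto
  then show ?thesis using z(3) assms(2) by (metis diff_gt_0_iff_gt diff_less_0_iff_less mult_pos_neg)
qed

lemma Lam_incr:
  assumes "- 2 * pi + \<theta> \<le> a" "a < b" "b \<le> - \<theta>"
  shows "Lam a < Lam b"
proof -
  obtain z where z: "a < z" "z < b" "Lam b - Lam a = (b - a) * g z"
    using MVT2[OF assms(2), of Lam g] Lam_deriv by blast
  have "g z > 0" using z assms by (intro g_pos'') auto
  then show ?thesis using z(3) assms(2) by (metis diff_gt_0_iff_gt mult_pos_pos)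
qed

text \<open>The maximum of \<open>Lam\<close> on [- 2 \<pi>, 0]. For u = 0 the formula would give 2
  Cl_2(\<pi>/3), the hyperbolic volume of the complement of the figure-eight knot.\<close>

definition "V0 = Lam (- \<theta>)"

lemma V0_pos: "V0 > 0"
  using Lam_decr[of "- \<theta>" 0] theta by (simp add: V0_def Lam_0)

lemma Lam_le_period: "- 2 * pi + \<theta> \<le> y \<Longrightarrow> y \<le> \<theta> \<Longrightarrow> Lam y \<le> V0"
  using Lam_decr[of "- \<theta>" y] Lam_incr[of y "- \<theta>"] by (cases y "- \<theta>" rule: linorder_cases) (auto simp: V0_def)

lemma Lam_le:
  assumes "0 \<le> y" "y \<le> 2 * pi * real m + \<theta>"
  shows "Lam y \<le> 2 * pi * real m * u + V0"
proof -
  \<comment> \<open>The number of periods that brings y into (- 2 \<pi> + \<theta>, \<theta>], where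
    \<open>V0\<close> is an upper bound.\<close>
  define j where "j = nat \<lceil>(y - \<theta>) / (2 * pi)\<rceil>"
  have tp: "2 * pi > 0" by simp
  have "(y - \<theta>) / (2 * pi) > - 1" using assms(1) theta pi_gt3 by (simp add: field_simps)
  then have c0: "\<lceil>(y - \<theta>) / (2 * pi)\<rceil> \<ge> 0" by linarith
  then have j: "real j = of_int \<lceil>(y - \<theta>) / (2 * pi)\<rceil>" by (simp add: j_def)
  have "(y - \<theta>) / (2 * pi) \<le> real j" "real j < (y - \<theta>) / (2 * pi) + 1" unfolding j by linarith+
  then have 1: "y - \<theta> \<le> real j * (2 * pi)" "real j * (2 * pi) < (y - \<theta>) + 2 * pi"
    by (simp_all add: field_simps)
  have "(y - \<theta>) / (2 * pi) \<le> real m" using assms(2) by (simp add: field_simps)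
  then have "\<lceil>(y - \<theta>) / (2 * pi)\<rceil> \<le> int m" by (simp add: ceiling_le_iff)
  then have jm: "real j \<le> real m" unfolding j by simp
  have "Lam y = Lam (y - 2 * pi * real j) + 2 * pi * real j * u"
    using Lam_periodic[of "y - 2 * pi * real j" j] by simp
  also have "\<dots> \<le> V0 + 2 * pi * real m * u"
    using 1 jm u by (intro add_mono Lam_le_period mult_right_mono mult_left_mono) (auto simp: algebra_simps)
  finally show ?thesis by simp
qed

text \<open>One period higher the argument lies in [0, \<theta>], where \<open>V0\<close> is still a
  bound; going back down costs 2 \<pi> u.\<close>

lemma Lam_low: "- 2 * pi \<le> y \<Longrightarrow> y \<le> - 2 * pi + \<theta> \<Longrightarrow> Lam y \<le> V0 - 2 * pi * u"
  using Lam_le_period[of "y + 2 * pi"] Lam_periodic[of y 1] pi_gt3 theta by simp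

lemma Lam_less:
  assumes "- 2 * pi \<le> y" "y \<le> 0" "y \<noteq> - \<theta>"
  shows "Lam y < V0"
proof (cases "y \<le> - 2 * pi + \<theta>")
  case True
  then show ?thesis using Lam_low[of y] assms u pi_gt_zero by (smt (verit) mult_pos_pos)
next
  case False
  then show ?thesis using Lam_decr[of "- \<theta>" y] Lam_incr[of y "- \<theta>"] assms theta
    by (cases y "- \<theta>" rule: linorder_cases) (auto simp: V0_def)
qed

lemma sin_theta: "sin \<theta> > 0"
  using theta pi_gt3 by (intro sin_gt_zero) auto

text \<open>L'Hospital's rule: g vanishes at - \<theta> and has the derivative - 2 sin \<theta>
  there, because the argument of the logarithm is 1.\<close>

lemma Lam_second_order: "((\<lambda>y. (Lam y - V0) / (y + \<theta>)\<^sup>2) \<longlongrightarrow> - sin \<theta>) (at (- \<theta>))"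
proof (rule lhopital)
  show "((\<lambda>y. Lam y - V0) \<longlongrightarrow> 0) (at (- \<theta>))"
  proof -
    have "isCont Lam (- \<theta>)" using Lam_deriv by (rule DERIV_isCont)
    then have "(Lam \<longlongrightarrow> V0) (at (- \<theta>))" by (simp add: isCont_def V0_def)
    then show ?thesis by (simp add: LIM_zero)
  qed
  show "((\<lambda>y. (y + \<theta>)\<^sup>2) \<longlongrightarrow> 0) (at (- \<theta>))" by (auto intro!: tendsto_eq_intros)
  show "\<forall>\<^sub>F y in at (- \<theta>). (y + \<theta>)\<^sup>2 \<noteq> 0"
    by (auto simp: eventually_at_filter)
  show "\<forall>\<^sub>F y in at (- \<theta>). 2 * (y + \<theta>) \<noteq> 0" by (auto simp: eventually_at_filter)
  show "\<forall>\<^sub>F y in at (- \<theta>). ((\<lambda>y. Lam y - V0) has_real_derivative g y) (at y)"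
    by (intro always_eventually allI) (auto intro!: derivative_eq_intros Lam_deriv)
  show "\<forall>\<^sub>F y in at (- \<theta>). ((\<lambda>y. (y + \<theta>)\<^sup>2) has_real_derivative 2 * (y + \<theta>)) (at y)"
    by (intro always_eventually allI) (auto intro!: derivative_eq_intros)
  have "(g has_real_derivative (2 * sin (- \<theta>)) / (2 * cosh u - 2 * cos (- \<theta>))) (at (- \<theta>))"
    unfolding g_def[abs_def] using g_arg_pos[of "- \<theta>"] by (auto intro!: derivative_eq_intros)
  then have "(g has_real_derivative - 2 * sin \<theta>) (at (- \<theta>))" by (simp add: cos_theta)
  then have "((\<lambda>y. (g y - g (- \<theta>)) / (y - (- \<theta>))) \<longlongrightarrow> - 2 * sin \<theta>) (at (- \<theta>))"
    by (simp add: has_field_derivative_iff)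
  then have "((\<lambda>y. (g y / (y + \<theta>)) / 2) \<longlongrightarrow> (- 2 * sin \<theta>) / 2) (at (- \<theta>))"
    by (intro tendsto_divide tendsto_const) (simp_all add: g_theta)
  then show "((\<lambda>y. g y / (2 * (y + \<theta>))) \<longlongrightarrow> - sin \<theta>) (at (- \<theta>))"
    by (simp add: field_simps)
qed

text \<open>The quotient of \<open>Lam y - V0\<close> by (y + \<theta>)^2, extended by its limit -
  sin \<theta>, is continuous and negative on a compact interval, so its maximum is negative. This
  gives the Gaussian bound for the Laplace method.\<close>

lemma Lam_quadratic: "\<exists>c>0. \<forall>y. - 2 * pi \<le> y \<and> y \<le> 0 \<longrightarrow> Lam y - V0 \<le> - c * (y + \<theta>)\<^sup>2"
proof -
  define q where "q y = (if y = - \<theta> then - sin \<theta> else (Lam y - V0) / (y + \<theta>)\<^sup>2)" for y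
  have "isCont q y" for y
  proof (cases "y = - \<theta>")
    case True
    have "(q \<longlongrightarrow> - sin \<theta>) (at (- \<theta>))"
      by (rule Lim_transform_eventually[OF Lam_second_order]) (auto simp: q_def eventually_at_filter)
    then show ?thesis by (simp add: True isCont_def) (simp add: q_def)
  next
    case False
    have c: "isCont (\<lambda>y. (Lam y - V0) / (y + \<theta>)\<^sup>2) y"
      using False by (intro continuous_intros DERIV_isCont[OF Lam_deriv]) auto
    have ev: "\<forall>\<^sub>F x in nhds y. (Lam x - V0) / (x + \<theta>)\<^sup>2 = q x"
      using t1_space_nhds[OF False] by eventually_elim (simp add: q_def)
    show ?thesis using c isCont_cong[OF ev] by simp
  qed
  then have "continuous_on {- 2 * pi..0} q" by (simp add: continuous_at_imp_continuous_on)
  then obtain m where m: "m \<in> {- 2 * pi..0}" "\<And>y. y \<in> {- 2 * pi..0} \<Longrightarrow> q y \<le> q m"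
    using continuous_attains_sup[of "{- 2 * pi..0}" q] by auto
  have "q m < 0"
    using m(1) Lam_less[of m] sin_theta by (auto simp: q_def divide_less_0_iff)
  moreover have "Lam y - V0 \<le> - (- q m) * (y + \<theta>)\<^sup>2" if "- 2 * pi \<le> y" "y \<le> 0" for y
  proof (cases "y = - \<theta>")
    case False
    have "q y \<le> q m" using m(2) that by simp
    then show ?thesis using False by (simp add: q_def divide_le_eq)
  qed (simp add: V0_def)
  ultimately show ?thesis by (intro exI[of _ "- q m"]) auto
qed

text \<open>
  \<open>gap v / xi_norm2\<close> is the real part of \<open>(P v - P \<phi>) / \<xi>\<close>, the exponential rate relative to the saddle
  point \<open>\<phi>\<close>, and \<open>gaps v / xi_norm2\<close> is that of \<open>Ps v / \<xi>\<close>.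
\<close>

definition "gap v = u * Re (P v) + 2 * pi * real p * Im (P v) - 2 * pi * real p * V0"
definition "gaps v = u * Re (Ps v) + 2 * pi * real p * Im (Ps v)"

lemma P_phi: "P \<phi> = \<i> * of_real V0"
proof -
  have "\<phi> \<in> Sig" using theta pi_gt3 by (simp add: \<phi>_def Sig_def)
  then have "P \<phi> = Ps \<phi>" using u by (intro P_eq_Ps) (auto simp: \<phi>_def)
  then show ?thesis by (simp add: \<phi>_def Ps_imag_axis V0_def)
qed

section \<open>Bounds for the exponential rate away from the imaginary axis\<close>

lemma Re_divide_xi: "xi_norm2 * Re (z / \<xi>) = u * Re z + 2 * pi * real p * Im z"
  using xi_norm2_pos by (simp add: Re_divide xi_norm2_def field_simps)

text \<open>The left side of the bound on q is the derivative of u Re Q + 2 \<pi> p Im Q along a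
  horizontal line. The estimates start from the known values on the imaginary axis and move to the
  right.\<close>

lemma horizontal_bound:
  assumes "a \<le> b"
    and Q: "\<And>s. a \<le> s \<Longrightarrow> s \<le> b \<Longrightarrow> (Q has_field_derivative q (Complex s y)) (at (Complex s y))"
    and D: "\<And>s. a \<le> s \<Longrightarrow> s \<le> b \<Longrightarrow> u * Re (q (Complex s y)) + 2 * pi * real p * Im (q (Complex s y)) \<le> D"
  shows "u * Re (Q (Complex b y)) + 2 * pi * real p * Im (Q (Complex b y))
    \<le> u * Re (Q (Complex a y)) + 2 * pi * real p * Im (Q (Complex a y)) + D * (b - a)"
proof -
  define k where "k s = u * Re (Q (Complex s y)) + 2 * pi * real p * Im (Q (Complex s y)) - D * s" for s
  have "k b \<le> k a"
  proof (rule DERIV_nonpos_imp_nonincreasing[OF assms(1)])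
    fix s assume s: "a \<le> s" "s \<le> b"
    have "((\<lambda>z. Q (z + \<i> * of_real y)) has_field_derivative q (Complex s y) * 1) (at (of_real s))"
    proof (rule DERIV_chain2[where f = Q and g = "\<lambda>z. z + \<i> * of_real y"])
      show "(Q has_field_derivative q (Complex s y)) (at (of_real s + \<i> * of_real y))"
        using Q[OF s] by (simp add: Complex_eq)
    qed (auto intro!: derivative_eq_intros)
    from has_vector_derivative_real_field[OF this, of UNIV]
    have v: "((\<lambda>s. Q (Complex s y)) has_vector_derivative q (Complex s y)) (at s)"
      by (simp add: Complex_eq)
    have d: "((\<lambda>s. Re (Q (Complex s y))) has_real_derivative Re (q (Complex s y))) (at s)"
      "((\<lambda>s. Im (Q (Complex s y))) has_real_derivative Im (q (Complex s y))) (at s)"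
      using bounded_linear.has_vector_derivative[OF bounded_linear_Re v] bounded_linear.has_vector_derivative[OF bounded_linear_Im v]
      by (simp_all add: has_real_derivative_iff_has_vector_derivative)
    have "(k has_real_derivative (u * Re (q (Complex s y)) + 2 * pi * real p * Im (q (Complex s y)) - D)) (at s)"
      using DERIV_diff[OF DERIV_add[OF DERIV_cmult[OF d(1), of u] DERIV_cmult[OF d(2), of "2 * pi * real p"]]
        DERIV_cmult[OF DERIV_ident, of D]] by (simp add: k_def[abs_def])
    then show "\<exists>z. (k has_real_derivative z) (at s) \<and> z \<le> 0" using D[OF s] by (intro exI conjI) auto
  qed
  then show ?thesis by (simp add: k_def algebra_simps)
qed

lemma norm_cosh_le: "norm (cosh v) \<le> cosh (Re v)" for v :: complex
proof -
  have "norm (cosh v) \<le> norm (exp v) / 2 + norm (exp (- v)) / 2"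
    unfolding cosh_def using norm_triangle_ineq[of "exp v" "exp (- v)"] by (simp del: norm_exp_eq_Re)
  then show ?thesis by (simp add: cosh_def add_divide_distrib)
qed

text \<open>exp u = cosh u + sinh u is at most 3/2 + 9/8 = 21/8, and the cube of this is below
  19.\<close>

lemma cosh_3u: "cosh (3 * u) \<le> 10"
proof -
  have "exp u = cosh u + sinh u" by (simp add: cosh_def sinh_def field_simps)
  also have "\<dots> \<le> 21 / 8" using u sinh_less by simp
  finally have "exp u ^ 3 \<le> (21 / 8) ^ 3" by (intro power_mono) auto
  then have "exp (3 * u) \<le> 19" by (simp add: exp_of_nat_mult[symmetric] power_divide)
  moreover have "exp (- (3 * u)) \<le> 1" using u by simp
  ultimately have "exp (3 * u) + exp (- (3 * u)) \<le> 20" by linarith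
  then show ?thesis by (simp add: cosh_def)
qed

text \<open>23 is 2 times 3/2 plus 2 times 10; the range of Re v covers the whole rectangle.\<close>

lemma norm_f_le:
  assumes "\<bar>Re v\<bar> \<le> 3 * u"
  shows "norm (f v) \<le> 23"
proof -
  have "norm (f v) \<le> norm (complex_of_real (2 * cosh u)) + norm (2 * cosh v)"
    unfolding f_def using norm_triangle_ineq4[of "complex_of_real (2 * cosh u)" "2 * cosh v"] by simp
  also have "\<dots> \<le> 3 + 2 * cosh (Re v)"
    using norm_cosh_le[of v] u cosh_gt_1 by (simp add: norm_mult)
  also have "cosh (Re v) \<le> cosh (3 * u)"
    using cosh_real_nonneg_le_iff[of "\<bar>Re v\<bar>" "3 * u"] assms u by simp
  finally show ?thesis using cosh_3u by simp
qed

lemma ln_23: "ln 23 \<le> (4::real)"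
proof -
  have "(5/4)^16 \<le> exp (1/4 :: real) ^ 16" using exp_ge_add_one_self[of "1/4::real"] by (intro power_mono) auto
  also have "\<dots> = exp 4" by (simp add: exp_of_nat_mult[symmetric])
  finally have "23 \<le> exp (4::real)" by (simp add: power_divide)
  then have "ln 23 \<le> ln (exp (4::real))" by (subst ln_le_cancel_iff) auto
  then show ?thesis by simp
qed

lemma Re_F_le:
  assumes "f v \<noteq> 0" "\<bar>Re v\<bar> \<le> 3 * u"
  shows "Re (F v) \<le> 4"
proof -
  have "Re (F v) = ln (norm (f v))" unfolding F_def using assms by (simp add: Re_Ln)
  also have "\<dots> \<le> ln 23" using norm_f_le[OF assms(2)] assms(1) by (subst ln_le_cancel_iff) auto
  finally show ?thesis using ln_23 by simp
qed

lemma Im_F_le: "f v \<noteq> 0 \<Longrightarrow> Im (F v) \<le> pi"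
  unfolding F_def by (rule Im_Ln_le_pi)

text \<open>The bound 4 for Re F with weight u, plus the bound \<pi> for Im F with weight 2 \<pi>
  p.\<close>

abbreviation "slope \<equiv> 4 * u + 2 * pi\<^sup>2 * real p"

lemma slope_bound:
  assumes "f v \<noteq> 0" "\<bar>Re v\<bar> \<le> 3 * u"
  shows "u * Re (F v) + 2 * pi * real p * Im (F v) \<le> slope"
proof -
  have "u * Re (F v) \<le> u * 4" using Re_F_le[OF assms] u by (intro mult_left_mono) auto
  moreover have "2 * pi * real p * Im (F v) \<le> 2 * pi * real p * pi"
    using Im_F_le[OF assms(1)] by (intro mult_left_mono) auto
  ultimately have "u * Re (F v) + 2 * pi * real p * Im (F v) \<le> u * 4 + 2 * pi * real p * pi" by (rule add_mono)
  also have "\<dots> = slope" by (simp add: power2_eq_square)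
  finally show ?thesis .
qed

lemma P_imag_axis: "- 2 * pi < y \<Longrightarrow> y < 0 \<Longrightarrow> P (Complex 0 y) = \<i> * of_real (Lam y)"
  using P_eq_Ps[of "Complex 0 y"] u Ps_imag_axis[of y] by (simp add: Sig_def)

lemma gap_imag_axis: "- 2 * pi < y \<Longrightarrow> y < 0 \<Longrightarrow> gap (Complex 0 y) = 2 * pi * real p * (Lam y - V0)"
  by (simp add: gap_def P_imag_axis algebra_simps)

lemma f_nz: "v \<in> Sig \<Longrightarrow> f v \<noteq> 0"
  using f_nonpos[of v] by auto

lemma gap_bound:
  assumes y: "- 2 * pi < y" "y < 0" and s: "0 \<le> a" "a \<le> b" "b \<le> 3 * u"
  shows "gap (Complex b y) \<le> gap (Complex a y) + slope * (b - a)"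
proof -
  have S: "Complex s y \<in> Sig" for s using y by (simp add: Sig_def)
  have "u * Re (P (Complex b y)) + 2 * pi * real p * Im (P (Complex b y))
    \<le> u * Re (P (Complex a y)) + 2 * pi * real p * Im (P (Complex a y)) + slope * (b - a)"
    by (rule horizontal_bound[OF s(2) P[OF S] slope_bound[OF f_nz[OF S]]]) (use s in auto)
  then show ?thesis by (simp add: gap_def)
qed

lemma gaps_bound:
  assumes "0 \<le> b" "b < u"
  shows "gaps (Complex b y) \<le> 2 * pi * real p * Lam y + slope * b"
proof -
  have "f (Complex s y) \<noteq> 0" if "\<bar>s\<bar> < u" for s
    using exp_Fs[of "Complex s y"] that by (metis exp_not_eq_zero complex.sel(1))
  then have "u * Re (Fs (Complex s y)) + 2 * pi * real p * Im (Fs (Complex s y)) \<le> slope" if "0 \<le> s" "s \<le> b" for s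
    using slope_bound[of "Complex s y"] Fs_eq_F[of "Complex s y"] that assms by simp
  moreover have "(Ps has_field_derivative Fs (Complex s y)) (at (Complex s y))" if "0 \<le> s" "s \<le> b" for s
    using that assms by (intro Ps_deriv) auto
  ultimately have "u * Re (Ps (Complex b y)) + 2 * pi * real p * Im (Ps (Complex b y))
    \<le> u * Re (Ps (Complex 0 y)) + 2 * pi * real p * Im (Ps (Complex 0 y)) + slope * (b - 0)"
    by (intro horizontal_bound[OF assms(1)])
  then show ?thesis by (simp add: gaps_def Ps_imag_axis)
qed

text \<open>The right side is at least 18, while 12 u is below 27/2.\<close>

lemma pi_p_u: "12 * u < 2 * pi\<^sup>2 * real p"
proof -
  have "9 < pi\<^sup>2" using power_strict_mono[OF pi_gt3, of 2] by simp
  then have "18 * 1 \<le> 2 * pi\<^sup>2 * real p" using p_ge_1 by (intro mult_mono) auto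
  then show ?thesis using u_less by simp
qed

text \<open>At these heights the axis value is at least 2 \<pi> u below \<open>V0\<close>, a loss of
  4 \<pi>^2 p u in \<open>gap\<close>. Moving right as far as u regains at most slope times u;
  beyond u the subtracted term, the decay of the kernel, exceeds the slope. The margin is stated
  with 12 u instead of 4 u to agree with that of the right side.\<close>

lemma bottom_estimate:
  assumes y: "- 2 * pi < y" "y \<le> - 2 * pi + \<theta>" and s: "0 \<le> s" "s \<le> 3 * u"
  shows "gap (Complex s y) - 4 * pi\<^sup>2 * real p * max 0 (s - u) \<le> - u * (2 * pi\<^sup>2 * real p - 12 * u)"
proof -
  have "y < 0" using y theta pi_gt3 by simp
  have "gap (Complex s y) \<le> gap (Complex 0 y) + slope * (s - 0)"
    by (rule gap_bound) (use y s \<open>y < 0\<close> in auto)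
  also have "gap (Complex 0 y) = 2 * pi * real p * (Lam y - V0)"
    by (rule gap_imag_axis) (use y \<open>y < 0\<close> in auto)
  also have "\<dots> \<le> 2 * pi * real p * (- 2 * pi * u)"
    using Lam_low[of y] y by (intro mult_left_mono) auto
  finally have 0: "gap (Complex s y) \<le> 2 * pi * real p * (- 2 * pi * u) + slope * (s - 0)"
    by simp
  define Q where "Q = pi\<^sup>2 * real p"
  have Q: "12 * u < 2 * Q" using pi_p_u by (simp add: Q_def)
  have 1: "gap (Complex s y) \<le> - 4 * Q * u + (4 * u + 2 * Q) * s" 
    by (rule order_trans[OF 0]) (simp add: Q_def power2_eq_square algebra_simps)
  show ?thesis
  proof (cases "s \<le> u")
    case True
    have "(4 * u + 2 * Q) * s \<le> (4 * u + 2 * Q) * u" using True u Q by (intro mult_left_mono) auto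
    then have "gap (Complex s y) \<le> - u * (2 * Q - 4 * u)" using 1 by (simp add: algebra_simps)
    also have "\<dots> \<le> - u * (2 * Q - 12 * u)" using u by (simp add: algebra_simps)
    finally show ?thesis using True by (simp add: Q_def mult_ac)
  next
    case False
    have "(4 * u - 2 * Q) * s \<le> (4 * u - 2 * Q) * u" using False u Q by (intro mult_left_mono_neg) auto
    then have "gap (Complex s y) - 4 * Q * (s - u) \<le> - u * (2 * Q - 4 * u)" using 1 by (simp add: algebra_simps)
    also have "\<dots> \<le> - u * (2 * Q - 12 * u)" using u by (simp add: algebra_simps)
    finally show ?thesis using False by (simp add: Q_def mult_ac)
  qed
qed

text \<open>From a value of at most 0 on the axis, three lengths u of growth stand against two of
  decay of the kernel: 3 (4 u + 2 \<pi>^2 p) - 8 \<pi>^2 p = - (2 \<pi>^2 p - 12 u).\<close>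

lemma right_estimate:
  assumes y: "- 2 * pi < y" "y < 0"
  shows "gap (Complex (3 * u) y) - 4 * pi\<^sup>2 * real p * (2 * u) \<le> - u * (2 * pi\<^sup>2 * real p - 12 * u)"
proof -
  have "gap (Complex (3 * u) y) \<le> gap (Complex 0 y) + slope * (3 * u - 0)"
    by (rule gap_bound) (use y u in auto)
  also have "gap (Complex 0 y) = 2 * pi * real p * (Lam y - V0)"
    by (rule gap_imag_axis) (use y in auto)
  also have "\<dots> \<le> 0" using Lam_less[of y] y
    by (cases "y = - \<theta>") (auto simp: V0_def intro!: mult_nonneg_nonpos)
  finally show ?thesis by (simp add: algebra_simps)
qed

text \<open>For the omitted summands at the beginning, hence with \<open>Ps\<close> and without the
  shift. Up to the height 2 \<pi> (p - 1) + \<theta> the potential on the axis is one period below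
  that of the saddle point, and the horizontal way to t u regains only part of this.\<close>

lemma lower_estimate:
  assumes t: "0 \<le> t" "t < 1" "2 * pi * real p * t \<le> 2 * pi * (real p - 1) + \<theta>"
  shows "gaps (of_real t * \<xi>) - 2 * pi * real p * (2 * pi * real p * u + V0) \<le> - u * (2 * pi\<^sup>2 * real p - 12 * u)"
proof -
  have e: "of_real t * \<xi> = Complex (t * u) (2 * pi * real p * t)" by (simp add: complex_eq_iff)
  have tu: "t * u < u" using t u by simp
  have pm: "real (p - Suc 0) = real p - 1" "real (p - 1) = real p - 1" using p by simp_all
  have "gaps (of_real t * \<xi>) \<le> 2 * pi * real p * Lam (2 * pi * real p * t) + slope * (t * u)"
    unfolding e by (rule gaps_bound) (use t u tu in auto)
  also have "\<dots> \<le> 2 * pi * real p * (2 * pi * real (p - 1) * u + V0) + slope * u"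
    using t tu u by (intro add_mono mult_left_mono Lam_le) (auto simp: pm)
  finally have "gaps (of_real t * \<xi>) - 2 * pi * real p * (2 * pi * real p * u + V0)
      \<le> 2 * pi * real p * (2 * pi * (real p - 1) * u + V0) + slope * u - 2 * pi * real p * (2 * pi * real p * u + V0)"
    by (simp add: pm)
  also have "\<dots> = - u * (2 * pi\<^sup>2 * real p - 4 * u)" by (simp add: algebra_simps power2_eq_square)
  also have "\<dots> \<le> - u * (2 * pi\<^sup>2 * real p - 12 * u)" using u by (simp add: algebra_simps)
  finally show ?thesis .
qed

text \<open>For y = 0 the value lies between 0 and 2 cosh u - 2. The deviations of at most 2 |y| in
  the real and 9/4 |y| in the imaginary part fit into the gap 3 - 2 cosh u, since 17/4 < 8.\<close>

lemma f_le_1: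
  assumes y: "\<bar>y\<bar> \<le> (3 - 2 * cosh u) / 8" and s: "0 \<le> s" "s \<le> u"
  shows "norm (f (Complex s y)) \<le> 1"
proof -
  have y1: "\<bar>y\<bar> \<le> 1" using y cosh_gt_1 by simp
  have c1: "1 - \<bar>y\<bar> \<le> cos y"
  proof -
    have "(sin (y / 2))\<^sup>2 \<le> (y / 2)\<^sup>2"
      using abs_sin_x_le_abs_x[of "y / 2"] by (simp only: abs_le_square_iff)
    moreover have "cos y = 1 - 2 * (sin (y / 2))\<^sup>2" using cos_double_sin[of "y / 2"] by simp
    ultimately have "1 - y\<^sup>2 / 2 \<le> cos y" by (simp add: power_divide)
    moreover have "\<bar>y\<bar> * \<bar>y\<bar> \<le> 1 * \<bar>y\<bar>" using y1 by (intro mult_right_mono) auto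
    then have "y\<^sup>2 \<le> 1 * \<bar>y\<bar>" by (simp add: power2_eq_square)
    ultimately show ?thesis by linarith
  qed
  have cs: "1 \<le> cosh s" "cosh s \<le> cosh u" using s u by (auto simp: cosh_real_ge_1 cosh_real_nonneg_le_iff)
  have "sinh s \<le> sinh u" using s by (simp add: sinh_real_le_iff)
  then have "sinh s \<le> 9/8" using sinh_less by linarith
  moreover have "0 \<le> sinh s" using s by simp
  ultimately have sn: "0 \<le> sinh s" "sinh s \<le> 9/8" by blast+
  have "cosh s * cos y \<le> cosh u * 1" using cs c1 y1 by (intro mult_mono) auto
  then have r0: "0 \<le> Re (f (Complex s y))" by (simp add: Re_f)
  have "1 * (1 - \<bar>y\<bar>) \<le> cosh s * cos y" using cs c1 y1 by (intro mult_mono) auto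
  then have r: "Re (f (Complex s y)) \<le> 2 * cosh u - 2 + 2 * \<bar>y\<bar>" by (simp add: Re_f)
  have "\<bar>Im (f (Complex s y))\<bar> = 2 * (sinh s * \<bar>sin y\<bar>)" using sn by (simp add: Im_f abs_mult)
  also have "\<dots> \<le> 2 * (9/8 * \<bar>y\<bar>)" using sn abs_sin_x_le_abs_x[of y] by (intro mult_left_mono mult_mono) auto
  finally have i: "\<bar>Im (f (Complex s y))\<bar> \<le> 9/4 * \<bar>y\<bar>" by simp
  have "norm (f (Complex s y)) \<le> \<bar>Re (f (Complex s y))\<bar> + \<bar>Im (f (Complex s y))\<bar>" by (rule cmod_le)
  then show ?thesis using r r0 i y by simp
qed

lemma arctan_le_self: "0 \<le> x \<Longrightarrow> arctan x \<le> (x::real)"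
proof -
  assume x: "0 \<le> x"
  have "0 - arctan 0 \<le> x - arctan x"
  proof (rule DERIV_nonneg_imp_nondecreasing[of 0 x "\<lambda>x. x - arctan x"])
    fix t :: real
    have "((\<lambda>x. x - arctan x) has_real_derivative 1 - inverse (1 + t\<^sup>2)) (at t)"
      by (intro DERIV_diff DERIV_ident DERIV_arctan)
    moreover have "inverse (1 + t\<^sup>2) \<le> 1" by (intro inverse_le_1_iff[THEN iffD2]) auto
    ultimately show "\<exists>y. ((\<lambda>x. x - arctan x) has_real_derivative y) (at t) \<and> 0 \<le> y" by (intro exI conjI) auto
  qed (rule x)
  then show ?thesis by simp
qed

lemma Im_Ln_le_quotient:
  assumes "Re z \<ge> m" "m > 0" "\<bar>Im z\<bar> \<le> d"
  shows "Im (Ln z) \<le> d / m"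
proof -
  have z: "z \<noteq> 0" "Re z > 0" using assms by auto
  have "Im (Ln z) = arctan (Im z / Re z)" using z arg_conv_arctan[of z] by (simp add: Arg_eq_Im_Ln)
  also have "\<dots> \<le> arctan (d / m)" using assms z
    by (subst arctan_le_iff) (intro frac_le, auto)
  also have "\<dots> \<le> d / m" using assms by (intro arctan_le_self) auto
  finally show ?thesis .
qed

text \<open>The top side passes the zero u of f, where log f is singular. Up to u - \<delta> one has
  |f| \<le> 1 and Re f \<ge> m, so that Re F is not positive and Im F is small. The remaining length
  \<delta> is covered by the crude slope, and beyond u the kernel decays faster than the slope. With
  A = 2 \<pi> p V0 the value near 0 is at most - A/2, and the two corrections of A/8 leave -
  A/4.\<close>

lemma top_estimate:
  "\<exists>\<epsilon> c. 0 < \<epsilon> \<and> \<epsilon> \<le> \<theta> / 2 \<and> \<epsilon> \<le> (3 - 2 * cosh u) / 8 \<and> 0 < c \<and>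
     (\<forall>y s. - \<epsilon> \<le> y \<and> y < 0 \<and> 0 \<le> s \<and> s \<le> 3 * u \<longrightarrow>
        gap (Complex s y) - 4 * pi\<^sup>2 * real p * max 0 (s - u) \<le> - c)"
proof -
  define A where "A = 2 * pi * real p * V0"
  have A: "A > 0" using V0_pos p_ge_1 by (simp add: A_def)
  have slope: "slope > 0" using u by (intro add_pos_nonneg) auto
  define \<delta> where "\<delta> = min (u / 2) (A / (8 * slope))"
  have "0 < \<delta>" unfolding \<delta>_def min_less_iff_conj using u A slope by (intro conjI divide_pos_pos mult_pos_pos) auto
  moreover have "\<delta> \<le> u / 2" unfolding \<delta>_def by (rule min.cobounded1)
  ultimately have d: "0 < \<delta>" "\<delta> \<le> u / 2" by auto
  have "\<delta> \<le> A / (8 * slope)" unfolding \<delta>_def by (rule min.cobounded2)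
  then have ds: "slope * \<delta> \<le> A / 8" using slope by (simp add: field_simps)
  define m where "m = 2 * cosh u - 2 * cosh (u - \<delta>)"
  have m: "m > 0" using d u cosh_real_nonneg_less_iff[of "u - \<delta>" u] by (simp add: m_def)
  have "isCont Lam 0" using Lam_deriv by (rule DERIV_isCont)
  then have "(Lam \<longlongrightarrow> 0) (at 0)" by (simp add: isCont_def Lam_0)
  then have "\<forall>\<^sub>F y in at 0. Lam y < V0 / 2" by (rule order_tendstoD) (use V0_pos in simp)
  then obtain e where e: "e > 0" "\<And>y. y \<noteq> 0 \<Longrightarrow> \<bar>y\<bar> < e \<Longrightarrow> Lam y < V0 / 2"
    by (auto simp: eventually_at dist_real_def)
  \<comment> \<open>For \<epsilon> at most r the imaginary part of log f contributes at most A/8 on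
    the way to u.\<close>
  define r where "r = A * m / (36 * pi * real p * u)"
  have r: "r > 0" using A m u p_ge_1 by (simp add: r_def)
  define \<epsilon> where "\<epsilon> = Min {e / 2, \<theta> / 2, (3 - 2 * cosh u) / 8, r}"
  have "\<epsilon> \<le> e / 2" "\<epsilon> \<le> \<theta> / 2" "\<epsilon> \<le> (3 - 2 * cosh u) / 8" "\<epsilon> \<le> r"
    unfolding \<epsilon>_def by (rule Min_le; simp)+
  moreover have "0 < \<epsilon>" using e(1) theta u r by (auto simp: \<epsilon>_def)
  ultimately have \<epsilon>: "0 < \<epsilon>" "\<epsilon> < e" "\<epsilon> \<le> \<theta> / 2" "\<epsilon> \<le> (3 - 2 * cosh u) / 8" "\<epsilon> \<le> r"
    using e(1) by auto
  have main: "gap (Complex s y) - 4 * pi\<^sup>2 * real p * max 0 (s - u) \<le> - (A / 4)"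
    if y: "- \<epsilon> \<le> y" "y < 0" and s: "0 \<le> s" "s \<le> 3 * u" for s y
  proof -
    have yS: "- 2 * pi < y" using y \<epsilon>(3) theta pi_gt3 by linarith
    have ay: "\<bar>y\<bar> \<le> \<epsilon>" using y by simp
    have g0: "gap (Complex 0 y) \<le> - (A / 2)"
    proof -
      have "Lam y < V0 / 2" using e(2)[of y] y \<epsilon> by auto
      then have "2 * pi * real p * (Lam y - V0) \<le> 2 * pi * real p * (- (V0 / 2))"
        by (intro mult_left_mono) auto
      then show ?thesis using gap_imag_axis[OF yS y(2)] by (simp add: A_def)
    qed
    define D where "D = 2 * pi * real p * (9/4 * \<epsilon> / m)"
    have Du: "D * u \<le> A / 8"
    proof -
      have "D * u \<le> 2 * pi * real p * (9/4 * r / m) * u"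
        unfolding D_def using \<epsilon> m u by (intro mult_right_mono mult_left_mono divide_right_mono) auto
      also have "\<dots> = A / 8" using m u p_ge_1 by (simp add: r_def field_simps)
      finally show ?thesis .
    qed
    have D0: "D \<ge> 0" using \<epsilon> m by (simp add: D_def)
    have low: "gap (Complex b y) \<le> - (3 * A / 8)" if b: "0 \<le> b" "b \<le> u - \<delta>" for b
    proof -
      have S: "Complex s y \<in> Sig" for s using y yS by (simp add: Sig_def)
      have bd: "u * Re (F (Complex s y)) + 2 * pi * real p * Im (F (Complex s y)) \<le> D" if s: "0 \<le> s" "s \<le> b" for s
      proof -
        have n: "norm (f (Complex s y)) \<le> 1" using ay \<epsilon> s b d by (intro f_le_1) auto
        have "Re (F (Complex s y)) = ln (norm (f (Complex s y)))"
          unfolding F_def using f_nz[OF S] by simp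
        also have "\<dots> \<le> 0" using n f_nz[OF S, of s] by (simp add: ln_le_zero_iff)
        finally have 1: "u * Re (F (Complex s y)) \<le> 0" using u by (simp add: mult_nonneg_nonpos)
        have cs: "cosh s \<le> cosh (u - \<delta>)" using s b u d by (subst cosh_real_nonneg_le_iff) auto
        have "cosh s * cos y \<le> cosh s * 1" by (intro mult_left_mono) auto
        moreover have "Re (f (Complex s y)) = 2 * cosh u - 2 * (cosh s * cos y)" by (simp add: Re_f)
        ultimately have re: "Re (f (Complex s y)) \<ge> m" using cs unfolding m_def by linarith
        have ss: "0 \<le> sinh s" "sinh s \<le> 9/8"
        proof -
          have "sinh s \<le> sinh u" using s b d by (simp add: sinh_real_le_iff)
          then show "sinh s \<le> 9/8" using sinh_less by linarith
          show "0 \<le> sinh s" using s by simp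
        qed
        have "\<bar>Im (f (Complex s y))\<bar> = 2 * (sinh s * \<bar>sin y\<bar>)" using ss by (simp add: Im_f abs_mult)
        also have "\<dots> \<le> 2 * (9/8 * \<epsilon>)"
          using ss abs_sin_x_le_abs_x[of y] ay by (intro mult_left_mono mult_mono) auto
        finally have im: "\<bar>Im (f (Complex s y))\<bar> \<le> 9/4 * \<epsilon>" by simp
        have "Im (F (Complex s y)) \<le> 9/4 * \<epsilon> / m" unfolding F_def by (rule Im_Ln_le_quotient[OF re m im])
        then have "2 * pi * real p * Im (F (Complex s y)) \<le> D" unfolding D_def by (intro mult_left_mono) auto
        then show ?thesis using 1 by simp
      qed
      have "u * Re (P (Complex b y)) + 2 * pi * real p * Im (P (Complex b y))
          \<le> u * Re (P (Complex 0 y)) + 2 * pi * real p * Im (P (Complex 0 y)) + D * (b - 0)"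
        by (rule horizontal_bound[OF b(1) P[OF S] bd])
      then have "gap (Complex b y) \<le> gap (Complex 0 y) + D * b" by (simp add: gap_def)
      moreover have "D * b \<le> D * u" using D0 b d by (intro mult_left_mono) auto
      ultimately show ?thesis using g0 Du by linarith
    qed
    show ?thesis
    proof (cases "s \<le> u - \<delta>")
      case True
      then show ?thesis using low[of s] s A d by simp
    next
      case False
      have "gap (Complex s y) \<le> gap (Complex (u - \<delta>) y) + slope * (s - (u - \<delta>))"
        by (rule gap_bound) (use yS y False s d in auto)
      moreover have "gap (Complex (u - \<delta>) y) \<le> - (3 * A / 8)" using low[of "u - \<delta>"] d by simp
      moreover have "slope * (s - (u - \<delta>)) = slope * \<delta> + slope * (s - u)" by (simp add: algebra_simps)
      moreover have "slope * (s - u) \<le> 4 * pi\<^sup>2 * real p * max 0 (s - u)"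
      proof (cases "s \<le> u")
        case True
        then show ?thesis using slope by (simp add: mult_nonneg_nonpos)
      next
        case False
        have "slope \<le> 4 * pi\<^sup>2 * real p" using pi_p_u u by simp
        then show ?thesis using False by (simp add: mult_right_mono)
      qed
      ultimately show ?thesis using ds by linarith
    qed
  qed
  show ?thesis
    by (rule exI[of _ \<epsilon>], rule exI[of _ "A / 4"]) (use main \<epsilon> A in auto)
qed

section \<open>Asymptotics and interpolation of the summands\<close>

definition "mesh N = \<xi> / of_nat N"
text \<open>This is 2 \<pi> i / \<open>mesh N\<close>, the \<kappa> of the summation formula. Both
  its parts are linear in N, so that a cut-off R independent of N is possible.\<close>

definition "freq N = 2 * of_real pi * \<i> * of_nat N / \<xi>"
definition "summand N k = (\<Prod>l=1..k. f (of_nat l * mesh N))"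
definition "period = of_nat p * (2 * of_real pi * \<i>)"

lemma period_simps [simp]: "Re period = 0" "Im period = 2 * pi * real p"
  by (simp_all add: period_def)

lemma exp_period: "exp period = 1"
  using exp_integer_2pi[of "of_nat p"] by (simp add: period_def mult_ac)

lemma f_periodic: "f (v - period) = f v"
proof -
  have "exp (v - period) = exp v" by (simp add: exp_diff exp_period)
  moreover have "exp (- (v - period)) = exp (- v)"
    by (simp add: exp_diff exp_period exp_minus inverse_eq_divide)
  ultimately show ?thesis by (simp only: f_def cosh_def)
qed

lemma cosh_xi: "cosh \<xi> = of_real (cosh u)"
proof -
  have "cos (2 * pi * real p) = 1" "sin (2 * pi * real p) = 0"
    using cos_2npi[of p] sin_2npi[of p] by (simp_all add: mult_ac)
  then show ?thesis by (simp add: complex_eq_iff cosh_complex)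
qed

lemma colored_jones_fig8_sum:
  assumes "N > 0"
  shows "colored_jones_fig8 N (exp (\<xi> / of_nat N)) = (\<Sum>k<N. summand N k)"
proof -
  have "of_nat N * (\<xi> / of_nat N) = \<xi>" using assms by simp
  then show ?thesis
    unfolding colored_jones_fig8_exp summand_def f_def mesh_def by (simp only: cosh_xi)
qed

lemma mesh_simps: "Re (mesh N) = u / real N" "Im (mesh N) = 2 * pi * real p / real N"
  by (simp_all add: mesh_def)

lemma norm_mesh: "norm (mesh N) = norm \<xi> / real N"
  by (simp add: mesh_def norm_divide)

lemma freq_mesh: "N > 0 \<Longrightarrow> freq N * mesh N = 2 * of_real pi * \<i>"
  using xi_nz by (simp add: freq_def mesh_def)

lemma freq_simps: "Re (freq N) = 4 * pi\<^sup>2 * real p * real N / xi_norm2" "Im (freq N) = 2 * pi * u * real N / xi_norm2"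
  by (simp_all add: freq_def Re_divide Im_divide xi_norm2_def power2_eq_square)

text \<open>Amounts to u \<le> 2 \<pi> p; it puts the ray of all \<kappa> t into the cone where exp
  + 1 is bounded below.\<close>

lemma freq_cone: "\<bar>Im (freq N)\<bar> \<le> Re (freq N)"
proof -
  have "2 * pi * u \<le> 2 * pi * (2 * pi * real p)"
  proof (intro mult_left_mono)
    have "2 * 3 * 1 \<le> 2 * pi * real p" using p_ge_1 pi_gt3 by (intro mult_mono) auto
    then show "u \<le> 2 * pi * real p" using u_less by simp
  qed simp
  then have "2 * pi * u * real N / xi_norm2 \<le> 2 * pi * (2 * pi * real p) * real N / xi_norm2"
    using xi_norm2_pos by (intro divide_right_mono mult_right_mono) auto
  then show ?thesis using u xi_norm2_pos by (simp add: freq_simps power2_eq_square mult_ac)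
qed

lemma Re_divide_mesh: "Re (z / mesh N) = real N / xi_norm2 * (u * Re z + 2 * pi * real p * Im z)"
proof -
  have "z / mesh N = of_nat N * (z / \<xi>)" by (simp add: mesh_def)
  moreover have "Re (of_nat N * w) = real N * Re w" for w by simp
  ultimately have "Re (z / mesh N) = real N * Re (z / \<xi>)" by (simp only:)
  also have "Re (z / \<xi>) = (u * Re z + 2 * pi * real p * Im z) / xi_norm2"
    using Re_divide_xi[of z] xi_norm2_pos by (simp add: field_simps)
  finally show ?thesis by simp
qed

definition "strip = {v :: complex. \<bar>Re v\<bar> < u}"

lemma strip_open: "open strip" and strip_convex: "convex strip"
proof -
  have "strip = {v. - u < Re v} \<inter> {v. Re v < u}" by (auto simp: strip_def)
  then show "open strip" "convex strip"
    by (simp_all add: open_Int convex_Int open_halfspace_Re_gt open_halfspace_Re_lt convex_halfspace_Re_gt convex_halfspace_Re_lt)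
qed

lemma Fs_holomorphic: "Fs holomorphic_on strip"
proof -
  have "1 - exp (- of_real u - v) \<notin> \<real>\<^sub>\<le>\<^sub>0" "1 - exp (- of_real u + v) \<notin> \<real>\<^sub>\<le>\<^sub>0" if "v \<in> strip" for v
    using exp_less_1[of v] that by (auto simp: strip_def intro!: one_minus_nonpos)
  then show ?thesis unfolding Fs_def[abs_def] by (intro holomorphic_intros) auto
qed

lemma compact_bound:
  fixes g :: "complex \<Rightarrow> complex"
  assumes "g holomorphic_on S" "K \<subseteq> S" "compact K"
  obtains B where "B > 0" "\<And>v. v \<in> K \<Longrightarrow> norm (g v) \<le> B"
proof -
  have "compact (g ` K)"
    using assms by (intro compact_continuous_image holomorphic_on_imp_continuous_on holomorphic_on_subset[OF assms(1)])
  then have "bounded (g ` K)" by (rule compact_imp_bounded)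
  then obtain B where "B > 0" "\<forall>x\<in>g ` K. norm x \<le> B" by (auto simp: bounded_pos)
  then show thesis using that[of B] by blast
qed

lemma Fs_derivs:
  assumes "K \<subseteq> strip" "compact K"
  obtains B where "B > 0"
    "\<And>v. v \<in> K \<Longrightarrow> (Fs has_field_derivative deriv Fs v) (at v)"
    "\<And>v. v \<in> K \<Longrightarrow> (deriv Fs has_field_derivative deriv (deriv Fs) v) (at v)"
    "\<And>v. v \<in> K \<Longrightarrow> norm (deriv Fs v) \<le> B"
    "\<And>v. v \<in> K \<Longrightarrow> norm (deriv (deriv Fs) v) \<le> B"
proof -
  have h1: "deriv Fs holomorphic_on strip" by (rule holomorphic_deriv[OF Fs_holomorphic strip_open])
  have h2: "deriv (deriv Fs) holomorphic_on strip" by (rule holomorphic_deriv[OF h1 strip_open])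
  obtain B1 where B1: "B1 > 0" "\<And>v. v \<in> K \<Longrightarrow> norm (deriv Fs v) \<le> B1"
    using compact_bound[OF h1 assms] by blast
  obtain B2 where B2: "B2 > 0" "\<And>v. v \<in> K \<Longrightarrow> norm (deriv (deriv Fs) v) \<le> B2"
    using compact_bound[OF h2 assms] by blast
  show thesis
  proof (rule that[of "max B1 B2"])
    fix v assume v: "v \<in> K"
    then have s: "v \<in> strip" using assms by auto
    show "(Fs has_field_derivative deriv Fs v) (at v)" using Fs_holomorphic strip_open s by (rule holomorphic_derivI)
    show "(deriv Fs has_field_derivative deriv (deriv Fs) v) (at v)" using h1 strip_open s by (rule holomorphic_derivI)
    show "norm (deriv Fs v) \<le> max B1 B2" using B1(2)[OF v] by simp
    show "norm (deriv (deriv Fs) v) \<le> max B1 B2" using B2(2)[OF v] by simp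
  qed (use B1 in simp)
qed

text \<open>The midpoint rule on a compact rectangle inside the vertical strip. The bound \<rho> < 1
  keeps the points away from the zero \<xi> of f; at most N steps with errors of order |h|^2 add up
  to O(1/N).\<close>

lemma summand_asymptotics:
  assumes \<rho>: "0 < \<rho>" "\<rho> < 1"
  obtains C where "C > 0" "\<And>N k. N > 0 \<Longrightarrow> real k + 1/2 \<le> \<rho> * real N \<Longrightarrow>
    \<exists>e. norm e \<le> C / real N \<and> summand N k = exp ((Ps ((of_nat k + 1/2) * mesh N) - Ps (mesh N / 2)) / mesh N + e)"
proof -
  define S where "S = cbox 0 (Complex (\<rho> * u) (2 * pi * real p))"
  have S: "v \<in> S \<longleftrightarrow> 0 \<le> Re v \<and> Re v \<le> \<rho> * u \<and> 0 \<le> Im v \<and> Im v \<le> 2 * pi * real p" for v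
    by (auto simp: S_def in_cbox_complex_iff)
  have "\<rho> * u < u" using \<rho> u by simp
  then have Sst: "S \<subseteq> strip" by (auto simp: S strip_def)
  have "compact S" by (simp add: S_def)
  from Fs_derivs[OF Sst this] obtain B where B: "B > 0"
    "\<And>v. v \<in> S \<Longrightarrow> (Fs has_field_derivative deriv Fs v) (at v)"
    "\<And>v. v \<in> S \<Longrightarrow> (deriv Fs has_field_derivative deriv (deriv Fs) v) (at v)"
    "\<And>v. v \<in> S \<Longrightarrow> norm (deriv (deriv Fs) v) \<le> B" by metis
  show thesis
  proof (rule that[of "B * xi_norm2"])
    show "B * xi_norm2 > 0" using B(1) xi_norm2_pos by simp
    fix N k :: nat assume N: "N > 0" and k: "real k + 1/2 \<le> \<rho> * real N"
    have inS: "of_real x * mesh N \<in> S" if x: "0 \<le> x" "x \<le> real k + 1/2" for x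
    proof -
      have "x / real N \<le> \<rho>" "x / real N \<ge> 0" using x k N by (auto simp: field_simps)
      then have "x / real N * u \<le> \<rho> * u" "x / real N * (2 * pi * real p) \<le> 1 * (2 * pi * real p)"
        using u \<rho> by (intro mult_right_mono; simp)+
      then show ?thesis using x u by (simp add: S mesh_simps)
    qed
    define e where "e = (\<Sum>l=1..k. Fs (of_nat l * mesh N)) - (Ps ((of_nat k + 1/2) * mesh N) - Ps (mesh N / 2)) / mesh N"
    have "norm e \<le> real k * B * norm (mesh N) ^ 2 / 8"
      unfolding e_def
    proof (rule midpoint_rule[of S])
      show "convex S" by (simp add: S_def)
      show "mesh N / 2 \<in> S" using inS[of "1/2"] by simp
      show "(of_nat k + 1/2) * mesh N \<in> S" using inS[of "real k + 1/2"] by simp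
      show "mesh N \<noteq> 0" using N xi_nz by (simp add: mesh_def)
      fix v assume v: "v \<in> S"
      show "(Ps has_field_derivative Fs v) (at v within S)"
        using Ps_deriv[of v] Sst v by (auto simp: strip_def intro: has_field_derivative_at_within)
      show "(Fs has_field_derivative deriv Fs v) (at v within S)"
        "(deriv Fs has_field_derivative deriv (deriv Fs) v) (at v within S)"
        using B(2,3)[OF v] by (auto intro: has_field_derivative_at_within)
      show "norm (deriv (deriv Fs) v) \<le> B" using B(4)[OF v] .
    qed
    also have "\<dots> \<le> real N * B * norm (mesh N) ^ 2 / 8"
    proof -
      have "\<rho> * real N \<le> 1 * real N" using \<rho> by (intro mult_right_mono) auto
      then have "real k \<le> real N" using k by simp
      then show ?thesis using B(1) by (intro divide_right_mono mult_right_mono) auto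
    qed
    also have "\<dots> = B * xi_norm2 / real N / 8" using N
      by (simp add: norm_mesh power_divide cmod_xi power2_eq_square[of "real N"])
    also have "\<dots> \<le> B * xi_norm2 / real N"
    proof -
      have "x / 8 \<le> x" if "0 \<le> x" for x :: real using that by simp
      moreover have "0 \<le> B * xi_norm2 / real N" using B(1) xi_norm2_pos by simp
      ultimately show ?thesis by blast
    qed
    finally have "norm e \<le> B * xi_norm2 / real N" .
    moreover have "summand N k = exp ((Ps ((of_nat k + 1/2) * mesh N) - Ps (mesh N / 2)) / mesh N + e)"
    proof -
      have "summand N k = (\<Prod>l=1..k. exp (Fs (of_nat l * mesh N)))"
        unfolding summand_def
      proof (rule prod.cong)
        fix l assume "l \<in> {1..k}"
        then have "of_real (real l) * mesh N \<in> S" by (intro inS) auto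
        then have "of_nat l * mesh N \<in> strip" using Sst by auto
        then show "f (of_nat l * mesh N) = exp (Fs (of_nat l * mesh N))" by (simp add: exp_Fs strip_def)
      qed simp
      also have "\<dots> = exp (\<Sum>l=1..k. Fs (of_nat l * mesh N))" by (simp add: exp_sum)
      finally show ?thesis by (simp add: e_def)
    qed
    ultimately show "\<exists>e. norm e \<le> B * xi_norm2 / real N \<and> summand N k = exp ((Ps ((of_nat k + 1/2) * mesh N) - Ps (mesh N / 2)) / mesh N + e)"
      by blast
  qed
qed

text \<open>Taylor expansion at 0, where \<open>Ps\<close> vanishes. This is the lower end of the
  midpoint rule and finally yields the factor 1 / (2 sinh (u/2)).\<close>

lemma Ps_half_step:
  obtains C where "C > 0" "\<And>N. N > 0 \<Longrightarrow> norm (Ps (mesh N / 2) / mesh N - Fs 0 / 2) \<le> C / real N"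
proof -
  define S where "S = cbox 0 (Complex (u / 2) (2 * pi * real p))"
  have S: "v \<in> S \<longleftrightarrow> 0 \<le> Re v \<and> Re v \<le> u / 2 \<and> 0 \<le> Im v \<and> Im v \<le> 2 * pi * real p" for v
    by (auto simp: S_def in_cbox_complex_iff)
  have Sst: "S \<subseteq> strip" using u by (auto simp: S strip_def)
  have "compact S" by (simp add: S_def)
  from Fs_derivs[OF Sst this] obtain B where B: "B > 0"
    "\<And>v. v \<in> S \<Longrightarrow> (Fs has_field_derivative deriv Fs v) (at v)"
    "\<And>v. v \<in> S \<Longrightarrow> norm (deriv Fs v) \<le> B" by metis
  show thesis
  proof (rule that[of "B * norm \<xi>"])
    show "B * norm \<xi> > 0" using B(1) xi_nz by simp
    fix N :: nat assume N: "N > 0"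
    define d where "d = mesh N / 2"
    have dS: "d \<in> S"
    proof -
      have N1: "1 \<le> real N" using N by simp
      define a b where "a = u / real N" and "b = 2 * pi * real p / real N"
      have "a \<le> u / 1" "b \<le> 2 * pi * real p / 1"
        unfolding a_def b_def using u N1 by (intro divide_left_mono; simp)+
      then have "a \<le> u" "b \<le> 2 * pi * real p" by simp_all
      moreover have "0 \<le> a" "0 \<le> b" using u by (simp_all add: a_def b_def)
      moreover have "Re d = a / 2" "Im d = b / 2"
        by (simp_all add: d_def mesh_simps a_def b_def)
      ultimately show ?thesis unfolding S by (intro conjI; linarith)
    qed
    have 0: "0 \<in> S" using u by (simp add: S)
    define g where "g i = (if i = 0 then Ps else if i = Suc 0 then Fs else deriv Fs)" for i :: nat
    have "norm (g 0 d - (\<Sum>i\<le>1. g i 0 * (d - 0) ^ i / fact i)) \<le> B * norm (d - 0) ^ Suc 1 / fact 1"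
    proof (rule complex_Taylor[OF _ _ _ 0 dS])
      show "convex S" by (simp add: S_def)
      show "(g i has_field_derivative g (Suc i) v) (at v within S)" if "v \<in> S" "i \<le> 1" for i v
        using that B(2)[of v] Ps_deriv[of v] Sst by (cases "i = 0") (auto simp: g_def strip_def intro: has_field_derivative_at_within)
      show "norm (g (Suc 1) v) \<le> B" if "v \<in> S" for v using B(3)[OF that] by (simp add: g_def)
    qed
    then have "norm (Ps d - d * Fs 0) \<le> B * norm d ^ 2"
      by (simp add: g_def power2_eq_square Ps_def mult.commute algebra_simps)
    then have "norm (Ps d - d * Fs 0) / norm (mesh N) \<le> B * norm d ^ 2 / norm (mesh N)"
      by (rule divide_right_mono) simp
    also have "\<dots> \<le> B * norm (mesh N)"
      using B(1) N xi_nz by (simp add: d_def norm_divide power_divide power2_eq_square)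
    finally have "norm ((Ps d - d * Fs 0) / mesh N) \<le> B * norm (mesh N)" by (simp add: norm_divide)
    moreover have "(Ps d - d * Fs 0) / mesh N = Ps (mesh N / 2) / mesh N - Fs 0 / 2"
    proof -
      have "mesh N \<noteq> 0" using N xi_nz by (simp add: mesh_def)
      then have "d / mesh N = 1 / 2" by (simp add: d_def)
      moreover have "(Ps d - d * Fs 0) / mesh N = Ps d / mesh N - (d / mesh N) * Fs 0"
        by (simp add: diff_divide_distrib)
      ultimately show ?thesis by (simp add: d_def)
    qed
    ultimately show "norm (Ps (mesh N / 2) / mesh N - Fs 0 / 2) \<le> B * norm \<xi> / real N" by (simp add: norm_mesh)
  qed
qed

text \<open>The difference equation is solved on a slightly wider strip that has room for two steps.
  As Re (\<open>freq N\<close>) is proportional to N, a fixed cut-off R attains any prescribed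
  exponential \<open>rate\<close>, and all constants come from one compact rectangle.\<close>

lemma interpolation:
  assumes b: "- 2 * pi < b0" "b0 < b1" "b1 < 0" and xr: "xr > 0" and rate: "rate > 0"
  defines "D \<equiv> {V :: complex. - 1 < Re V \<and> Re V < xr \<and> b0 < Im V \<and> Im V < b1}"
  obtains C N0 where "C > 0" "N0 > 0"
    "\<And>N. N \<ge> N0 \<Longrightarrow> \<exists>E. E holomorphic_on D \<and>
      (\<forall>V\<in>D. norm (E V - (P V / mesh N + F V / 2)) \<le> C / real N) \<and>
      (\<forall>V\<in>D. norm (E (V + mesh N) - E V - F (V + mesh N)) \<le> C * exp (- rate * real N))"
    "\<And>N V. N \<ge> N0 \<Longrightarrow> V \<in> D \<Longrightarrow> V + mesh N / 2 \<in> Sig \<and>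
      norm (P (V + mesh N / 2) / mesh N - (P V / mesh N + F V / 2)) \<le> C / real N"
proof -
  define c0 c1 where "c0 = (b0 - 2 * pi) / 2" and "c1 = b1 / 2"
  have c: "- 2 * pi < c0" "c0 < b0" "b1 < c1" "c1 < 0" using b by (auto simp: c0_def c1_def)
  \<comment> \<open>Chosen so that Re (\<open>freq N\<close>) times R is \<open>rate\<close> times
    N.\<close>
  define R where "R = rate * xi_norm2 / (4 * pi\<^sup>2 * real p)"
  have R: "R > 0" using rate xi_norm2_pos p_ge_1 by (simp add: R_def)
  define K where "K = cbox (Complex (- 3 - R) c0) (Complex (xr + 3 + R) c1)"
  have K: "v \<in> K \<longleftrightarrow> - 3 - R \<le> Re v \<and> Re v \<le> xr + 3 + R \<and> c0 \<le> Im v \<and> Im v \<le> c1" for v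
    by (auto simp: K_def in_cbox_complex_iff)
  have KS: "K \<subseteq> Sig" using c by (auto simp: K Sig_def)
  have cK: "compact K" by (simp add: K_def)
  obtain BF where BF: "BF > 0" "\<And>v. v \<in> K \<Longrightarrow> norm (F v) \<le> BF"
    using compact_bound[OF F_holomorphic KS cK] by blast
  have dF: "deriv F holomorphic_on Sig" by (rule holomorphic_deriv[OF F_holomorphic Sig_open])
  obtain M where M: "M > 0" "\<And>v. v \<in> K \<Longrightarrow> norm (deriv F v) \<le> M"
    using compact_bound[OF dF KS cK] by blast
  define W where "W = {v :: complex. c0 < Im v \<and> Im v < c1}"
  have WS: "W \<subseteq> Sig" using c by (auto simp: W_def Sig_def)
  define C where "C = max (4 * BF) (6 * M * xi_norm2\<^sup>2 / ((4 * pi\<^sup>2 * real p)\<^sup>2 * norm \<xi>) + M * norm \<xi>)"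
  have C0: "C > 0" using BF(1) by (simp add: C_def less_max_iff_disj)
  define d where "d = min (b0 - c0) (c1 - b1)"
  have d: "d > 0" using c by (simp add: d_def)
  \<comment> \<open>\<open>n1\<close> makes two steps fit into the margin of the strip,
    \<open>n2\<close> bounds the horizontal part of a step by 1, and \<open>n3\<close> makes exp (-
    rate N) at most 1/2.\<close>
  obtain n1 :: nat where n1: "real n1 > 4 * pi * real p / d" using reals_Archimedean2 by blast
  obtain n2 :: nat where n2: "real n2 > u" using reals_Archimedean2 by blast
  obtain n3 :: nat where n3: "real n3 > 1 / rate" using reals_Archimedean2 by blast
  define N0 where "N0 = Suc (max n1 (max n2 n3))"
  have big: "N > 0" "4 * pi * real p / real N < d" "u / real N < 1" "1 < rate * real N" if N: "N \<ge> N0" for N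
  proof -
    have Ns: "real N \<ge> real n1" "real N \<ge> real n2" "real N \<ge> real n3" "N > 0" using N by (auto simp: N0_def)
    then show "N > 0" by simp
    have "4 * pi * real p / d < real N" using n1 Ns by linarith
    then show "4 * pi * real p / real N < d" using d Ns by (simp add: field_simps)
    show "u / real N < 1" using n2 Ns by (simp add: divide_less_eq)
    have "1 / rate < real N" using n3 Ns by linarith
    then show "1 < rate * real N" using rate by (simp add: field_simps)
  qed
  have cD: "V + mesh N / 2 \<in> K" "V + mesh N / 2 \<in> W" "c0 < Im V" "Im V + 2 * Im (mesh N) < c1"
    "- 1 < Re V" "Re V < xr" "0 \<le> Re (mesh N)" "Re (mesh N) < 1" "V \<in> K" "0 \<le> Im (mesh N)"
    if N: "N \<ge> N0" and V: "V \<in> D" for N V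
  proof -
    have hI: "0 \<le> Im (mesh N)" "2 * Im (mesh N) < d" using big[OF N] by (simp_all add: mesh_simps)
    have hR: "0 \<le> Re (mesh N)" "Re (mesh N) < 1" using big[OF N] u by (simp_all add: mesh_simps)
    have v: "- 1 < Re V" "Re V < xr" "b0 < Im V" "Im V < b1" using V by (auto simp: D_def)
    have dd: "d \<le> b0 - c0" "d \<le> c1 - b1" by (auto simp: d_def)
    have I: "c0 < Im V" "Im V + 2 * Im (mesh N) < c1" using v dd hI c by linarith+
    have e: "Re (V + mesh N / 2) = Re V + Re (mesh N) / 2" "Im (V + mesh N / 2) = Im V + Im (mesh N) / 2" by simp_all
    show "V + mesh N / 2 \<in> K" unfolding K e using v I hI hR R by (intro conjI; linarith)
    show "V + mesh N / 2 \<in> W" unfolding W_def mem_Collect_eq e using I hI by (intro conjI; linarith)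
    show "V \<in> K" unfolding K using v I hI R by (intro conjI; linarith)
    show "c0 < Im V" "Im V + 2 * Im (mesh N) < c1" "- 1 < Re V" "Re V < xr" "0 \<le> Re (mesh N)" "Re (mesh N) < 1" "0 \<le> Im (mesh N)"
      using I v hR hI by simp_all
  qed
  have Pstep: "norm (P (V + mesh N / 2) / mesh N - (P V / mesh N + F V / 2)) \<le> M * norm \<xi> / real N"
    if N: "N \<ge> N0" and V: "V \<in> D" for N V
  proof -
    define e where "e = mesh N / 2"
    define q where "q i = (if i = 0 then P else if i = Suc 0 then F else deriv F)" for i :: nat
    have "norm (q 0 (V + e) - (\<Sum>i\<le>1. q i V * (V + e - V) ^ i / fact i)) \<le> M * norm (V + e - V) ^ Suc 1 / fact 1"
    proof (rule complex_Taylor[where S = K])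
      show "convex K" by (simp add: K_def)
      show "V \<in> K" "V + e \<in> K" using cD[OF N V] by (simp_all add: e_def)
      show "(q i has_field_derivative q (Suc i) v) (at v within K)" if "v \<in> K" "i \<le> 1" for i v
        using that P[of v] holomorphic_derivI[OF F_holomorphic Sig_open, of v] KS
        by (cases "i = 0") (auto simp: q_def intro: has_field_derivative_at_within)
      show "norm (q (Suc 1) v) \<le> M" if "v \<in> K" for v using M(2)[OF that] by (simp add: q_def)
    qed
    then have "norm (P (V + e) - P V - e * F V) \<le> M * norm e ^ 2"
      by (simp add: q_def power2_eq_square mult.commute algebra_simps)
    then have "norm (P (V + e) - P V - e * F V) / norm (mesh N) \<le> M * norm e ^ 2 / norm (mesh N)"
      by (rule divide_right_mono) simp
    also have "\<dots> \<le> M * norm (mesh N)"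
      using M(1) big(1)[OF N] xi_nz by (simp add: e_def norm_divide power_divide power2_eq_square)
    finally have "norm ((P (V + e) - P V - e * F V) / mesh N) \<le> M * norm (mesh N)" by (simp add: norm_divide)
    moreover have "(P (V + e) - P V - e * F V) / mesh N = P (V + mesh N / 2) / mesh N - (P V / mesh N + F V / 2)"
    proof -
      have "mesh N \<noteq> 0" using big(1)[OF N] xi_nz by (simp add: mesh_def)
      then have "e / mesh N = 1 / 2" by (simp add: e_def)
      moreover have "(P (V + e) - P V - e * F V) / mesh N = P (V + e) / mesh N - P V / mesh N - (e / mesh N) * F V"
        by (simp add: diff_divide_distrib)
      ultimately show ?thesis by (simp add: e_def)
    qed
    ultimately show ?thesis by (simp add: norm_mesh)
  qed
  have MC: "M * norm \<xi> / real N \<le> C / real N" for N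
  proof (rule divide_right_mono)
    have "0 \<le> 6 * M * xi_norm2\<^sup>2 / ((4 * pi\<^sup>2 * real p)\<^sup>2 * norm \<xi>)" using M(1) by simp
    then show "M * norm \<xi> \<le> C" by (simp add: C_def)
  qed simp
  show thesis
  proof (rule that[of C N0])
    show "C > 0" by (rule C0)
    show "N0 > 0" by (simp add: N0_def)
    show "V + mesh N / 2 \<in> Sig \<and> norm (P (V + mesh N / 2) / mesh N - (P V / mesh N + F V / 2)) \<le> C / real N"
      if "N \<ge> N0" "V \<in> D" for N V
      using Pstep[OF that] MC[of N] cD(1)[OF that] KS by auto
    fix N :: nat assume N: "N \<ge> N0"
    interpret ap: abel_plana F P c0 c1 R "mesh N" "freq N"
    proof
      show "F holomorphic_on {v. c0 < Im v \<and> Im v < c1}"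
        using F_holomorphic WS by (auto simp: W_def intro: holomorphic_on_subset)
      show "(P has_field_derivative F v) (at v)" if "c0 < Im v" "Im v < c1" for v
        using P[of v] WS that by (auto simp: W_def)
      show "0 < R" by (rule R)
      show "0 < Im (mesh N)" using big(1)[OF N] p by (simp add: mesh_simps)
      show "freq N * mesh N = 2 * of_real pi * \<i>" using freq_mesh[OF big(1)[OF N]] .
      show "\<bar>Im (freq N)\<bar> \<le> Re (freq N)" by (rule freq_cone)
    qed
    have kR: "Re (freq N) * R = rate * real N"
      using xi_norm2_pos p_ge_1 by (simp add: freq_simps R_def)
    have Dcols: "D \<subseteq> (\<lambda>V. V + mesh N / 2) -` W" using cD(2)[OF N] by auto
    have EH: "ap.E holomorphic_on D"
      unfolding ap.E_def[abs_def]
    proof (intro holomorphic_intros)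
      have "P holomorphic_on Sig"
        using P Sig_open by (auto simp: holomorphic_on_open)
      then have PW: "P holomorphic_on W" using WS by (rule holomorphic_on_subset)
      have XW: "ap.X holomorphic_on W" using ap.X_holomorphic by (simp add: W_def)
      have a: "(\<lambda>V. V + mesh N / 2) holomorphic_on D" "(\<lambda>V. V + mesh N / 2) ` D \<subseteq> W"
        using Dcols by (auto intro!: holomorphic_intros)
      show "(\<lambda>V. P (V + mesh N / 2)) holomorphic_on D"
        using holomorphic_on_compose_gen[OF a(1) PW a(2)] by (simp add: o_def)
      show "(\<lambda>V. ap.X (V + mesh N / 2)) holomorphic_on D"
        using holomorphic_on_compose_gen[OF a(1) XW a(2)] by (simp add: o_def)
      show "mesh N \<noteq> 0" using big(1)[OF N] xi_nz by (simp add: mesh_def)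
    qed
    have est: "norm (ap.E V - (P V / mesh N + F V / 2)) \<le> C / real N" if V: "V \<in> D" for V
    proof -
      define c where "c = V + mesh N / 2"
      have "norm (ap.X c) \<le> 6 * M / (Re (freq N))\<^sup>2"
      proof (rule ap.X_bound)
        show "c \<in> {v. c0 < Im v \<and> Im v < c1}" using cD(2)[OF N V] by (simp add: c_def W_def)
        fix t assume t: "\<bar>t\<bar> \<le> R"
        have "- 1 \<le> Re c" "Re c \<le> xr + 1" using cD(5-8)[OF N V] by (simp_all add: c_def)
        moreover have "c0 < Im c" "Im c < c1" using cD(2)[OF N V] by (simp_all add: c_def W_def)
        moreover have "- R \<le> t" "t \<le> R" using t by (auto simp: abs_le_iff)
        ultimately have "c + of_real t \<in> K" by (simp add: K)
        then show "norm (deriv F (c + of_real t)) \<le> M" by (rule M(2))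
      qed
      then have "norm (ap.X c) / norm (mesh N) \<le> 6 * M / (Re (freq N))\<^sup>2 / norm (mesh N)"
        by (rule divide_right_mono) simp
      also have "\<dots> = 6 * M * xi_norm2\<^sup>2 / ((4 * pi\<^sup>2 * real p)\<^sup>2 * norm \<xi>) / real N"
        using big(1)[OF N] xi_norm2_pos p_ge_1 xi_nz
        by (simp add: freq_simps norm_mesh power_divide power_mult_distrib power2_eq_square[of "real N"] field_simps)
      finally have 1: "norm (ap.X c / mesh N) \<le> 6 * M * xi_norm2\<^sup>2 / ((4 * pi\<^sup>2 * real p)\<^sup>2 * norm \<xi>) / real N"
        by (simp add: norm_divide)
      have "ap.E V - (P V / mesh N + F V / 2) = (P c / mesh N - (P V / mesh N + F V / 2)) + ap.X c / mesh N"
        by (simp add: ap.E_def c_def add_divide_distrib)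
      also have "norm \<dots> \<le> M * norm \<xi> / real N + 6 * M * xi_norm2\<^sup>2 / ((4 * pi\<^sup>2 * real p)\<^sup>2 * norm \<xi>) / real N"
        using Pstep[OF N V] 1 unfolding c_def by (intro order_trans[OF norm_triangle_ineq] add_mono)
      also have "\<dots> = (6 * M * xi_norm2\<^sup>2 / ((4 * pi\<^sup>2 * real p)\<^sup>2 * norm \<xi>) + M * norm \<xi>) / real N"
        by (simp add: add_divide_distrib)
      also have "\<dots> \<le> C / real N" by (intro divide_right_mono) (simp_all add: C_def)
      finally show ?thesis .
    qed
    have fe: "norm (ap.E (V + mesh N) - ap.E V - F (V + mesh N)) \<le> C * exp (- rate * real N)" if V: "V \<in> D" for V
    proof -
      have "norm (ap.E (V + mesh N) - ap.E V - F (V + mesh N)) \<le> 4 * BF * exp (- Re (freq N) * R)"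
      proof (rule ap.E_functional_equation)
        show "c0 < Im V" "Im V + 2 * Im (mesh N) < c1" using cD[OF N V] by auto
        have "- (rate * real N) \<le> - 1" using big(4)[OF N] by simp
        then have "exp (- (rate * real N)) \<le> exp (- 1 :: real)" by simp
        also have "exp (- 1 :: real) \<le> 1 / 2" using exp_ge_add_one_self[of "1::real"] by (simp add: exp_minus inverse_eq_divide field_simps)
        finally show "exp (- Re (freq N) * R) \<le> 1 / 2" using kR by simp
        fix s :: real assume s: "0 \<le> s" "s \<le> 1"
        have hb: "0 \<le> s * Re (mesh N)" "s * Re (mesh N) \<le> 1 * 1" "0 \<le> s * Im (mesh N)" "s * Im (mesh N) \<le> 1 * Im (mesh N)"
        proof -
          show "s * Re (mesh N) \<le> 1 * 1" by (rule mult_mono) (use s cD(7,8)[OF N V] in auto)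
          show "s * Im (mesh N) \<le> 1 * Im (mesh N)" by (rule mult_right_mono) (use s cD(10)[OF N V] in auto)
        qed (use s cD(7,10)[OF N V] in auto)
        note cc = cD(3-8,10)[OF N V]
        have "V + mesh N / 2 - of_real R + of_real s * mesh N \<in> K"
        proof -
          have "Re (V + mesh N / 2 - of_real R + of_real s * mesh N) = Re V + Re (mesh N) / 2 - R + s * Re (mesh N)"
            "Im (V + mesh N / 2 - of_real R + of_real s * mesh N) = Im V + Im (mesh N) / 2 + s * Im (mesh N)" by simp_all
          then show ?thesis unfolding K using hb cc R by (intro conjI; linarith)
        qed
        then show "norm (F (V + mesh N / 2 - of_real R + of_real s * mesh N)) \<le> BF" by (rule BF(2))
        have "V + mesh N / 2 + of_real R + of_real s * mesh N \<in> K"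
        proof -
          have "Re (V + mesh N / 2 + of_real R + of_real s * mesh N) = Re V + Re (mesh N) / 2 + R + s * Re (mesh N)"
            "Im (V + mesh N / 2 + of_real R + of_real s * mesh N) = Im V + Im (mesh N) / 2 + s * Im (mesh N)" by simp_all
          then show ?thesis unfolding K using hb cc R by (intro conjI; linarith)
        qed
        then show "norm (F (V + mesh N / 2 + of_real R + of_real s * mesh N)) \<le> BF" by (rule BF(2))
      qed
      also have "\<dots> \<le> C * exp (- rate * real N)"
        using kR by (simp add: C_def)
      finally show ?thesis .
    qed
    show "\<exists>E. E holomorphic_on D \<and>
      (\<forall>V\<in>D. norm (E V - (P V / mesh N + F V / 2)) \<le> C / real N) \<and>
      (\<forall>V\<in>D. norm (E (V + mesh N) - E V - F (V + mesh N)) \<le> C * exp (- rate * real N))"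
      using EH est fe by (intro exI[of _ ap.E]) blast
  qed
qed

end

lemma norm_exp_minus_1_le:
  fixes z :: complex
  assumes "norm z \<le> 1"
  shows "norm (exp z - 1) \<le> 3 * norm z"
proof -
  have "norm (exp z - exp 0) \<le> 3 * norm (z - 0)"
  proof (rule field_differentiable_bound[of "cball 0 1"])
    show "(exp has_field_derivative exp w) (at w within cball 0 1)" for w :: complex
      by (rule has_field_derivative_at_within[OF DERIV_exp])
    show "norm (exp w) \<le> 3" if "w \<in> cball 0 1" for w :: complex
    proof -
      have "Re w \<le> 1" using that complex_Re_le_cmod[of w] by simp
      then have "exp (Re w) \<le> exp 1" by (simp only: exp_le_cancel_iff)
      also have "exp 1 \<le> (3 :: real)" by (rule exp_le)
      finally have "exp (Re w) \<le> 3" .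
      then show ?thesis by (simp only: norm_exp_eq_Re)
    qed
  qed (use assms in auto)
  then show ?thesis by simp
qed

section \<open>The peak and the interpolated summands\<close>

context fig8 begin

text \<open>The value of exp (Ps / h) at the saddle point moved up by p periods; all sizes are
  measured against it.\<close>

definition "peak N = exp ((P \<phi> + period * of_real u) / mesh N)"

lemma norm_peak: "norm (peak N) = exp (real N / xi_norm2 * (2 * pi * real p * (2 * pi * real p * u + V0)))"
  by (simp add: peak_def Re_divide_mesh P_phi algebra_simps)

lemma norm_peak_ge_1: "norm (peak N) \<ge> 1"
  unfolding norm_peak using u V0_pos xi_norm2_pos by simp

lemma peak_nz: "peak N \<noteq> 0"
  by (simp add: peak_def)

text \<open>Crude, but enough to fix the rate ln 23 + 1: a relative error exp (- rate N) of a
  summand is an absolute error of at most exp (- N).\<close>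

lemma norm_summand_le:
  assumes "k \<le> N" "N > 0"
  shows "norm (summand N k) \<le> 23 ^ N"
proof -
  have "norm (summand N k) = (\<Prod>l=1..k. norm (f (of_nat l * mesh N)))" by (simp add: summand_def prod_norm)
  also have "\<dots> \<le> (\<Prod>l=1..k. 23)"
  proof (rule prod_mono)
    fix l assume "l \<in> {1..k}"
    then have "real l / real N \<le> 1" using assms by simp
    then have "real l / real N * u \<le> 1 * u" using u by (intro mult_right_mono) auto
    then have "\<bar>Re (of_nat l * mesh N)\<bar> \<le> 3 * u" using u by (simp add: mesh_simps)
    then show "0 \<le> norm (f (of_nat l * mesh N)) \<and> norm (f (of_nat l * mesh N)) \<le> 23" by (simp add: norm_f_le)
  qed
  also have "\<dots> = 23 ^ k" by simp
  also have "(23::real) ^ k \<le> 23 ^ N" using assms by (intro power_increasing) auto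
  finally show ?thesis .
qed

lemma summand_Suc: "summand N (Suc k) = summand N k * f (of_nat (Suc k) * mesh N)"
  by (simp add: summand_def)

text \<open>Shifting the lattice points by the period of \<open>f\<close> moves the dominant summands into \<open>Sig\<close>.\<close>

definition "node N k = of_nat k * mesh N - period"

lemma node_Suc: "node N (Suc k) = node N k + mesh N"
  by (simp add: node_def algebra_simps)

lemma node_simps: "Re (node N k) = real k / real N * u" "Im (node N k) = 2 * pi * real p * (real k / real N - 1)"
  by (simp_all add: node_def mesh_simps algebra_simps)

text \<open>Going from \<open>Ps\<close> at (k0 + 1/2) h to \<open>P\<close> at the shifted point
  adds period times u, which is contained in \<open>peak\<close>. The expressions at the node then
  cancel between the summand and E, up to O(1/N), and those at V remain.\<close>

lemma interpolant_estimate: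
  assumes N: "N > 0"
    and t: "summand N k0 = exp ((Ps ((of_nat k0 + 1/2) * mesh N) - Ps (mesh N / 2)) / mesh N + e1)" "norm e1 \<le> C1 / real N"
    and h: "norm (Ps (mesh N / 2) / mesh N - Fs 0 / 2) \<le> C3 / real N"
    and S: "node N k0 + mesh N / 2 \<in> Sig" "(real k0 + 1/2) / real N < 1"
    and c: "norm (P (node N k0 + mesh N / 2) / mesh N - (P (node N k0) / mesh N + F (node N k0) / 2)) \<le> C / real N"
    and E: "norm (E (node N k0) - (P (node N k0) / mesh N + F (node N k0) / 2)) \<le> C / real N"
      "norm (E V - (P V / mesh N + F V / 2)) \<le> C / real N"
  shows "\<exists>e. norm e \<le> (C1 + C3 + 3 * C) / real N \<and>
     summand N k0 * exp (E V - E (node N k0)) = peak N * exp ((P V - P \<phi>) / mesh N + F V / 2 - Fs 0 / 2 + e)"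
proof -
  define W where "W = node N k0"
  define e2 e3 e4 e5 where "e2 = P (W + mesh N / 2) / mesh N - (P W / mesh N + F W / 2)"
    and "e3 = Ps (mesh N / 2) / mesh N - Fs 0 / 2" and "e4 = E W - (P W / mesh N + F W / 2)"
    and "e5 = E V - (P V / mesh N + F V / 2)"
  have hn: "mesh N \<noteq> 0" using N xi_nz by (simp add: mesh_def)
  have Ps: "Ps ((of_nat k0 + 1/2) * mesh N) = P (W + mesh N / 2) + period * of_real u"
  proof -
    have "(of_nat k0 + 1/2) * mesh N = W + mesh N / 2 + of_nat p * (2 * of_real pi * \<i>)"
      by (simp add: W_def node_def period_def algebra_simps)
    then have "Ps ((of_nat k0 + 1/2) * mesh N) = Ps (W + mesh N / 2) + of_nat p * (2 * of_real pi * \<i>) * of_real u"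
      by (simp only: Ps_periodic)
    moreover have "Ps (W + mesh N / 2) = P (W + mesh N / 2)"
    proof (rule P_eq_Ps[symmetric])
      show "W + mesh N / 2 \<in> Sig" using S by (simp add: W_def)
      have "Re (W + mesh N / 2) = (real k0 + 1/2) / real N * u" using N by (simp add: W_def node_simps mesh_simps field_simps)
      moreover have "(real k0 + 1/2) / real N * u < 1 * u" using S(2) u by (intro mult_strict_right_mono) auto
      moreover have "0 \<le> (real k0 + 1/2) / real N * u" using u by simp
      ultimately show "\<bar>Re (W + mesh N / 2)\<bar> < u" by simp
    qed
    ultimately show ?thesis by (simp add: period_def)
  qed
  define e where "e = e1 + e2 - e3 - e4 + e5"
  have "norm e \<le> norm e1 + norm e2 + norm e3 + norm e4 + norm e5"
    unfolding e_def by (smt (verit) norm_triangle_ineq norm_triangle_ineq4)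
  also have "\<dots> \<le> C1 / real N + C / real N + C3 / real N + C / real N + C / real N"
    using t(2) h c E by (intro add_mono) (simp_all add: e2_def e3_def e4_def e5_def W_def)
  also have "\<dots> = (C1 + C3 + 3 * C) / real N" by (simp add: add_divide_distrib)
  finally have "norm e \<le> (C1 + C3 + 3 * C) / real N" .
  moreover have "summand N k0 * exp (E V - E W) = peak N * exp ((P V - P \<phi>) / mesh N + F V / 2 - Fs 0 / 2 + e)"
  proof -
    have "summand N k0 * exp (E V - E W) = exp ((P (W + mesh N / 2) + period * of_real u - Ps (mesh N / 2)) / mesh N + e1 + (E V - E W))"
      unfolding t(1) Ps by (simp add: exp_add)
    also have "(P (W + mesh N / 2) + period * of_real u - Ps (mesh N / 2)) / mesh N + e1 + (E V - E W)
       = (P \<phi> + period * of_real u) / mesh N + ((P V - P \<phi>) / mesh N + F V / 2 - Fs 0 / 2 + e)"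
      by (simp add: e_def e2_def e3_def e4_def e5_def add_divide_distrib diff_divide_distrib)
    finally show ?thesis by (simp add: peak_def exp_add)
  qed
  ultimately show ?thesis unfolding W_def by blast
qed

text \<open>Both sides satisfy the recursion with the factor f (l h), by exp F = f and the
  periodicity of f; the left one only up to exp of a quantity of size \<eta> per step.\<close>

lemma lattice_interpolant:
  assumes N: "N > 0"
    and st: "\<And>k. k0 \<le> k \<Longrightarrow> k < k1 \<Longrightarrow> norm (E (node N k + mesh N) - E (node N k) - F (node N k + mesh N)) \<le> \<eta>"
    and S: "\<And>k. k0 \<le> k \<Longrightarrow> k \<le> k1 \<Longrightarrow> node N k \<in> Sig"
    and k: "k0 \<le> k" "k \<le> k1"
  shows "\<exists>\<delta>. norm \<delta> \<le> real (k - k0) * \<eta> \<and> summand N k0 * exp (E (node N k) - E (node N k0)) = summand N k * exp \<delta>"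
  using k
proof (induction k rule: dec_induct)
  case base
  then show ?case by (intro exI[of _ 0]) simp
next
  case (step k)
  then obtain \<delta> where \<delta>: "norm \<delta> \<le> real (k - k0) * \<eta>" "summand N k0 * exp (E (node N k) - E (node N k0)) = summand N k * exp \<delta>" by auto
  define e where "e = E (node N (Suc k)) - E (node N k) - F (node N (Suc k))"
  have e: "norm e \<le> \<eta>" using st[of k] step by (simp add: e_def node_Suc)
  have "norm (\<delta> + e) \<le> real (k - k0) * \<eta> + \<eta>" using norm_triangle_ineq[of \<delta> e] \<delta>(1) e by linarith
  also have "\<dots> = real (Suc k - k0) * \<eta>" using step by (simp add: Suc_diff_le algebra_simps)
  finally have "norm (\<delta> + e) \<le> real (Suc k - k0) * \<eta>" .
  moreover have "summand N k0 * exp (E (node N (Suc k)) - E (node N k0)) = summand N (Suc k) * exp (\<delta> + e)"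
  proof -
    have "node N (Suc k) \<in> Sig" using S[of "Suc k"] step by simp
    then have "exp (F (node N (Suc k))) = f (of_nat (Suc k) * mesh N)"
      by (simp only: exp_F) (simp only: node_def f_periodic)
    moreover have q: "E (node N (Suc k)) - E (node N k0) = (E (node N k) - E (node N k0)) + e + F (node N (Suc k))"
      by (simp add: e_def)
    have "summand N k0 * exp (E (node N (Suc k)) - E (node N k0)) = (summand N k0 * exp (E (node N k) - E (node N k0))) * exp e * exp (F (node N (Suc k)))"
      by (simp only: q exp_add mult.assoc)
    ultimately show ?thesis by (simp add: \<delta>(2) summand_Suc exp_add)
  qed
  ultimately show ?case by blast
qed

section \<open>The pole kernel on the sides of the rectangle\<close>

definition "pole_kernel N V = 1 / (1 - exp (freq N * (V + period)))"

lemma freq_xi: "N > 0 \<Longrightarrow> freq N * \<xi> = 2 * of_real pi * \<i> * of_nat N"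
  using xi_nz by (simp add: freq_def)

text \<open>The last bracket is the signed horizontal distance from the line of nodes: the kernel
  tends to 1 on its left and to 0 on its right.\<close>

lemma Re_freq_V: "Re (freq N * (Complex s y + period)) = Re (freq N) * (s - u * (1 + y / (2 * pi * real p)))"
proof -
  have "Re (freq N * (Complex s y + period)) = Re (freq N) * s - Im (freq N) * (y + 2 * pi * real p)"
    by simp
  also have "Im (freq N) * (y + 2 * pi * real p) = Re (freq N) * (u * (1 + y / (2 * pi * real p)))"
    using p_ge_1 xi_norm2_pos by (simp add: freq_simps field_simps power2_eq_square)
  finally show ?thesis by (simp add: algebra_simps)
qed

lemma Re_freq_nonneg: "Re (freq N) \<ge> 0"
  using xi_norm2_pos by (simp add: freq_simps)

text \<open>Halfway between two nodes exp (freq N (V + period)) is - exp z with z a real multiple of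
  \<open>freq N\<close>, so the bounds on the double cone apply. The line of nodes crosses such a
  row at x u \<le> u, whence the decay for s > u.\<close>

lemma kernel_horizontal:
  assumes N: "N > 0" and m: "real m - 1/2 \<le> real N" and y: "y = 2 * pi * real p * ((real m - 1/2) / real N - 1)"
  shows "norm (pole_kernel N (Complex s y)) \<le> 3 * exp (- Re (freq N) * max 0 (s - u))"
proof -
  define x where "x = (real m - 1/2) / real N"
  have x1: "x \<le> 1" using m N by (simp add: x_def)
  define z where "z = freq N * of_real (s - x * u)"
  have q: "Complex s y + period = of_real x * \<xi> + of_real (s - x * u)"
    by (simp add: complex_eq_iff y x_def algebra_simps)
  have "freq N * (Complex s y + period) = of_real x * (freq N * \<xi>) + z"
    by (simp only: q distrib_left z_def mult.left_commute)
  also have "of_real x * (freq N * \<xi>) = of_real (real m * (2 * pi)) * \<i> - of_real pi * \<i>"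
    unfolding freq_xi[OF N] using N by (simp add: x_def field_simps)
  finally have "exp (freq N * (Complex s y + period)) = exp (of_real (real m * (2 * pi)) * \<i>) / exp (of_real pi * \<i>) * exp z"
    by (simp add: exp_add exp_diff)
  also have "exp (of_real (real m * (2 * pi)) * \<i>) = 1"
    using exp_integer_2pi[of "of_nat m"] by (simp add: mult_ac)
  also have "exp (of_real pi * \<i>) = - 1" by (simp add: exp_eq_polar)
  finally have e: "pole_kernel N (Complex s y) = 1 / (exp z + 1)" by (simp add: pole_kernel_def add.commute)
  have z: "Re z = Re (freq N) * (s - x * u)" "Im z = Im (freq N) * (s - x * u)" by (simp_all add: z_def)
  have "\<bar>Im z\<bar> \<le> \<bar>Re z\<bar>"
    unfolding z abs_mult using freq_cone[of N] Re_freq_nonneg[of N] by (intro mult_right_mono) auto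
  note b = norm_exp_plus_1_ge'[OF this]
  show ?thesis
  proof (cases "s \<le> u")
    case True
    have "norm (pole_kernel N (Complex s y)) = 1 / norm (exp z + 1)" by (simp add: e norm_divide)
    also have "\<dots> \<le> 1 / (1 / 3)" using b(1) by (intro divide_left_mono) auto
    finally show ?thesis using True by simp
  next
    case False
    have "x * u \<le> 1 * u" using x1 u by (intro mult_right_mono) auto
    then have "Re (freq N) * (s - u) \<le> Re z" unfolding z using Re_freq_nonneg by (intro mult_left_mono) auto
    then have "exp (Re (freq N) * (s - u)) \<le> exp (Re z)" by (simp only: exp_le_cancel_iff)
    then have "exp (Re (freq N) * (s - u)) / 3 \<le> norm (exp z + 1)" using b(2) by linarith
    then have "1 / norm (exp z + 1) \<le> 1 / (exp (Re (freq N) * (s - u)) / 3)"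
      by (intro divide_left_mono) (auto intro!: mult_pos_pos simp: less_le_trans[OF _ b(1)])
    also have "\<dots> = 3 * exp (- (Re (freq N) * (s - u)))" by (simp only: exp_minus inverse_eq_divide) simp
    finally show ?thesis using False by (simp add: e norm_divide)
  qed
qed

text \<open>For y \<le> 0 the line of nodes stays in Re v \<le> u, at distance at least 2 u from
  this side.\<close>

lemma kernel_right:
  assumes N: "Re (freq N) * (2 * u) \<ge> 1" and y: "y \<le> 0"
  shows "norm (pole_kernel N (Complex (3 * u) y)) \<le> 3 * exp (- Re (freq N) * (2 * u))"
proof -
  define z where "z = freq N * (Complex (3 * u) y + period)"
  have "u * (1 + y / (2 * pi * real p)) \<le> u * (1 + 0)"
    using u y p_ge_1 by (intro mult_left_mono add_left_mono) (auto simp: divide_le_0_iff)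
  then have "Re (freq N) * (2 * u) \<le> Re z"
    unfolding z_def Re_freq_V using Re_freq_nonneg by (intro mult_left_mono) auto
  then have ez: "exp (Re (freq N) * (2 * u)) \<le> norm (exp z)" by simp
  have "exp (Re (freq N) * (2 * u)) \<ge> 2" using exp_ge_add_one_self[of "Re (freq N) * (2 * u)"] N by linarith
  then have "exp (Re (freq N) * (2 * u)) / 3 \<le> norm (1 - exp z)"
    using ez norm_triangle_ineq3[of 1 "exp z"] by (simp del: norm_exp_eq_Re)
  then have "1 / norm (1 - exp z) \<le> 1 / (exp (Re (freq N) * (2 * u)) / 3)"
    by (intro divide_left_mono mult_pos_pos) (auto intro: less_le_trans[of _ "exp (Re (freq N) * (2 * u)) / 3"])
  also have "\<dots> = 3 * exp (- Re (freq N) * (2 * u))" by (simp add: exp_minus field_simps)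
  finally show ?thesis by (simp add: pole_kernel_def z_def[symmetric] norm_divide)
qed

text \<open>The axis lies to the left of the line of nodes, at a distance proportional to y + 2
  \<pi> p, and this is at least \<theta>/2 because p \<ge> 1.\<close>

lemma kernel_left:
  assumes y: "y \<ge> - 2 * pi + \<theta> / 2" "y \<le> 0" and N: "exp (- (2 * pi * u * real N / xi_norm2) * (\<theta> / 2)) \<le> 1 / 2"
  shows "norm (pole_kernel N (Complex 0 y) - 1) \<le> 2 * exp (- (2 * pi * u * real N / xi_norm2) * (\<theta> / 2))"
    "norm (pole_kernel N (Complex 0 y)) \<le> 2"
proof -
  define z where "z = freq N * (Complex 0 y + period)"
  have "Re z = - (Im (freq N) * (y + 2 * pi * real p))" by (simp add: z_def)
  also have "\<dots> \<le> - (Im (freq N) * (\<theta> / 2))"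
  proof -
    have "2 * pi * 1 \<le> 2 * pi * real p" using p_ge_1 by (intro mult_left_mono) auto
    then have "\<theta> / 2 \<le> y + 2 * pi * real p" using y(1) by linarith
    moreover have "Im (freq N) \<ge> 0" using u xi_norm2_pos by (simp add: freq_simps)
    ultimately have "Im (freq N) * (\<theta> / 2) \<le> Im (freq N) * (y + 2 * pi * real p)" by (rule mult_left_mono)
    then show ?thesis by (simp only: neg_le_iff_le)
  qed
  finally have "exp (Re z) \<le> exp (- (2 * pi * u * real N / xi_norm2) * (\<theta> / 2))" by (simp add: freq_simps)
  then have ez: "norm (exp z) \<le> exp (- (2 * pi * u * real N / xi_norm2) * (\<theta> / 2))" by simp
  then have ez2: "norm (exp z) \<le> 1 / 2" using N by linarith
  have d: "norm (1 - exp z) \<ge> 1 / 2" using norm_triangle_ineq2[of 1 "exp z"] ez2 by (simp del: norm_exp_eq_Re)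
  then have nz: "1 - exp z \<noteq> 0" by (metis norm_zero not_one_le_zero divide_le_0_1_iff half_gt_zero_iff not_less zero_less_one)
  have "pole_kernel N (Complex 0 y) - 1 = exp z / (1 - exp z)"
    unfolding pole_kernel_def z_def[symmetric] using nz by (simp add: field_simps)
  then have "norm (pole_kernel N (Complex 0 y) - 1) = norm (exp z) / norm (1 - exp z)" by (simp only: norm_divide)
  also have "\<dots> \<le> exp (- (2 * pi * u * real N / xi_norm2) * (\<theta> / 2)) / (1 / 2)"
    using ez d by (intro frac_le) auto
  finally show "norm (pole_kernel N (Complex 0 y) - 1) \<le> 2 * exp (- (2 * pi * u * real N / xi_norm2) * (\<theta> / 2))" by simp
  have "norm (pole_kernel N (Complex 0 y)) = 1 / norm (1 - exp z)" by (simp add: pole_kernel_def z_def[symmetric] norm_divide)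
  also have "\<dots> \<le> 1 / (1 / 2)" using d by (intro divide_left_mono) auto
  finally show "norm (pole_kernel N (Complex 0 y)) \<le> 2" by simp
qed

end

section \<open>The contour integral and its saddle point\<close>

text \<open>Collects the constants and interpolants whose existence has been shown, so that all
  later estimates refer to the same data, with constants independent of N. The rectangle will lie
  between the heights - 2 \<pi> + \<theta>/2 and - \<epsilon>/2; the margins \<theta>/4 and
  \<epsilon>/4 leave room around it.\<close>

locale fig8_interpolant = fig8 +
  fixes \<epsilon> c C1 C3 C :: real and N0 :: nat and E :: "nat \<Rightarrow> complex \<Rightarrow> complex"
  assumes eps: "0 < \<epsilon>" "\<epsilon> \<le> \<theta> / 2" "\<epsilon> \<le> (3 - 2 * cosh u) / 8"
    and c: "0 < c" "c \<le> u * (2 * pi\<^sup>2 * real p - 12 * u)"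
    and top: "\<And>y s. - \<epsilon> \<le> y \<Longrightarrow> y < 0 \<Longrightarrow> 0 \<le> s \<Longrightarrow> s \<le> 3 * u \<Longrightarrow>
        gap (Complex s y) - 4 * pi\<^sup>2 * real p * max 0 (s - u) \<le> - c"
    and C: "C1 > 0" "C3 > 0" "C > 0"
    and t_as: "\<And>N k. N > 0 \<Longrightarrow> real k + 1/2 \<le> (1 - 1 / (2 * real p)) * real N \<Longrightarrow>
      \<exists>e. norm e \<le> C1 / real N \<and> summand N k = exp ((Ps ((of_nat k + 1/2) * mesh N) - Ps (mesh N / 2)) / mesh N + e)"
    and half: "\<And>N. N > 0 \<Longrightarrow> norm (Ps (mesh N / 2) / mesh N - Fs 0 / 2) \<le> C3 / real N"
    and E_hol: "\<And>N. N \<ge> N0 \<Longrightarrow> E N holomorphic_on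
        {V. - 1 < Re V \<and> Re V < 3 * u + 1 \<and> - 2 * pi + \<theta> / 4 < Im V \<and> Im V < - \<epsilon> / 4}"
    and E_est: "\<And>N V. N \<ge> N0 \<Longrightarrow> - 1 < Re V \<Longrightarrow> Re V < 3 * u + 1 \<Longrightarrow> - 2 * pi + \<theta> / 4 < Im V \<Longrightarrow> Im V < - \<epsilon> / 4 \<Longrightarrow>
        norm (E N V - (P V / mesh N + F V / 2)) \<le> C / real N"
    and E_eq: "\<And>N V. N \<ge> N0 \<Longrightarrow> - 1 < Re V \<Longrightarrow> Re V < 3 * u + 1 \<Longrightarrow> - 2 * pi + \<theta> / 4 < Im V \<Longrightarrow> Im V < - \<epsilon> / 4 \<Longrightarrow>
        norm (E N (V + mesh N) - E N V - F (V + mesh N)) \<le> C * exp (- (ln 23 + 1) * real N)"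
    and P_step: "\<And>N V. N \<ge> N0 \<Longrightarrow> - 1 < Re V \<Longrightarrow> Re V < 3 * u + 1 \<Longrightarrow> - 2 * pi + \<theta> / 4 < Im V \<Longrightarrow> Im V < - \<epsilon> / 4 \<Longrightarrow>
        V + mesh N / 2 \<in> Sig \<and> norm (P (V + mesh N / 2) / mesh N - (P V / mesh N + F V / 2)) \<le> C / real N"
begin

definition "D = {V :: complex. - 1 < Re V \<and> Re V < 3 * u + 1 \<and> - 2 * pi + \<theta> / 4 < Im V \<and> Im V < - \<epsilon> / 4}"

lemma D_Sig: "D \<subseteq> Sig"
  using eps theta by (auto simp: D_def Sig_def)

text \<open>The parameters at which x \<xi> - period has the heights - 2 \<pi> + \<theta>/2 and -
  \<epsilon>/2.\<close>

definition "x0 = 1 - (2 * pi - \<theta> / 2) / (2 * pi * real p)"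
definition "x1 = 1 - (\<epsilon> / 2) / (2 * pi * real p)"
text \<open>The rounding accounts for the half steps: the rows at \<open>k0 N\<close> - 1/2 and
  \<open>k1 N\<close> + 1/2 still lie between the two heights.\<close>

definition "k0 N = nat \<lceil>real N * x0 + 1/2\<rceil>"
definition "k1 N = nat \<lfloor>real N * x1 - 1/2\<rfloor>"
definition "yb N = 2 * pi * real p * ((real (k0 N) - 1/2) / real N - 1)"
definition "yt N = 2 * pi * real p * ((real (k1 N) + 1/2) / real N - 1)"
definition "C2 = C1 + C3 + 3 * C"
definition "big N \<longleftrightarrow> N \<ge> N0 \<and> N > 0 \<and> 2 * pi * real p / real N < \<theta> / 8 \<and> 2 * pi * real p / real N < \<epsilon> / 8 \<and>
   Re (freq N) * (2 * u) \<ge> 1 \<and> exp (- (2 * pi * u * real N / xi_norm2) * (\<theta> / 2)) \<le> 1 / 2 \<and>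
   real N * C * exp (- (ln 23 + 1) * real N) \<le> 1 \<and> C2 / real N \<le> 1"

text \<open>
  The holomorphic interpolant of the summands, anchored at \<open>k0 N\<close>. The rows \<open>yb N\<close> and \<open>yt N\<close> run halfway
  between consecutive lattice points, where the pole kernel is harmless.
\<close>

definition "T N V = summand N (k0 N) * exp (E N V - E N (node N (k0 N)))"

lemma eventually_big: "\<forall>\<^sub>F N in sequentially. big N"
proof -
  have X: "xi_norm2 > 0" by (rule xi_norm2_pos)
  have 1: "\<forall>\<^sub>F N in sequentially. a / real N < b" if "b > 0" for a b :: real
  proof -
    have "(\<lambda>N. a / real N) \<longlonglongrightarrow> 0" by real_asymp
    then show ?thesis by (rule order_tendstoD) (rule that)
  qed
  have 2: "\<forall>\<^sub>F N in sequentially. Re (freq N) * (2 * u) \<ge> 1"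
  proof -
    have "filterlim (\<lambda>N. (4 * pi\<^sup>2 * real p * (2 * u) / xi_norm2) * real N) at_top sequentially"
      using u X p_ge_1 by (intro filterlim_tendsto_pos_mult_at_top[OF tendsto_const] filterlim_real_sequentially) auto
    then have "\<forall>\<^sub>F N in sequentially. (4 * pi\<^sup>2 * real p * (2 * u) / xi_norm2) * real N \<ge> 1"
      by (simp add: filterlim_at_top)
    then show ?thesis by eventually_elim (simp add: freq_simps mult_ac)
  qed
  have 3: "\<forall>\<^sub>F N in sequentially. exp (- (2 * pi * u * real N / xi_norm2) * (\<theta> / 2)) \<le> 1 / 2"
  proof -
    define a where "a = 2 * pi * u / xi_norm2 * (\<theta> / 2)"
    have "a > 0" using u X theta by (simp add: a_def)
    then have "(\<lambda>N. exp (- a * real N)) \<longlonglongrightarrow> 0" by real_asymp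
    then have "\<forall>\<^sub>F N in sequentially. exp (- a * real N) < 1 / 2" by (rule order_tendstoD) simp
    then show ?thesis by eventually_elim (simp add: a_def mult_ac)
  qed
  have 4: "\<forall>\<^sub>F N in sequentially. real N * C * exp (- (ln 23 + 1) * real N) \<le> 1"
  proof -
    define b :: real where "b = ln 23 + 1"
    have "b > 0" by (simp add: b_def add_pos_pos)
    then have "(\<lambda>N. real N * C * exp (- b * real N)) \<longlonglongrightarrow> 0" by real_asymp
    then have "\<forall>\<^sub>F N in sequentially. real N * C * exp (- b * real N) < 1" by (rule order_tendstoD) simp
    then show ?thesis by eventually_elim (simp add: b_def)
  qed
  have 5: "\<forall>\<^sub>F N in sequentially. C2 / real N < 1" by (rule 1) simp
  have 6: "\<forall>\<^sub>F N in sequentially. 2 * pi * real p / real N < \<theta> / 8" by (rule 1) (use theta in simp)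
  have 7: "\<forall>\<^sub>F N in sequentially. 2 * pi * real p / real N < \<epsilon> / 8" by (rule 1) (use eps in simp)
  show ?thesis
    using eventually_ge_at_top[of N0] eventually_gt_at_top[of "0::nat"] 2 3 4 5 6 7
    by eventually_elim (use theta eps in \<open>auto simp: big_def\<close>)
qed

context
  fixes N :: nat
  assumes big: "big N"
begin

lemma N_facts: "N \<ge> N0" "N > 0" "2 * pi * real p / real N < \<theta> / 8" "2 * pi * real p / real N < \<epsilon> / 8"
   "Re (freq N) * (2 * u) \<ge> 1" "exp (- (2 * pi * u * real N / xi_norm2) * (\<theta> / 2)) \<le> 1 / 2"
   "real N * C * exp (- (ln 23 + 1) * real N) \<le> 1" "C2 / real N \<le> 1"
  using big by (auto simp: big_def)

lemma tp: "2 * pi * real p > 0"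
  using p by simp

lemma x0_pos: "x0 > 0"
proof -
  have "2 * pi * 1 \<le> 2 * pi * real p" using p_ge_1 by (intro mult_left_mono) auto
  then have "2 * pi - \<theta> / 2 < 2 * pi * real p" using theta by linarith
  then show ?thesis using tp by (simp add: x0_def)
qed

lemma k0: "real N * x0 \<le> real (k0 N) - 1/2" "real (k0 N) - 1/2 < real N * x0 + 1" "k0 N > 0"
proof -
  have "0 < \<lceil>real N * x0 + 1/2\<rceil>" using x0_pos by (simp add: add_nonneg_pos)
  then have "real (k0 N) = of_int \<lceil>real N * x0 + 1/2\<rceil>" "k0 N > 0" by (simp_all add: k0_def)
  then show "real N * x0 \<le> real (k0 N) - 1/2" "real (k0 N) - 1/2 < real N * x0 + 1" "k0 N > 0"
    by linarith+
qed

text \<open>Rounding moves the row by less than one step, which is shorter than \<theta>/8; hence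
  5/8 = 1/2 + 1/8.\<close>

lemma yb: "- 2 * pi + \<theta> / 2 \<le> yb N" "yb N < - 2 * pi + 5 * \<theta> / 8"
proof -
  have N: "real N > 0" using N_facts by simp
  have "x0 \<le> (real (k0 N) - 1/2) / real N" "(real (k0 N) - 1/2) / real N < x0 + 1 / real N"
    using k0(1) divide_strict_right_mono[OF k0(2) N] N by (simp_all add: add_divide_distrib pos_le_divide_eq mult.commute)
  then have "2 * pi * real p * (x0 - 1) \<le> yb N" "yb N < 2 * pi * real p * (x0 + 1 / real N - 1)"
    unfolding yb_def using p by (auto intro!: mult_left_mono mult_strict_left_mono)
  moreover have "2 * pi * real p * (x0 - 1) = - 2 * pi + \<theta> / 2" using p by (simp add: x0_def)
  moreover have "2 * pi * real p * (x0 + 1 / real N - 1) = 2 * pi * real p * (x0 - 1) + 2 * pi * real p / real N"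
    by (simp add: algebra_simps)
  ultimately show "- 2 * pi + \<theta> / 2 \<le> yb N" "yb N < - 2 * pi + 5 * \<theta> / 8" using N_facts(3) by linarith+
qed

lemma eps_small: "\<epsilon> < 2 * pi * real p"
proof -
  have "2 * pi * 1 \<le> 2 * pi * real p" using p_ge_1 by (intro mult_left_mono) auto
  then show ?thesis using eps theta pi_gt3 by linarith
qed

lemma k1: "real (k1 N) + 1/2 \<le> real N * x1" "real N * x1 - 1 < real (k1 N) + 1/2"
proof -
  have N: "real N > 0" using N_facts by simp
  have "1 / real N < \<epsilon> / 8 / (2 * pi * real p)" using N_facts(4) tp N by (simp add: field_simps)
  also have "\<dots> < 1 / 8" using eps_small tp by (simp add: field_simps)
  finally have "real N > 8" using N by (simp add: field_simps)
  moreover have "x1 \<ge> 1 / 2" using eps_small tp by (simp add: x1_def field_simps)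
  then have "real N * (1/2) \<le> real N * x1" by (intro mult_left_mono) auto
  ultimately have "0 \<le> real N * x1 - 1/2" by linarith
  then have "0 \<le> \<lfloor>real N * x1 - 1/2\<rfloor>" by simp
  then have "real (k1 N) = of_int \<lfloor>real N * x1 - 1/2\<rfloor>" by (simp add: k1_def)
  then show "real (k1 N) + 1/2 \<le> real N * x1" "real N * x1 - 1 < real (k1 N) + 1/2" by linarith+
qed

lemma yt: "yt N \<le> - \<epsilon> / 2" "- 5 * \<epsilon> / 8 < yt N"
proof -
  have N: "real N > 0" using N_facts by simp
  have "(real (k1 N) + 1/2) / real N \<le> x1" "x1 - 1 / real N < (real (k1 N) + 1/2) / real N"
    using k1(1) divide_strict_right_mono[OF k1(2) N] N by (simp_all add: diff_divide_distrib pos_divide_le_eq mult.commute)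
  then have "yt N \<le> 2 * pi * real p * (x1 - 1)" "2 * pi * real p * (x1 - 1 / real N - 1) < yt N"
    unfolding yt_def using p by (auto intro!: mult_left_mono mult_strict_left_mono)
  moreover have "2 * pi * real p * (x1 - 1) = - \<epsilon> / 2" using p by (simp add: x1_def)
  moreover have "2 * pi * real p * (x1 - 1 / real N - 1) = 2 * pi * real p * (x1 - 1) - 2 * pi * real p / real N"
    by (simp add: algebra_simps)
  ultimately show "yt N \<le> - \<epsilon> / 2" "- 5 * \<epsilon> / 8 < yt N" using N_facts(4) by linarith+
qed

lemma yb_yt: "yb N < yt N"
  using yb yt eps theta pi_gt3 by linarith

lemma k0_k1: "k0 N \<le> k1 N" "k1 N < N"
proof -
  have N: "real N > 0" using N_facts by simp
  have "(real (k0 N) - 1/2) / real N < (real (k1 N) + 1/2) / real N"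
    using yb_yt tp unfolding yb_def yt_def by (simp add: mult_less_cancel_left_pos)
  then have "real (k0 N) - 1/2 < real (k1 N) + 1/2" using N by (simp add: divide_less_cancel)
  then show "k0 N \<le> k1 N" by linarith
  have "x1 < 1" using eps tp by (simp add: x1_def)
  then have "real N * x1 < real N * 1" using N by (intro mult_strict_left_mono) auto
  then show "k1 N < N" using k1(1) by linarith
qed

lemma Im_node:
  assumes "k0 N \<le> k" "k \<le> k1 N"
  shows "yb N < Im (node N k)" "Im (node N k) < yt N"
proof -
  have N: "real N > 0" using N_facts by simp
  have "(real (k0 N) - 1/2) / real N < real k / real N" "real k / real N < (real (k1 N) + 1/2) / real N"
    using assms N by (auto intro!: divide_strict_right_mono)
  then show "yb N < Im (node N k)" "Im (node N k) < yt N"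
    unfolding yb_def yt_def node_simps using p by (auto intro!: mult_strict_left_mono)
qed

lemma Re_node:
  assumes "k0 N \<le> k" "k \<le> k1 N"
  shows "0 < Re (node N k)" "Re (node N k) < u"
proof -
  have k: "0 < k" "k < N" using assms k0 k0_k1 by auto
  then show "0 < Re (node N k)" using u by (simp add: node_simps)
  have "real k / real N * u < 1 * u" using k u by (intro mult_strict_right_mono) auto
  then show "Re (node N k) < u" by (simp add: node_simps)
qed

lemma node_D:
  assumes "k0 N \<le> k" "k \<le> k1 N"
  shows "node N k \<in> D"
proof -
  have "- 2 * pi + \<theta> / 4 < Im (node N k)" "Im (node N k) < - \<epsilon> / 4"
    using Im_node[OF assms] yb yt theta eps by linarith+
  then show ?thesis using Re_node[OF assms] u unfolding D_def by simp
qed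

text \<open>The point at k0 + 1/2 is still below the height - \<pi>, which belongs to the parameter
  1 - 1 / (2 p). The anchor is thus in the range of the midpoint asymptotics.\<close>

lemma k0_rho: "real (k0 N) + 1/2 \<le> (1 - 1 / (2 * real p)) * real N"
proof -
  have N: "real N > 0" using N_facts by simp
  have "2 * pi * real p * ((real (k0 N) + 1/2) / real N - 1) = yb N + 2 * pi * real p / real N"
    using N by (simp add: yb_def field_simps)
  also have "\<dots> < - pi" using yb N_facts(3) theta by linarith
  also have "- pi = 2 * pi * real p * (- 1 / (2 * real p))" using p by simp
  finally have "(real (k0 N) + 1/2) / real N - 1 < - 1 / (2 * real p)"
    using tp by (simp only: mult_less_cancel_left_pos)
  then show ?thesis using N by (simp add: field_simps)
qed

lemma T_est:
  assumes V: "V \<in> D"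
  shows "\<exists>e. norm e \<le> C2 / real N \<and> T N V = peak N * exp ((P V - P \<phi>) / mesh N + F V / 2 - Fs 0 / 2 + e)"
proof -
  obtain e1 where e1: "norm e1 \<le> C1 / real N"
    "summand N (k0 N) = exp ((Ps ((of_nat (k0 N) + 1/2) * mesh N) - Ps (mesh N / 2)) / mesh N + e1)"
    using t_as[OF N_facts(2) k0_rho] by blast
  have W: "node N (k0 N) \<in> D" using node_D[of "k0 N"] k0_k1 by simp
  have r: "(real (k0 N) + 1/2) / real N < 1"
  proof -
    have "(1 - 1 / (2 * real p)) * real N < 1 * real N"
      using p N_facts by (intro mult_strict_right_mono) auto
    then have "real (k0 N) + 1/2 < real N" using k0_rho by linarith
    then show ?thesis using N_facts(2) by simp
  qed
  show ?thesis unfolding T_def C2_def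
    by (rule interpolant_estimate[OF N_facts(2) e1(2,1) half[OF N_facts(2)] _ r])
       (use W V P_step[OF N_facts(1)] E_est[OF N_facts(1)] in \<open>auto simp: D_def\<close>)
qed

text \<open>At the anchor \<open>T_est\<close> expresses the summand by exponentials. Nonvanishing
  of T makes the poles in the residue computation simple.\<close>

lemma T_nz: "T N V \<noteq> 0"
proof -
  have "node N (k0 N) \<in> D" using node_D[of "k0 N"] k0_k1 by simp
  from T_est[OF this] have "summand N (k0 N) \<noteq> 0" using peak_nz by (auto simp: T_def)
  then show ?thesis by (simp add: T_def)
qed

lemma T_norm:
  assumes V: "V \<in> D" "0 \<le> Re V" "Re V \<le> 3 * u"
  shows "norm (T N V) \<le> exp (3 + norm (Fs 0)) * norm (peak N) * exp (real N / xi_norm2 * gap V)"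
proof -
  from T_est[OF V(1)] obtain e where e: "norm e \<le> C2 / real N"
    "T N V = peak N * exp ((P V - P \<phi>) / mesh N + F V / 2 - Fs 0 / 2 + e)" by blast
  have "norm (T N V) = norm (peak N) * exp (Re ((P V - P \<phi>) / mesh N) + Re (F V) / 2 - Re (Fs 0) / 2 + Re e)"
    by (simp add: e(2) norm_mult)
  also have "Re ((P V - P \<phi>) / mesh N) = real N / xi_norm2 * gap V"
    unfolding Re_divide_mesh by (simp add: gap_def P_phi algebra_simps)
  \<comment> \<open>The constant 3 consists of 4/2 from F and 1 from e.\<close>
  also have "real N / xi_norm2 * gap V + Re (F V) / 2 - Re (Fs 0) / 2 + Re e \<le> (3 + norm (Fs 0)) + real N / xi_norm2 * gap V"
  proof -
    have "Re (F V) \<le> 4" using V D_Sig by (intro Re_F_le f_nz) auto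
    moreover have "- Re (Fs 0) \<le> norm (Fs 0)" using abs_Re_le_cmod[of "Fs 0"] by linarith
    moreover have "Re e \<le> 1" using complex_Re_le_cmod[of e] e(1) N_facts(8) by linarith
    moreover have "0 \<le> norm (Fs 0)" by simp
    ultimately show ?thesis by linarith
  qed
  then have "norm (peak N) * exp (real N / xi_norm2 * gap V + Re (F V) / 2 - Re (Fs 0) / 2 + Re e)
     \<le> norm (peak N) * exp ((3 + norm (Fs 0)) + real N / xi_norm2 * gap V)"
    by (intro mult_left_mono) auto
  also have "\<dots> = exp (3 + norm (Fs 0)) * norm (peak N) * exp (real N / xi_norm2 * gap V)"
    by (simp add: exp_add)
  finally show ?thesis .
qed

text \<open>At most N steps give |\<delta>| \<le> N \<eta>, and the choice of the rate makes 23^N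
  times \<eta> equal to C exp (- N).\<close>

lemma T_lattice:
  assumes k: "k0 N \<le> k" "k \<le> k1 N"
  shows "norm (summand N k - T N (node N k)) \<le> 3 * (real N * C * exp (- real N))"
proof -
  define \<eta> where "\<eta> = C * exp (- (ln 23 + 1) * real N)"
  have "\<exists>\<delta>. norm \<delta> \<le> real (k - k0 N) * \<eta> \<and> summand N (k0 N) * exp (E N (node N k) - E N (node N (k0 N))) = summand N k * exp \<delta>"
  proof (rule lattice_interpolant[OF N_facts(2) _ _ k])
    fix j assume j: "k0 N \<le> j" "j < k1 N"
    show "norm (E N (node N j + mesh N) - E N (node N j) - F (node N j + mesh N)) \<le> \<eta>"
      unfolding \<eta>_def using node_D[of j] j by (intro E_eq[OF N_facts(1)]) (auto simp: D_def)
  next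
    fix j assume j: "k0 N \<le> j" "j \<le> k1 N"
    show "node N j \<in> Sig" using node_D[OF j] D_Sig by auto
  qed
  then obtain \<delta> where \<delta>: "norm \<delta> \<le> real (k - k0 N) * \<eta>" "T N (node N k) = summand N k * exp \<delta>" by (auto simp: T_def)
  have \<eta>0: "\<eta> \<ge> 0" using C by (simp add: \<eta>_def)
  have kN: "k \<le> N" using k k0_k1 by simp
  have "real (k - k0 N) * \<eta> \<le> real N * \<eta>" using \<eta>0 kN by (intro mult_right_mono) auto
  then have d1: "norm \<delta> \<le> real N * \<eta>" using \<delta>(1) by linarith
  have "real N * \<eta> \<le> 1" using N_facts(7) by (simp add: \<eta>_def mult_ac)
  then have "norm \<delta> \<le> 1" using d1 by linarith
  have "norm (summand N k - T N (node N k)) = norm (summand N k) * norm (exp \<delta> - 1)"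
    unfolding \<delta>(2) norm_mult[symmetric] by (subst norm_minus_commute) (simp add: algebra_simps)
  also have "\<dots> \<le> 23 ^ N * (3 * (real N * \<eta>))"
    using norm_summand_le[OF kN N_facts(2)] norm_exp_minus_1_le[OF \<open>norm \<delta> \<le> 1\<close>] d1
    by (intro mult_mono) auto
  also have "\<dots> = 3 * (real N * C * exp (- real N))"
  proof -
    have "(23::real) ^ N * exp (- (ln 23 + 1) * real N) = exp (- real N)"
    proof -
      have "(23::real) ^ N = exp (ln 23 * real N)" by (simp add: exp_of_nat2_mult)
      then show ?thesis by (simp add: exp_add[symmetric] algebra_simps)
    qed
    then show ?thesis by (simp add: \<eta>_def)
  qed
  finally show ?thesis .
qed

end

section \<open>The integrand on the sides and the omitted summands\<close>

definition "G N V = T N V * pole_kernel N V"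
definition "amp = exp (3 + norm (Fs 0))"

lemma T_norm':
  assumes N: "big N" and V: "V \<in> D" "0 \<le> Re V" "Re V \<le> 3 * u"
  shows "norm (T N V) \<le> amp * norm (peak N) * exp (real N / xi_norm2 * gap V)"
  unfolding amp_def by (rule T_norm[OF assms])

lemma amp_pos: "amp > 0" by (simp add: amp_def)

text \<open>Since Re (\<open>freq N\<close>) = 4 \<pi>^2 p N / |\<xi>|^2, the rate of T and the
  decay of the kernel combine into one exponent; m is the length over which the kernel is known to
  decay.\<close>

lemma side_product:
  assumes N: "big N" and V: "V \<in> D" "0 \<le> Re V" "Re V \<le> 3 * u"
    and K: "norm (pole_kernel N V) \<le> 3 * exp (- Re (freq N) * m)"
    and g: "gap V - 4 * pi\<^sup>2 * real p * m \<le> - c"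
  shows "norm (G N V) \<le> 3 * amp * norm (peak N) * exp (- c * real N / xi_norm2)"
proof -
  have "norm (G N V) \<le> (amp * norm (peak N) * exp (real N / xi_norm2 * gap V)) * (3 * exp (- Re (freq N) * m))"
    unfolding G_def norm_mult using T_norm'[OF N V] K amp_pos by (intro mult_mono) auto
  also have "\<dots> = 3 * amp * norm (peak N) * exp (real N / xi_norm2 * (gap V - 4 * pi\<^sup>2 * real p * m))"
    by (simp add: freq_simps exp_diff exp_minus right_diff_distrib field_simps)
  also have "\<dots> \<le> 3 * amp * norm (peak N) * exp (real N / xi_norm2 * (- c))"
  proof -
    have "real N / xi_norm2 * (gap V - 4 * pi\<^sup>2 * real p * m) \<le> real N / xi_norm2 * (- c)"
      by (rule mult_left_mono[OF g]) (use xi_norm2_pos in simp)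
    then have "exp (real N / xi_norm2 * (gap V - 4 * pi\<^sup>2 * real p * m)) \<le> exp (real N / xi_norm2 * (- c))"
      by (simp only: exp_le_cancel_iff)
    then show ?thesis by (rule mult_left_mono) (use amp_pos in simp)
  qed
  finally show ?thesis by (simp add: mult_ac)
qed

lemma G_bottom:
  assumes N: "big N" and s: "0 \<le> s" "s \<le> 3 * u"
  shows "norm (G N (Complex s (yb N))) \<le> 3 * amp * norm (peak N) * exp (- c * real N / xi_norm2)"
proof (rule side_product[OF N])
  note y = yb[OF N]
  show "Complex s (yb N) \<in> D" using y s u theta eps pi_gt3 by (auto simp: D_def)
  have "real (k0 N) - 1/2 \<le> real N" using k0_k1[OF N] by simp
  then show "norm (pole_kernel N (Complex s (yb N))) \<le> 3 * exp (- Re (freq N) * max 0 (s - u))"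
    by (rule kernel_horizontal[OF N_facts(2)[OF N] _ yb_def])
  have "- 2 * pi < yb N" "yb N \<le> - 2 * pi + \<theta>" using y theta by linarith+
  from bottom_estimate[OF this s]
  show "gap (Complex s (yb N)) - 4 * pi\<^sup>2 * real p * max 0 (s - u) \<le> - c" using c(2) by simp
qed (use s in auto)

lemma G_top:
  assumes N: "big N" and s: "0 \<le> s" "s \<le> 3 * u"
  shows "norm (G N (Complex s (yt N))) \<le> 3 * amp * norm (peak N) * exp (- c * real N / xi_norm2)"
proof (rule side_product[OF N])
  note y = yt[OF N]
  show "Complex s (yt N) \<in> D" using y s u theta eps pi_gt3 by (auto simp: D_def)
  \<comment> \<open>The top row at k1 + 1/2 is the row at m - 1/2 for m = k1 + 1.\<close>
  have "real (Suc (k1 N)) - 1/2 \<le> real N" using k0_k1[OF N] by simp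
  moreover have "yt N = 2 * pi * real p * ((real (Suc (k1 N)) - 1/2) / real N - 1)" by (simp add: yt_def)
  ultimately show "norm (pole_kernel N (Complex s (yt N))) \<le> 3 * exp (- Re (freq N) * max 0 (s - u))"
    by (rule kernel_horizontal[OF N_facts(2)[OF N]])
  show "gap (Complex s (yt N)) - 4 * pi\<^sup>2 * real p * max 0 (s - u) \<le> - c"
    by (rule top) (use y s eps in auto)
qed (use s in auto)

lemma G_right:
  assumes N: "big N" and y: "yb N \<le> y" "y \<le> yt N"
  shows "norm (G N (Complex (3 * u) y)) \<le> 3 * amp * norm (peak N) * exp (- c * real N / xi_norm2)"
proof (rule side_product[OF N])
  have y': "- 2 * pi + \<theta> / 4 < y" "- 2 * pi < y" "y < - \<epsilon> / 4" "y < 0"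
    using y yb[OF N] yt[OF N] theta eps by linarith+
  show "Complex (3 * u) y \<in> D" using y' u by (auto simp: D_def)
  show "norm (pole_kernel N (Complex (3 * u) y)) \<le> 3 * exp (- Re (freq N) * (2 * u))"
    by (rule kernel_right) (use N_facts(5)[OF N] y' in auto)
  show "gap (Complex (3 * u) y) - 4 * pi\<^sup>2 * real p * (2 * u) \<le> - c"
    using right_estimate[OF y'(2,4)] c(2) by simp
qed (use u in auto)

lemma T_holomorphic: "big N \<Longrightarrow> T N holomorphic_on D"
  using E_hol[of N] unfolding T_def[abs_def] D_def big_def by (intro holomorphic_intros) auto

lemma contour_step:
  assumes N: "big N"
  shows "continuous_on {yb N..yt N} (\<lambda>y. G N (Complex 0 y))"
    "norm (mesh N * (\<Sum>k=k0 N..k1 N. T N (node N k)) - \<i> * integral {yb N..yt N} (\<lambda>y. G N (Complex 0 y)))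
      \<le> 3 * amp * norm (peak N) * exp (- c * real N / xi_norm2) * (6 * u + 2 * pi)"
proof -
  define B where "B = 3 * amp * norm (peak N) * exp (- c * real N / xi_norm2)"
  have B0: "B \<ge> 0" using amp_pos by (simp add: B_def)
  have Np: "real N > 0" using N_facts[OF N] by simp
  have Do: "open D"
    unfolding D_def Collect_conj_eq
    by (intro open_Int open_halfspace_Im_lt open_halfspace_Im_gt open_halfspace_Re_lt open_halfspace_Re_gt)
  have Dc: "convex D"
    unfolding D_def Collect_conj_eq
    by (intro convex_Int convex_halfspace_Im_lt convex_halfspace_Im_gt convex_halfspace_Re_lt convex_halfspace_Re_gt)
  have box: "cbox (Complex 0 (yb N)) (Complex (3 * u) (yt N)) \<subseteq> D"
    using yb[OF N] yt[OF N] theta eps u by (auto simp: D_def in_cbox_complex_iff)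
  have pts: "of_nat k * mesh N - period \<in> box (Complex 0 (yb N)) (Complex (3 * u) (yt N))"
    if "k0 N \<le> k" "k \<le> k1 N" for k
    using Im_node[OF N that] Re_node[OF N that] u by (simp add: in_box_complex_iff node_def)
  have out: "yb N > (real (k0 N) - 1) * Im (mesh N) - Im period" "yt N < (real (k1 N) + 1) * Im (mesh N) - Im period"
  proof -
    have "(real (k0 N) - 1) / real N < (real (k0 N) - 1/2) / real N" "(real (k1 N) + 1/2) / real N < (real (k1 N) + 1) / real N"
      using Np by (auto intro!: divide_strict_right_mono)
    then have "2 * pi * real p * ((real (k0 N) - 1) / real N - 1) < yb N" "yt N < 2 * pi * real p * ((real (k1 N) + 1) / real N - 1)"
      unfolding yb_def yt_def using p by (auto intro!: mult_strict_left_mono)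
    then show "yb N > (real (k0 N) - 1) * Im (mesh N) - Im period" "yt N < (real (k1 N) + 1) * Im (mesh N) - Im period"
      by (simp_all add: mesh_simps algebra_simps)
  qed
  have Gd: "G N V = T N V / (1 - exp (freq N * (V + period)))" for V
    by (simp add: G_def pole_kernel_def)
  have h: "Im (mesh N) > 0" using Np p by (simp add: mesh_simps)
  have r: "(0::real) < 3 * u" using u by simp
  note L = lattice_sum_contour[OF Do Dc T_holomorphic[OF N] T_nz[OF N] h freq_mesh[OF N_facts(2)[OF N]] r yb_yt[OF N] box pts out B0, folded Gd]
  have bounds: "norm (G N (Complex x (yb N))) \<le> B" "norm (G N (Complex x (yt N))) \<le> B" if "0 \<le> x" "x \<le> 3 * u" for x
    using G_bottom[OF N that] G_top[OF N that] by (simp_all add: B_def)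
  have bounds2: "norm (G N (Complex (3 * u) y)) \<le> B" if "yb N \<le> y" "y \<le> yt N" for y
    using G_right[OF N that] by (simp add: B_def)
  show "continuous_on {yb N..yt N} (\<lambda>y. G N (Complex 0 y))"
    by (rule L(1)) (use bounds bounds2 in auto)
  have "norm (mesh N * (\<Sum>k=k0 N..k1 N. T N (of_nat k * mesh N - period)) - \<i> * integral {yb N..yt N} (\<lambda>y. G N (Complex 0 y)))
     \<le> B * (2 * (3 * u - 0) + (yt N - yb N))"
    by (rule L(2)) (use bounds bounds2 in auto)
  \<comment> \<open>Twice the width 3 u, plus 2 \<pi> as a bound for the height.\<close>
  also have "\<dots> \<le> B * (6 * u + 2 * pi)"
    using B0 yb[OF N] yt[OF N] theta eps by (intro mult_left_mono) auto
  finally show "norm (mesh N * (\<Sum>k=k0 N..k1 N. T N (node N k)) - \<i> * integral {yb N..yt N} (\<lambda>y. G N (Complex 0 y)))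
      \<le> 3 * amp * norm (peak N) * exp (- c * real N / xi_norm2) * (6 * u + 2 * pi)"
    by (simp add: node_def B_def)
qed

text \<open>For k < k0 the point (k + 1/2) h is not above the bottom row (up to the shift by p
  periods), which is within the range of \<open>lower_estimate\<close> and of the midpoint
  asymptotics.\<close>

lemma lower_terms:
  assumes N: "big N" and k: "k < k0 N"
  shows "norm (summand N k) \<le> amp * norm (peak N) * exp (- c * real N / xi_norm2)"
proof -
  have Np: "real N > 0" using N_facts[OF N] by simp
  define t where "t = (real k + 1/2) / real N"
  have tle: "t \<le> (real (k0 N) - 1/2) / real N" unfolding t_def using k Np by (intro divide_right_mono) auto
  have kr: "real k + 1/2 \<le> (1 - 1 / (2 * real p)) * real N" using k0_rho[OF N] k by linarith
  have t0: "0 \<le> t" by (simp add: t_def)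
  have t1: "t < 1"
  proof -
    have "(1 - 1 / (2 * real p)) * real N < 1 * real N" using p Np by (intro mult_strict_right_mono) auto
    then have "real k + 1/2 < real N" using kr by linarith
    then show ?thesis using Np by (simp add: t_def)
  qed
  have "2 * pi * real p * t \<le> 2 * pi * real p * ((real (k0 N) - 1/2) / real N)" using tle by (intro mult_left_mono) auto
  also have "\<dots> = yb N + 2 * pi * real p" by (simp add: yb_def algebra_simps)
  also have "\<dots> \<le> 2 * pi * (real p - 1) + \<theta>" using yb[OF N] theta by (simp add: algebra_simps)
  finally have t2: "2 * pi * real p * t \<le> 2 * pi * (real p - 1) + \<theta>" .
  obtain e where e: "norm e \<le> C1 / real N" "summand N k = exp ((Ps ((of_nat k + 1/2) * mesh N) - Ps (mesh N / 2)) / mesh N + e)"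
    using t_as[OF N_facts(2)[OF N] kr] by blast
  have "(of_nat k + 1/2) * mesh N = of_real t * \<xi>" using Np by (simp add: t_def mesh_def)
  then have ex: "norm (summand N k) = exp (Re (Ps (of_real t * \<xi>) / mesh N) - Re (Ps (mesh N / 2) / mesh N) + Re e)"
    unfolding e(2) by (simp add: diff_divide_distrib)
  have g: "Re (Ps (of_real t * \<xi>) / mesh N) \<le> real N / xi_norm2 * (2 * pi * real p * (2 * pi * real p * u + V0)) - c * real N / xi_norm2"
  proof -
    have "gaps (of_real t * \<xi>) \<le> 2 * pi * real p * (2 * pi * real p * u + V0) - c"
      using lower_estimate[OF t0 t1 t2] c(2) by simp
    then have "real N / xi_norm2 * gaps (of_real t * \<xi>) \<le> real N / xi_norm2 * (2 * pi * real p * (2 * pi * real p * u + V0) - c)"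
      using xi_norm2_pos by (intro mult_left_mono) auto
    moreover have "real N / xi_norm2 * (a - c) = real N / xi_norm2 * a - c * real N / xi_norm2" for a
      by (simp add: right_diff_distrib diff_divide_distrib mult.commute)
    ultimately show ?thesis by (simp only: Re_divide_mesh gaps_def)
  qed
  have CC: "C1 / real N \<le> 1" "C3 / real N \<le> 1"
  proof -
    have "C1 / real N \<le> C2 / real N" "C3 / real N \<le> C2 / real N"
      using C by (intro divide_right_mono; simp add: C2_def)+
    then show "C1 / real N \<le> 1" "C3 / real N \<le> 1" using N_facts(8)[OF N] by linarith+
  qed
  have "- Re (Ps (mesh N / 2) / mesh N) + Re e \<le> 3 + norm (Fs 0)"
  proof -
    have "Re e \<le> 1" using complex_Re_le_cmod[of e] e(1) CC by linarith
    moreover have "\<bar>Re (Ps (mesh N / 2) / mesh N - Fs 0 / 2)\<bar> \<le> 1"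
      using abs_Re_le_cmod half[OF N_facts(2)[OF N]] CC by (meson order_trans)
    then have "- Re (Ps (mesh N / 2) / mesh N) \<le> 1 - Re (Fs 0 / 2)" by simp
    moreover have "- Re (Fs 0 / 2) \<le> norm (Fs 0 / 2)" using abs_Re_le_cmod[of "Fs 0 / 2"] by linarith
    moreover have "norm (Fs 0 / 2) \<le> norm (Fs 0)" by simp
    ultimately show ?thesis by linarith
  qed
  then have "norm (summand N k) \<le> exp ((3 + norm (Fs 0)) + real N / xi_norm2 * (2 * pi * real p * (2 * pi * real p * u + V0)) + (- c * real N / xi_norm2))"
    unfolding ex using g by simp
  also have "\<dots> = amp * norm (peak N) * exp (- c * real N / xi_norm2)"
    by (simp only: exp_add amp_def norm_peak)
  finally show ?thesis .
qed

text \<open>From \<open>k1 N\<close> on every new factor has modulus at most 1 by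
  \<open>f_le_1\<close>, so the summands do not increase in modulus. The one at \<open>k1 N\<close>
  is compared with T at a node half a step below the top row, where the bound \<open>top\<close>
  still holds.\<close>

lemma upper_terms:
  assumes N: "big N" and k: "k1 N \<le> k" "k < N"
  shows "norm (summand N k) \<le> amp * norm (peak N) * exp (- c * real N / xi_norm2) + 3 * (real N * C * exp (- real N))"
proof -
  have Np: "real N > 0" using N_facts[OF N] by simp
  have "norm (summand N k) \<le> norm (summand N (k1 N))" using k
  proof (induction k rule: dec_induct)
    case (step k)
    define s y where "s = real (Suc k) / real N * u" and "y = 2 * pi * real p * (real (Suc k) / real N - 1)"
    have "f (of_nat (Suc k) * mesh N) = f (node N (Suc k))" by (simp only: node_def f_periodic)
    also have "node N (Suc k) = Complex s y" by (simp add: complex_eq_iff node_simps s_def y_def)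
    finally have fe: "f (of_nat (Suc k) * mesh N) = f (Complex s y)" .
    have q: "(real (k1 N) + 1/2) / real N \<le> real (Suc k) / real N" "real (Suc k) / real N \<le> 1"
      using step Np by (auto intro!: divide_right_mono)
    have "yt N \<le> y" unfolding yt_def y_def using q(1) by (intro mult_left_mono) auto
    moreover have "y \<le> 0" unfolding y_def using q(2) by (intro mult_nonneg_nonpos) auto
    ultimately have "\<bar>y\<bar> \<le> (3 - 2 * cosh u) / 8" using yt[OF N] eps by linarith
    moreover have "s \<le> 1 * u" unfolding s_def using q(2) u by (intro mult_right_mono) auto
    moreover have "0 \<le> s" using u by (simp add: s_def)
    ultimately have "norm (f (Complex s y)) \<le> 1" by (intro f_le_1) auto
    then have "norm (summand N (Suc k)) \<le> norm (summand N k) * 1"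
      unfolding summand_Suc norm_mult fe by (intro mult_left_mono) auto
    then show ?case using step by simp
  qed simp
  also have "\<dots> \<le> norm (T N (node N (k1 N))) + norm (summand N (k1 N) - T N (node N (k1 N)))"
    using norm_triangle_ineq[of "T N (node N (k1 N))" "summand N (k1 N) - T N (node N (k1 N))"] by simp
  also have "\<dots> \<le> amp * norm (peak N) * exp (- c * real N / xi_norm2) + 3 * (real N * C * exp (- real N))"
  proof (rule add_mono)
    have kk: "k0 N \<le> k1 N" "k1 N \<le> k1 N" using k0_k1[OF N] by auto
    define V where "V = node N (k1 N)"
    have V: "V \<in> D" "0 < Re V" "Re V < u" using node_D[OF N kk] Re_node[OF N kk] by (auto simp: V_def)
    have "Im V = yt N - (2 * pi * real p / real N) / 2"
      by (simp add: V_def node_simps yt_def add_divide_distrib algebra_simps)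
    moreover have "- \<epsilon> \<le> a - w / 2" if "- 5 * \<epsilon> / 8 < a" "w < \<epsilon> / 8" for a w
      using that eps(1) by linarith
    ultimately have "- \<epsilon> \<le> Im V" using yt(2)[OF N] N_facts(4)[OF N] by metis
    moreover have "Im V < 0" using V(1) eps by (auto simp: D_def)
    ultimately have "gap (Complex (Re V) (Im V)) - 4 * pi\<^sup>2 * real p * max 0 (Re V - u) \<le> - c"
      using V u by (intro top) auto
    then have "gap V \<le> - c" using V(3) by simp
    then have "real N / xi_norm2 * gap V \<le> real N / xi_norm2 * (- c)" using xi_norm2_pos by (intro mult_left_mono) auto
    then have "exp (real N / xi_norm2 * gap V) \<le> exp (- c * real N / xi_norm2)" by (simp add: mult_ac)
    moreover have "norm (T N V) \<le> amp * norm (peak N) * exp (real N / xi_norm2 * gap V)"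
      using V u by (intro T_norm'[OF N]) auto
    ultimately show "norm (T N (node N (k1 N))) \<le> amp * norm (peak N) * exp (- c * real N / xi_norm2)"
      unfolding V_def using amp_pos by (smt (verit) mult_left_mono mult_nonneg_nonneg norm_ge_zero)
    show "norm (summand N (k1 N) - T N (node N (k1 N))) \<le> 3 * (real N * C * exp (- real N))"
      by (rule T_lattice[OF N kk])
  qed
  finally show ?thesis .
qed

text \<open>The first term collects the three sides and the two groups of omitted summands, relative
  to \<open>peak\<close>; the second one collects the interpolation errors. The number of summands
  is absorbed by |mesh N| N = |\<xi>|.\<close>

definition "err N = exp (- c * real N / xi_norm2) * (3 * amp * (6 * u + 2 * pi) + 2 * norm \<xi> * amp)
  + norm \<xi> * (6 * (real N * C * exp (- real N)))"

lemma sum_step: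
  assumes N: "big N"
  shows "norm (mesh N * (\<Sum>k<N. summand N k) / peak N - \<i> * integral {yb N..yt N} (\<lambda>y. G N (Complex 0 y) / peak N)) \<le> err N"
proof -
  have Np: "real N > 0" using N_facts[OF N] by simp
  have kk: "k0 N \<le> k1 N" "k1 N < N" using k0_k1[OF N] by auto
  define x z where "x = amp * norm (peak N) * exp (- c * real N / xi_norm2)" and "z = 3 * (real N * C * exp (- real N))"
  have x0: "x \<ge> 0" using amp_pos by (simp add: x_def)
  have z0: "z \<ge> 0" using C by (simp add: z_def)
  define S1 S2 S3 where "S1 = (\<Sum>k<k0 N. summand N k)" and "S2 = (\<Sum>k=k0 N..k1 N. summand N k - T N (node N k))"
    and "S3 = (\<Sum>k\<in>{k1 N<..<N}. summand N k)"
  have split: "(\<Sum>k<N. summand N k) = S1 + (\<Sum>k=k0 N..k1 N. summand N k) + S3"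
  proof -
    have "{..<N} = ({..<k0 N} \<union> {k0 N..k1 N}) \<union> {k1 N<..<N}" using kk by auto
    moreover have "(\<Sum>k\<in>({..<k0 N} \<union> {k0 N..k1 N}) \<union> {k1 N<..<N}. summand N k) =
       (\<Sum>k\<in>{..<k0 N} \<union> {k0 N..k1 N}. summand N k) + (\<Sum>k\<in>{k1 N<..<N}. summand N k)"
      by (rule sum.union_disjoint) (use kk in auto)
    moreover have "(\<Sum>k\<in>{..<k0 N} \<union> {k0 N..k1 N}. summand N k) = (\<Sum>k<k0 N. summand N k) + (\<Sum>k=k0 N..k1 N. summand N k)"
      by (rule sum.union_disjoint) auto
    ultimately show ?thesis by (simp only: S1_def S3_def)
  qed
  have b1: "norm S1 \<le> real (card {..<k0 N}) * x"
    unfolding S1_def by (rule sum_norm_bound) (use lower_terms[OF N] in \<open>auto simp: x_def\<close>)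
  have b2: "norm S2 \<le> real (card {k0 N..k1 N}) * z"
    unfolding S2_def by (rule sum_norm_bound) (use T_lattice[OF N] in \<open>auto simp: z_def\<close>)
  have b3: "norm S3 \<le> real (card {k1 N<..<N}) * (x + z)"
    unfolding S3_def by (rule sum_norm_bound) (use upper_terms[OF N] in \<open>auto simp: x_def z_def\<close>)
  have cards: "real (card {..<k0 N}) \<le> real N" "real (card {k0 N..k1 N}) \<le> real N" "real (card {k1 N<..<N}) \<le> real N"
    using kk by auto
  have "norm S1 \<le> real N * x" "norm S2 \<le> real N * z" "norm S3 \<le> real N * (x + z)"
    using b1 b2 b3 cards x0 z0 mult_right_mono[OF cards(1) x0] mult_right_mono[OF cards(2) z0] mult_right_mono[OF cards(3), of "x + z"]
    by linarith+
  then have R: "norm (S1 + S2 + S3) \<le> real N * (2 * x + 2 * z)"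
    using norm_triangle_ineq[of "S1 + S2" S3] norm_triangle_ineq[of S1 S2] by (simp add: algebra_simps)
  have tot: "(\<Sum>k<N. summand N k) = (\<Sum>k=k0 N..k1 N. T N (node N k)) + (S1 + S2 + S3)"
    unfolding split S2_def by (simp add: sum_subtractf)
  define I where "I = integral {yb N..yt N} (\<lambda>y. G N (Complex 0 y))"
  define M where "M = mesh N * (\<Sum>k=k0 N..k1 N. T N (node N k)) - \<i> * I"
  have M: "norm M \<le> 3 * x * (6 * u + 2 * pi)" using contour_step(2)[OF N] by (simp add: M_def I_def x_def mult_ac)
  have eq: "mesh N * (\<Sum>k<N. summand N k) - \<i> * I = M + mesh N * (S1 + S2 + S3)"
    unfolding tot M_def by (simp add: algebra_simps)
  have nh: "norm (mesh N) * real N = norm \<xi>" using Np by (simp add: norm_mesh)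
  have "norm (mesh N * (\<Sum>k<N. summand N k) - \<i> * I) \<le> norm M + norm (mesh N) * norm (S1 + S2 + S3)"
    unfolding eq norm_mult[symmetric] by (rule norm_triangle_ineq)
  also have "\<dots> \<le> 3 * x * (6 * u + 2 * pi) + norm (mesh N) * (real N * (2 * x + 2 * z))"
    using M R by (intro add_mono mult_left_mono) auto
  also have "\<dots> = 3 * x * (6 * u + 2 * pi) + norm \<xi> * (2 * x + 2 * z)"
    by (simp only: mult.assoc[symmetric] nh)
  finally have fin: "norm (mesh N * (\<Sum>k<N. summand N k) - \<i> * I) \<le> 3 * x * (6 * u + 2 * pi) + norm \<xi> * (2 * x + 2 * z)" .
  have Idiv: "integral {yb N..yt N} (\<lambda>y. G N (Complex 0 y) / peak N) = I / peak N"
    by (simp add: I_def)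
  have A1: "norm (peak N) \<ge> 1" by (rule norm_peak_ge_1)
  have "norm (mesh N * (\<Sum>k<N. summand N k) / peak N - \<i> * integral {yb N..yt N} (\<lambda>y. G N (Complex 0 y) / peak N))
     = norm (mesh N * (\<Sum>k<N. summand N k) - \<i> * I) / norm (peak N)"
    unfolding Idiv by (simp add: norm_divide[symmetric] diff_divide_distrib)
  also have "\<dots> \<le> (3 * x * (6 * u + 2 * pi) + norm \<xi> * (2 * x + 2 * z)) / norm (peak N)"
    using fin by (rule divide_right_mono) simp
  also have "\<dots> = exp (- c * real N / xi_norm2) * (3 * amp * (6 * u + 2 * pi) + 2 * norm \<xi> * amp) + norm \<xi> * (2 * z) / norm (peak N)"
    using peak_nz[of N] by (simp add: x_def field_simps)
  \<comment> \<open>The interpolation errors are absolute; dividing them by \<open>peak\<close> is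
    harmless because its modulus is at least 1.\<close>
  also have "norm \<xi> * (2 * z) / norm (peak N) \<le> norm \<xi> * (2 * z) / 1"
    using A1 z0 by (intro divide_left_mono) auto
  finally show ?thesis by (simp add: err_def z_def)
qed

lemma err_tendsto: "(\<lambda>N. sqrt (real N) * err N) \<longlonglongrightarrow> 0"
proof -
  define a b d where "a = c / xi_norm2" and "b = 3 * amp * (6 * u + 2 * pi) + 2 * norm \<xi> * amp" and "d = norm \<xi> * 6 * C"
  have a: "a > 0" using c xi_norm2_pos by (simp add: a_def)
  have e: "sqrt (real N) * err N = (sqrt (real N) * exp (- a * real N)) * b + d * (sqrt (real N) * real N * exp (- real N))" for N
    by (simp add: err_def a_def b_def d_def algebra_simps)
  have "(\<lambda>N. sqrt (real N) * exp (- a * real N)) \<longlonglongrightarrow> 0" using a by real_asymp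
  moreover have "(\<lambda>N. sqrt (real N) * real N * exp (- real N)) \<longlonglongrightarrow> 0" by real_asymp
  ultimately have "(\<lambda>N. (sqrt (real N) * exp (- a * real N)) * b + d * (sqrt (real N) * real N * exp (- real N))) \<longlonglongrightarrow> 0 * b + d * 0"
    by (intro tendsto_intros)
  then show ?thesis unfolding e by simp
qed

section \<open>The Laplace method on the left side\<close>

lemma Re_gamma: "Re (\<i> / \<xi> * of_real (sin \<theta>)) = sin \<theta> * (2 * pi * real p) / xi_norm2"
  by (simp add: Re_divide xi_norm2_def)

text \<open>\<open>Lam_second_order\<close> along y = - \<theta> + s / sqrt N. The case s = 0 is
  separate, as a punctured limit says nothing about the point itself.\<close>

lemma Lam_scaled_tendsto:
  "(\<lambda>N. real N * (Lam (- \<theta> + s / sqrt (real N)) - V0)) \<longlonglongrightarrow> - sin \<theta> * s\<^sup>2"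
proof (cases "s = 0")
  case True
  then show ?thesis by (simp add: V0_def)
next
  case False
  have lim: "filterlim (\<lambda>N. - \<theta> + s / sqrt (real N)) (at (- \<theta>)) sequentially"
  proof (rule filterlim_atI)
    show "(\<lambda>N. - \<theta> + s / sqrt (real N)) \<longlonglongrightarrow> - \<theta>" by real_asymp
    show "\<forall>\<^sub>F N in sequentially. - \<theta> + s / sqrt (real N) \<noteq> - \<theta>"
      using eventually_gt_at_top[of "0::nat"] by eventually_elim (use False in simp)
  qed
  have "(\<lambda>N. s\<^sup>2 * ((Lam (- \<theta> + s / sqrt (real N)) - V0) / (- \<theta> + s / sqrt (real N) + \<theta>)\<^sup>2)) \<longlonglongrightarrow> s\<^sup>2 * - sin \<theta>"
    by (intro tendsto_mult tendsto_const filterlim_compose[OF Lam_second_order lim])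
  then have "(\<lambda>N. s\<^sup>2 * ((Lam (- \<theta> + s / sqrt (real N)) - V0) / (- \<theta> + s / sqrt (real N) + \<theta>)\<^sup>2)) \<longlonglongrightarrow> - sin \<theta> * s\<^sup>2"
    by (simp add: mult.commute)
  then show ?thesis
  proof (rule Lim_transform_eventually)
    show "\<forall>\<^sub>F N in sequentially. s\<^sup>2 * ((Lam (- \<theta> + s / sqrt (real N)) - V0) / (- \<theta> + s / sqrt (real N) + \<theta>)\<^sup>2) =
      real N * (Lam (- \<theta> + s / sqrt (real N)) - V0)"
      using eventually_gt_at_top[of "0::nat"] by eventually_elim (use False in \<open>simp add: power_divide\<close>)
  qed
qed

text \<open>The exponent of T / \<open>peak\<close> on the imaginary axis without its O(1/N)
  part.\<close>

definition "profile N y = \<i> / \<xi> * of_real (real N * (Lam y - V0)) + of_real (g y) / 2 - Fs 0 / 2"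

text \<open>The relative error stems from the interpolation, O(1/N), and from the deviation of the
  kernel from 1. The first bound gives the pointwise limit and the second one the domination in the
  Laplace method.\<close>

lemma G_imag_axis:
  assumes N: "big N" and y: "yb N \<le> y" "y \<le> yt N"
  shows "norm (G N (Complex 0 y) / peak N - exp (profile N y)) \<le> norm (exp (profile N y)) *
     (6 * (C2 / real N) + 2 * exp (- (2 * pi * u * real N / xi_norm2) * (\<theta> / 2)))"
    "norm (G N (Complex 0 y) / peak N) \<le> 2 * amp * exp (real N / xi_norm2 * (2 * pi * real p * (Lam y - V0)))"
proof -
  have y': "- 2 * pi + \<theta> / 4 < y" "- 2 * pi < y" "y < - \<epsilon> / 4" "y < 0" "- 2 * pi + \<theta> / 2 \<le> y"
    using y yb[OF N] yt[OF N] theta eps by linarith+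
  have D: "Complex 0 y \<in> D" using y' u by (auto simp: D_def)
  have h0: "mesh N \<noteq> 0" using N_facts(2)[OF N] xi_nz by (simp add: mesh_def)
  obtain e where e: "norm e \<le> C2 / real N"
    "T N (Complex 0 y) = peak N * exp ((P (Complex 0 y) - P \<phi>) / mesh N + F (Complex 0 y) / 2 - Fs 0 / 2 + e)"
    using T_est[OF N D] by blast
  have "F (Complex 0 y) = of_real (g y)" using Fs_eq_F[of "Complex 0 y"] Fs_imag_axis[of y] u by simp
  moreover have "(P (Complex 0 y) - P \<phi>) / mesh N = \<i> / \<xi> * of_real (real N * (Lam y - V0))"
    by (simp add: P_imag_axis[OF y'(2,4)] P_phi mesh_def algebra_simps diff_divide_distrib)
  ultimately have T: "T N (Complex 0 y) = peak N * exp (profile N y + e)"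
    unfolding e(2) profile_def by simp
  note K = kernel_left[OF y'(5) less_imp_le[OF y'(4)] N_facts(6)[OF N]]
  have eq: "G N (Complex 0 y) / peak N = exp (profile N y) * (exp e * pole_kernel N (Complex 0 y))"
    using peak_nz[of N] by (simp add: G_def T exp_add)
  have e1: "norm e \<le> 1" using e(1) N_facts(8)[OF N] by linarith
  have "norm (exp e * pole_kernel N (Complex 0 y) - 1) \<le> norm ((exp e - 1) * pole_kernel N (Complex 0 y)) + norm (pole_kernel N (Complex 0 y) - 1)"
    using norm_triangle_ineq[of "(exp e - 1) * pole_kernel N (Complex 0 y)" "pole_kernel N (Complex 0 y) - 1"] by (simp add: algebra_simps)
  also have "\<dots> \<le> 3 * (C2 / real N) * 2 + 2 * exp (- (2 * pi * u * real N / xi_norm2) * (\<theta> / 2))"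
  proof (rule add_mono)
    have "norm (exp e - 1) \<le> 3 * (C2 / real N)" using norm_exp_minus_1_le[OF e1] e(1) by linarith
    moreover have "0 \<le> 3 * (C2 / real N)" using order_trans[OF norm_ge_zero e(1)] by linarith
    ultimately show "norm ((exp e - 1) * pole_kernel N (Complex 0 y)) \<le> 3 * (C2 / real N) * 2"
      unfolding norm_mult using K(2) by (intro mult_mono) auto
  qed (rule K(1))
  finally have b: "norm (exp e * pole_kernel N (Complex 0 y) - 1) \<le> 6 * (C2 / real N) + 2 * exp (- (2 * pi * u * real N / xi_norm2) * (\<theta> / 2))"
    by simp
  have "G N (Complex 0 y) / peak N - exp (profile N y) = exp (profile N y) * (exp e * pole_kernel N (Complex 0 y) - 1)"
    unfolding eq by (simp add: algebra_simps)
  then show "norm (G N (Complex 0 y) / peak N - exp (profile N y)) \<le> norm (exp (profile N y)) *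
     (6 * (C2 / real N) + 2 * exp (- (2 * pi * u * real N / xi_norm2) * (\<theta> / 2)))"
    using b by (simp only: norm_mult) (rule mult_left_mono, auto)
  have "norm (T N (Complex 0 y)) \<le> amp * norm (peak N) * exp (real N / xi_norm2 * gap (Complex 0 y))"
    using T_norm'[OF N D] u by simp
  then have "norm (G N (Complex 0 y)) \<le> (amp * norm (peak N) * exp (real N / xi_norm2 * gap (Complex 0 y))) * 2"
    unfolding G_def norm_mult using K(2) amp_pos by (intro mult_mono) auto
  then show "norm (G N (Complex 0 y) / peak N) \<le> 2 * amp * exp (real N / xi_norm2 * (2 * pi * real p * (Lam y - V0)))"
    using peak_nz[of N] by (simp add: norm_divide divide_le_eq gap_imag_axis[OF y'(2,4)] mult_ac)
qed

text \<open>As g vanishes at - \<theta>, only the quadratic term of \<open>profile\<close> and the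
  constant - Fs 0 / 2 survive the scaling by sqrt N.\<close>

lemma left_side_integral:
  "(\<lambda>N. of_real (sqrt (real N)) * integral {yb N..yt N} (\<lambda>y. G N (Complex 0 y) / peak N))
     \<longlonglongrightarrow> exp (- Fs 0 / 2) * csqrt (pi / (\<i> / \<xi> * of_real (sin \<theta>)))"
proof -
  obtain q where q: "q > 0" "\<And>y. - 2 * pi \<le> y \<Longrightarrow> y \<le> 0 \<Longrightarrow> Lam y - V0 \<le> - q * (y + \<theta>)\<^sup>2"
    using Lam_quadratic by blast
  show ?thesis
  \<comment> \<open>The interval from yb N to yt N varies with N but always contains
    [- 2 \<pi> + \<theta>, - \<epsilon>], which has the saddle point in its interior.\<close>
  proof (rule laplace_method[of "2 * pi * real p * q / xi_norm2" "\<i> / \<xi> * of_real (sin \<theta>)" yb yt _ "2 * amp" "- \<theta>" _ "- 2 * pi + \<theta>" "- \<epsilon>"])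
    show "0 < 2 * pi * real p * q / xi_norm2" using q(1) xi_norm2_pos p by simp
    show "0 < Re (\<i> / \<xi> * of_real (sin \<theta>))" unfolding Re_gamma using sin_theta xi_norm2_pos p by simp
    show "\<forall>\<^sub>F N in sequentially. continuous_on {yb N..yt N} (\<lambda>y. G N (Complex 0 y) / peak N)"
      using eventually_big by eventually_elim (intro continuous_intros contour_step ballI peak_nz)
    show "\<forall>\<^sub>F N in sequentially. \<forall>y\<in>{yb N..yt N}. norm (G N (Complex 0 y) / peak N)
        \<le> 2 * amp * exp (- (2 * pi * real p * q / xi_norm2) * real N * (y - - \<theta>)\<^sup>2)"
      using eventually_big
    proof eventually_elim
      case (elim N)
      show ?case
      proof
        fix y assume y: "y \<in> {yb N..yt N}"
        then have "- 2 * pi \<le> y" "y \<le> 0" using yb[OF elim] yt[OF elim] theta eps by auto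
        from q(2)[OF this] have "real N / xi_norm2 * (2 * pi * real p * (Lam y - V0)) \<le> real N / xi_norm2 * (2 * pi * real p * (- q * (y + \<theta>)\<^sup>2))"
          using xi_norm2_pos by (intro mult_left_mono) auto
        also have "\<dots> = - (2 * pi * real p * q / xi_norm2) * real N * (y - - \<theta>)\<^sup>2" by simp
        finally have "2 * amp * exp (real N / xi_norm2 * (2 * pi * real p * (Lam y - V0)))
           \<le> 2 * amp * exp (- (2 * pi * real p * q / xi_norm2) * real N * (y - - \<theta>)\<^sup>2)"
          using amp_pos by (intro mult_left_mono) auto
        then show "norm (G N (Complex 0 y) / peak N) \<le> 2 * amp * exp (- (2 * pi * real p * q / xi_norm2) * real N * (y - - \<theta>)\<^sup>2)"
          using G_imag_axis(2)[OF elim, of y] y by simp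
      qed
    qed
    show "- 2 * pi + \<theta> < - \<theta>" "- \<theta> < - \<epsilon>" using theta pi_gt3 eps by linarith+
    show ab: "\<forall>\<^sub>F N in sequentially. yb N \<le> - 2 * pi + \<theta> \<and> - \<epsilon> \<le> yt N"
      using eventually_big
    proof eventually_elim
      case (elim N)
      then show ?case using yb[OF elim] yt[OF elim] theta eps by linarith
    qed
    fix s :: real
    define y where "y N = - \<theta> + s / sqrt (real N)" for N
    have ylim: "y \<longlonglongrightarrow> - \<theta>" unfolding y_def by real_asymp
    have y1: "\<forall>\<^sub>F N in sequentially. y N > - 2 * pi + \<theta>" "\<forall>\<^sub>F N in sequentially. y N < - \<epsilon>"
      using theta pi_gt3 eps by (auto intro!: order_tendstoD[OF ylim])
    have mlim: "(\<lambda>N. profile N (y N)) \<longlonglongrightarrow> \<i> / \<xi> * of_real (- sin \<theta> * s\<^sup>2) + of_real (g (- \<theta>)) / 2 - Fs 0 / 2"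
      unfolding profile_def
    proof (intro tendsto_diff tendsto_add tendsto_mult[OF tendsto_const] tendsto_divide tendsto_of_real tendsto_const)
      show "(\<lambda>N. real N * (Lam (y N) - V0)) \<longlonglongrightarrow> - sin \<theta> * s\<^sup>2"
        unfolding y_def by (rule Lam_scaled_tendsto)
      have "isCont g (- \<theta>)" unfolding g_def using g_arg_pos[of "- \<theta>"] by (intro continuous_intros) auto
      then show "(\<lambda>N. g (y N)) \<longlonglongrightarrow> g (- \<theta>)" using ylim by (rule isCont_tendsto_compose)
    qed auto
    define w where "w = \<i> / \<xi> * of_real (- sin \<theta> * s\<^sup>2) - Fs 0 / 2"
    have mlim': "(\<lambda>N. profile N (y N)) \<longlonglongrightarrow> w" using mlim by (simp add: w_def g_theta)
    have elim': "(\<lambda>N. exp (profile N (y N))) \<longlonglongrightarrow> exp w" by (intro tendsto_exp mlim')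
    have bl: "(\<lambda>N. norm (exp (profile N (y N))) * (6 * (C2 / real N) + 2 * exp (- (2 * pi * u * real N / xi_norm2) * (\<theta> / 2)))) \<longlonglongrightarrow> norm (exp w) * (6 * 0 + 2 * 0)"
    proof -
      have z1: "(\<lambda>N. C2 / real N) \<longlonglongrightarrow> 0" by real_asymp
      define a where "a = 2 * pi * u / xi_norm2 * (\<theta> / 2)"
      have "a > 0" using u xi_norm2_pos theta by (simp add: a_def)
      then have "(\<lambda>N. exp (- a * real N)) \<longlonglongrightarrow> 0" by real_asymp
      then have z2: "(\<lambda>N. exp (- (2 * pi * u * real N / xi_norm2) * (\<theta> / 2))) \<longlonglongrightarrow> 0" by (simp add: a_def mult_ac)
      show ?thesis by (intro tendsto_mult tendsto_add tendsto_const tendsto_norm elim' z1 z2)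
    qed
    have "(\<lambda>N. G N (Complex 0 (y N)) / peak N - exp (profile N (y N))) \<longlonglongrightarrow> 0"
    proof (rule Lim_null_comparison)
      show "\<forall>\<^sub>F N in sequentially. norm (G N (Complex 0 (y N)) / peak N - exp (profile N (y N)))
        \<le> norm (exp (profile N (y N))) * (6 * (C2 / real N) + 2 * exp (- (2 * pi * u * real N / xi_norm2) * (\<theta> / 2)))"
        using eventually_big y1 ab
      proof eventually_elim
        case (elim N)
        then show ?case by (intro G_imag_axis(1)) auto
      qed
    qed (use bl in simp)
    from tendsto_add[OF this elim']
    have "(\<lambda>N. G N (Complex 0 (y N)) / peak N) \<longlonglongrightarrow> exp w" by simp
    moreover have "exp w = exp (- Fs 0 / 2) * exp (- (\<i> / \<xi> * of_real (sin \<theta>)) * (of_real s)\<^sup>2)"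
    proof -
      have "w = - Fs 0 / 2 + (- (\<i> / \<xi> * of_real (sin \<theta>)) * (of_real s)\<^sup>2)"
        unfolding w_def by (simp add: algebra_simps)
      then show ?thesis by (simp only: exp_add)
    qed
    ultimately show "(\<lambda>N. G N (Complex 0 (- \<theta> + s / sqrt (real N))) / peak N) \<longlonglongrightarrow>
       exp (- Fs 0 / 2) * exp (- (\<i> / \<xi> * of_real (sin \<theta>)) * (of_real s)\<^sup>2)"
      by (simp add: y_def)
  qed
qed

text \<open>In the prefactor, i is the direction of the left side, and 1 / \<xi> comes from dividing
  by mesh N = \<xi> / N.\<close>

lemma summand_sum_asymptotics:
  "(\<lambda>N. (\<Sum>k<N. summand N k) / (peak N * of_real (sqrt (real N))))
    \<longlonglongrightarrow> \<i> / \<xi> * (exp (- Fs 0 / 2) * csqrt (pi / (\<i> / \<xi> * of_real (sin \<theta>))))"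
proof -
  let ?I = "\<lambda>N. integral {yb N..yt N} (\<lambda>y. G N (Complex 0 y) / peak N)"
  let ?s = "\<lambda>N. complex_of_real (sqrt (real N))"
  have d: "(\<lambda>N. ?s N * (mesh N * (\<Sum>k<N. summand N k) / peak N - \<i> * ?I N)) \<longlonglongrightarrow> 0"
  proof (rule Lim_null_comparison[OF _ err_tendsto])
    show "\<forall>\<^sub>F N in sequentially. norm (?s N * (mesh N * (\<Sum>k<N. summand N k) / peak N - \<i> * ?I N)) \<le> sqrt (real N) * err N"
      using eventually_big
    proof eventually_elim
      case (elim N)
      show ?case unfolding norm_mult using sum_step[OF elim] by (simp add: mult_left_mono)
    qed
  qed
  have "(\<lambda>N. 1 / \<xi> * (?s N * (mesh N * (\<Sum>k<N. summand N k) / peak N - \<i> * ?I N) + \<i> * (?s N * ?I N)))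
     \<longlonglongrightarrow> 1 / \<xi> * (0 + \<i> * (exp (- Fs 0 / 2) * csqrt (pi / (\<i> / \<xi> * of_real (sin \<theta>)))))"
    by (intro tendsto_mult tendsto_add tendsto_const d left_side_integral)
  then have "(\<lambda>N. 1 / \<xi> * (?s N * (mesh N * (\<Sum>k<N. summand N k) / peak N - \<i> * ?I N) + \<i> * (?s N * ?I N)))
     \<longlonglongrightarrow> \<i> / \<xi> * (exp (- Fs 0 / 2) * csqrt (pi / (\<i> / \<xi> * of_real (sin \<theta>))))" by simp
  then show ?thesis
  proof (rule Lim_transform_eventually)
    show "\<forall>\<^sub>F N in sequentially. 1 / \<xi> * (?s N * (mesh N * (\<Sum>k<N. summand N k) / peak N - \<i> * ?I N) + \<i> * (?s N * ?I N))
       = (\<Sum>k<N. summand N k) / (peak N * ?s N)"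
      using eventually_gt_at_top[of "0::nat"]
    proof eventually_elim
      case (elim N)
      have s: "?s N * ?s N = of_nat N" by (simp flip: of_real_mult)
      have s0: "?s N \<noteq> 0" using elim by simp
      have E: "1 / \<xi> * (?s N * (mesh N * S / A - \<i> * I) + \<i> * (?s N * I)) = S / (A * ?s N)" if "A \<noteq> 0" for S A I
      proof -
        have "1 / \<xi> * (?s N * (mesh N * S / A - \<i> * I) + \<i> * (?s N * I)) = 1 / \<xi> * (?s N * (mesh N * S / A))"
          by (simp add: algebra_simps)
        also have "\<dots> = ?s N * S / (of_nat N * A)" using xi_nz by (simp add: mesh_def)
        also have "\<dots> = S / (A * ?s N)" unfolding s[symmetric] using s0 that by (simp add: field_simps)
        finally show ?thesis .
      qed
      show ?case by (rule E[OF peak_nz])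
    qed
  qed
qed

end

context fig8 begin

lemma sum_asymptotics:
  "(\<lambda>N. colored_jones_fig8 N (exp (\<xi> / of_nat N)) / (peak N * of_real (sqrt (real N))))
    \<longlonglongrightarrow> \<i> / \<xi> * (exp (- Fs 0 / 2) * csqrt (pi / (\<i> / \<xi> * of_real (sin \<theta>))))"
proof -
  obtain \<epsilon> ct where e: "0 < \<epsilon>" "\<epsilon> \<le> \<theta> / 2" "\<epsilon> \<le> (3 - 2 * cosh u) / 8" "0 < ct"
    "\<And>y s. - \<epsilon> \<le> y \<Longrightarrow> y < 0 \<Longrightarrow> 0 \<le> s \<Longrightarrow> s \<le> 3 * u \<Longrightarrow>
        gap (Complex s y) - 4 * pi\<^sup>2 * real p * max 0 (s - u) \<le> - ct"
    using top_estimate by blast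
  \<comment> \<open>One rate for all sides: that of the top side and the common margin of the
    others.\<close>
  define c where "c = min ct (u * (2 * pi\<^sup>2 * real p - 12 * u))"
  have c: "0 < c" "c \<le> u * (2 * pi\<^sup>2 * real p - 12 * u)" "c \<le> ct"
    using e(4) u pi_p_u by (auto simp: c_def)
  have "0 < 1 - 1 / (2 * real p)" "1 - 1 / (2 * real p) < 1" using p p_ge_1 by (auto simp: field_simps)
  from summand_asymptotics[OF this] obtain C1 where C1: "C1 > 0"
    "\<And>N k. N > 0 \<Longrightarrow> real k + 1/2 \<le> (1 - 1 / (2 * real p)) * real N \<Longrightarrow>
      \<exists>e. norm e \<le> C1 / real N \<and> summand N k = exp ((Ps ((of_nat k + 1/2) * mesh N) - Ps (mesh N / 2)) / mesh N + e)"
    by blast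
  obtain C3 where C3: "C3 > 0" "\<And>N. N > 0 \<Longrightarrow> norm (Ps (mesh N / 2) / mesh N - Fs 0 / 2) \<le> C3 / real N"
    using Ps_half_step by blast
  define D where "D = {V :: complex. - 1 < Re V \<and> Re V < 3 * u + 1 \<and> - 2 * pi + \<theta> / 4 < Im V \<and> Im V < - \<epsilon> / 4}"
  have b: "- 2 * pi < - 2 * pi + \<theta> / 4" "- 2 * pi + \<theta> / 4 < - \<epsilon> / 4" "- \<epsilon> / 4 < 0" "0 < 3 * u + 1" "0 < ln 23 + (1::real)"
    using theta e pi_gt3 u by (auto simp: add_pos_pos)
  obtain C N0 where CN: "C > 0" "N0 > 0"
    "\<And>N. N \<ge> N0 \<Longrightarrow> \<exists>E. E holomorphic_on D \<and>
      (\<forall>V\<in>D. norm (E V - (P V / mesh N + F V / 2)) \<le> C / real N) \<and>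
      (\<forall>V\<in>D. norm (E (V + mesh N) - E V - F (V + mesh N)) \<le> C * exp (- (ln 23 + 1) * real N))"
    "\<And>N V. N \<ge> N0 \<Longrightarrow> V \<in> D \<Longrightarrow> V + mesh N / 2 \<in> Sig \<and>
      norm (P (V + mesh N / 2) / mesh N - (P V / mesh N + F V / 2)) \<le> C / real N"
    using interpolation[OF b] unfolding D_def by blast
  have "\<forall>N\<in>{N0..}. \<exists>E. E holomorphic_on D \<and>
      (\<forall>V\<in>D. norm (E V - (P V / mesh N + F V / 2)) \<le> C / real N) \<and>
      (\<forall>V\<in>D. norm (E (V + mesh N) - E V - F (V + mesh N)) \<le> C * exp (- (ln 23 + 1) * real N))"
    using CN(3) by simp
  from bchoice[OF this] obtain E where E: "\<And>N. N \<ge> N0 \<Longrightarrow> E N holomorphic_on D"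
    "\<And>N V. N \<ge> N0 \<Longrightarrow> V \<in> D \<Longrightarrow> norm (E N V - (P V / mesh N + F V / 2)) \<le> C / real N"
    "\<And>N V. N \<ge> N0 \<Longrightarrow> V \<in> D \<Longrightarrow> norm (E N (V + mesh N) - E N V - F (V + mesh N)) \<le> C * exp (- (ln 23 + 1) * real N)"
    by (metis atLeast_iff)
  interpret I: fig8_interpolant u p \<epsilon> c C1 C3 C N0 E
  proof
    show "gap (Complex s y) - 4 * pi\<^sup>2 * real p * max 0 (s - u) \<le> - c"
      if "- \<epsilon> \<le> y" "y < 0" "0 \<le> s" "s \<le> 3 * u" for y s
      using e(5)[OF that] c(3) by simp
    show "E N holomorphic_on {V. - 1 < Re V \<and> Re V < 3 * u + 1 \<and> - 2 * pi + \<theta> / 4 < Im V \<and> Im V < - \<epsilon> / 4}"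
      if "N \<ge> N0" for N using E(1)[OF that] by (simp add: D_def)
  qed (use e c C1 C3 CN E in \<open>auto simp: D_def\<close>)
  show ?thesis
  proof (rule Lim_transform_eventually[OF I.summand_sum_asymptotics])
    show "\<forall>\<^sub>F N in sequentially. (\<Sum>k<N. summand N k) / (peak N * of_real (sqrt (real N)))
       = colored_jones_fig8 N (exp (\<xi> / of_nat N)) / (peak N * of_real (sqrt (real N)))"
      using eventually_gt_at_top[of "0::nat"] by eventually_elim (simp add: colored_jones_fig8_sum)
  qed
qed

end

section \<open>Identification of the constants\<close>

lemma sinh_of_real_half: "sinh (complex_of_real x / 2) = of_real (sinh (x / 2))"
  by (simp add: sinh_def exp_of_real scaleR_conv_of_real flip: exp_of_real)

context fig8 begin

text \<open>With cosh u = cos \<theta> + 1/2 the radicand is (2 cos \<theta> + 2) (2 cos \<theta> -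
  2) = - 4 sin^2 \<theta>, and sin \<theta> > 0 fixes the branch.\<close>

lemma fig8_root_eq: "fig8_root u = \<i> * of_real (2 * sin \<theta>)"
proof -
  have c: "cosh u = cos \<theta> + 1/2" using cos_theta by simp
  have "(2 * cosh u + 1) * (2 * cosh u - 3) = - (2 * sin \<theta>)\<^sup>2"
    unfolding c power_mult_distrib sin_squared_eq by (simp add: algebra_simps power2_eq_square)
  then have "fig8_root u = csqrt (of_real (- (2 * sin \<theta>)\<^sup>2))" by (simp only: fig8_root_def)
  also have "\<dots> = \<i> * of_real (2 * sin \<theta>)"
    by (rule csqrt_unique) (use sin_theta in \<open>auto simp: power_mult_distrib\<close>)
  finally show ?thesis .
qed

text \<open>The argument of the logarithm is cos \<theta> - i sin \<theta>, with \<theta> in the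
  principal range.\<close>

lemma phi_fig8_eq: "\<phi>_fig8 u = \<phi>"
proof -
  have "complex_of_real (cosh u) - 1/2 - 1/2 * fig8_root u = exp \<phi>"
    using cos_theta by (simp add: fig8_root_eq complex_eq_iff \<phi>_def Re_exp Im_exp)
  then show ?thesis unfolding \<phi>_fig8_def
    by (simp only:) (rule Ln_exp, use theta pi_gt3 in \<open>auto simp: \<phi>_def\<close>)
qed

lemma S_fig8_eq: "S_fig8 u = P \<phi> + 2 * of_real pi * \<i> * of_real u"
proof -
  have "\<phi> \<in> Sig" using theta pi_gt3 by (simp add: \<phi>_def Sig_def)
  then have "P \<phi> = Ps \<phi>" using u by (intro P_eq_Ps) (auto simp: \<phi>_def)
  then show ?thesis unfolding S_fig8_def phi_fig8_eq Ps_def by (simp add: algebra_simps)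
qed

lemma T_fig8_eq: "T_fig8 u = 1 / (\<i> * of_real (sin \<theta>))"
  by (simp add: T_fig8_def fig8_root_eq)

text \<open>This identity brings in J_p. The two exponents differ by N / \<xi> times 2 \<pi> i (p -
  1) (u + 2 p \<pi> i). The last bracket is \<xi>, so the difference is (p - 1) N times 2 \<pi>
  i.\<close>

lemma peak_eq:
  "peak N = exp (of_nat N / \<xi> * S_fig8 u) * exp (of_nat (p * (p - 1)) * (4 * of_nat N * (of_real pi)\<^sup>2 / \<xi>))"
proof (cases "N = 0")
  case False
  have p1: "complex_of_nat (p * (p - 1)) = of_nat p * (of_nat p - 1)" using p by (simp add: of_nat_diff)
  define E1 E2 where "E1 = (P \<phi> + period * of_real u) / mesh N"
    and "E2 = of_nat N / \<xi> * S_fig8 u + of_nat (p * (p - 1)) * (4 * of_nat N * (of_real pi)\<^sup>2 / \<xi>)"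
  have "E1 - E2 = of_nat N / \<xi> * ((of_nat p - 1) * (2 * of_real pi * \<i>) * (of_real u + of_nat p * (2 * of_real pi * \<i>)))"
    unfolding E1_def E2_def p1 S_fig8_eq mesh_def period_def using False xi_nz
    by (simp add: field_simps power2_eq_square)
  also have "of_real u + of_nat p * (2 * of_real pi * \<i>) = \<xi>" by (simp add: \<xi>_def)
  finally have "E1 - E2 = 2 * of_nat ((p - 1) * N) * of_real pi * \<i>"
    using xi_nz p by (simp add: of_nat_diff mult_ac)
  then have "exp (E1 - E2) = exp (2 * of_real pi * \<i>) ^ ((p - 1) * N)"
    by (simp only: exp_of_nat_mult[symmetric]) (simp add: mult_ac)
  then have "exp (E1 - E2) = 1" by simp
  then have "exp E1 = exp E2" by (simp add: exp_diff)
  then show ?thesis by (simp add: peak_def E1_def E2_def exp_add)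
\<comment> \<open>For N = 0 both sides are 1, as division by \<open>mesh 0\<close> = 0 gives
  0.\<close>
qed (simp add: peak_def mesh_def)

text \<open>f 0 = 2 cosh u - 2 is the square of 2 sinh (u/2).\<close>

lemma exp_Fs_0_half: "exp (- Fs 0 / 2) = 1 / (2 * sinh (of_real u / 2))"
proof -
  have s: "sinh (u / 2) > 0" using u by simp
  have "2 * cosh u - 2 = (2 * sinh (u / 2))\<^sup>2"
    using cosh_double[of "u / 2"] by (simp add: power_mult_distrib cosh_square_eq)
  then have "g 0 = ln ((2 * sinh (u / 2))\<^sup>2)" unfolding g_def by (simp only: cos_zero mult_1_right)
  then have g0: "g 0 = 2 * ln (2 * sinh (u / 2))" using s ln_realpow[of "2 * sinh (u / 2)" 2] by simp
  have "Fs 0 = of_real (g 0)" using Fs_imag_axis[of 0] by (simp add: Complex_eq)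
  then have "exp (- Fs 0 / 2) = of_real (exp (- ln (2 * sinh (u / 2))))" by (simp add: g0 flip: exp_of_real)
  also have "\<dots> = of_real (1 / (2 * sinh (u / 2)))" using s by (simp add: exp_minus inverse_eq_divide)
  also have "\<dots> = 1 / (2 * sinh (of_real u / 2))" by (simp add: sinh_of_real_half)
  finally show ?thesis .
qed

text \<open>A question of branches: c = csqrt \<xi> lies in the open first quadrant and csqrt T
  equals r (1 - i), so sqrt \<pi> r (1 - i) c has the real part sqrt \<pi> r (Re c + Im c) > 0 and
  is the principal root. The factor i is that of csqrt (- \<pi>).\<close>

lemma constant_eq:
  "\<i> / \<xi> * csqrt (pi / (\<i> / \<xi> * of_real (sin \<theta>))) =
     csqrt (- of_real pi) * csqrt (T_fig8 u) * csqrt (1 / \<xi>)"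
proof -
  define r where "r = sqrt (1 / (2 * sin \<theta>))"
  have r: "r > 0" "r\<^sup>2 = 1 / (2 * sin \<theta>)" using sin_theta by (auto simp: r_def)
  have T: "csqrt (T_fig8 u) = Complex r (- r)"
  proof -
    have "csqrt (1 / (\<i> * of_real (sin \<theta>))) = Complex r (- r)"
    proof (rule csqrt_unique)
      show "(Complex r (- r))\<^sup>2 = 1 / (\<i> * of_real (sin \<theta>))"
        using r(2) by (simp add: complex_eq_iff power2_eq_square Re_divide Im_divide)
    qed (use r in auto)
    then show ?thesis by (simp add: T_fig8_eq)
  qed
  define c where "c = csqrt \<xi>"
  have c2: "c\<^sup>2 = \<xi>" by (simp add: c_def)
  have c0: "c \<noteq> 0" using xi_nz by (simp add: c_def)
  have cR: "Re c > 0"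
    using u by (simp add: c_def add_nonneg_pos)
  have "0 < 2 * pi * real p" using p by simp
  also have "2 * pi * real p = Im (c\<^sup>2)" by (simp add: c2)
  also have "\<dots> = 2 * Re c * Im c" by (simp add: power2_eq_square)
  finally have cI: "Im c > 0" using cR by (simp add: zero_less_mult_iff)
  have c': "csqrt (1 / \<xi>) = 1 / c"
  proof (rule csqrt_unique)
    have "Re (1 / c) > 0" using cR cI by (simp add: Re_divide add_pos_pos)
    then show "0 < Re (1 / c) \<or> Re (1 / c) = 0 \<and> 0 \<le> Im (1 / c)" by blast
  qed (simp add: power_divide c2)
  have m: "csqrt (- of_real pi) = \<i> * of_real (sqrt pi)"
    by (rule csqrt_unique) (auto simp: power_mult_distrib simp flip: of_real_power)
  have k: "csqrt (pi / (\<i> / \<xi> * of_real (sin \<theta>))) = of_real (sqrt pi) * Complex r (- r) * c"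
  proof (rule csqrt_unique)
    have "(Complex r (- r))\<^sup>2 = T_fig8 u" by (simp flip: T)
    then show "(of_real (sqrt pi) * Complex r (- r) * c)\<^sup>2 = pi / (\<i> / \<xi> * of_real (sin \<theta>))"
      by (simp add: power_mult_distrib c2 T_fig8_eq flip: of_real_power)
    have "Re (of_real (sqrt pi) * Complex r (- r) * c) = sqrt pi * r * (Re c + Im c)"
      by (simp add: algebra_simps)
    then show "0 < Re (of_real (sqrt pi) * Complex r (- r) * c) \<or>
       Re (of_real (sqrt pi) * Complex r (- r) * c) = 0 \<and> 0 \<le> Im (of_real (sqrt pi) * Complex r (- r) * c)"
      using r(1) cR cI by simp
  qed
  show ?thesis unfolding k m T c' using c0 by (simp add: c2[symmetric] field_simps power2_eq_square)
qed

text \<open>The real part of 4 N \<pi>^2 / \<xi> is 4 \<pi>^2 u N / |\<xi>|^2 and tends to infinity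
  because u > 0. So J_p may be replaced by its leading exponential, which cancels the second factor
  in \<open>peak_eq\<close>.\<close>

lemma colored_jones_ratio:
  "(\<lambda>N::nat.
      (colored_jones_fig8 N (exp (\<xi> / of_nat N))
         / colored_jones_fig8 p (exp (4 * of_nat N * (complex_of_real pi)\<^sup>2 / \<xi>)))
      / (csqrt (- complex_of_real pi) / (2 * sinh (complex_of_real u / 2))
         * csqrt (T_fig8 u) * csqrt (of_nat N / \<xi>) * exp (of_nat N / \<xi> * S_fig8 u)))
    \<longlonglongrightarrow> 1"
proof -
  define a where "a N = 4 * of_nat N * (complex_of_real pi)\<^sup>2 / \<xi>" for N :: nat
  have "Re (a N) = 4 * pi\<^sup>2 * u / xi_norm2 * real N" for N
    by (simp add: a_def Re_divide xi_norm2_def flip: of_real_power)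
  moreover have "4 * pi\<^sup>2 * u / xi_norm2 > 0" using u xi_norm2_pos by simp
  ultimately have "filterlim (\<lambda>N. Re (a N)) at_top sequentially"
    by (simp only:) real_asymp
  from colored_jones_fig8_leading[OF p this]
  have J: "(\<lambda>N. colored_jones_fig8 p (exp (a N)) / exp (of_nat (p * (p - 1)) * a N)) \<longlonglongrightarrow> 1" .
  define Q where "Q = csqrt (- of_real pi) / (2 * sinh (of_real u / 2)) * csqrt (T_fig8 u) * csqrt (1 / \<xi>)"
  have Q0: "Q \<noteq> 0"
    using u xi_nz sin_theta by (simp add: Q_def T_fig8_eq sinh_of_real_half)
  have "\<i> / \<xi> * (exp (- Fs 0 / 2) * csqrt (pi / (\<i> / \<xi> * of_real (sin \<theta>)))) =
     exp (- Fs 0 / 2) * (\<i> / \<xi> * csqrt (pi / (\<i> / \<xi> * of_real (sin \<theta>))))"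
    by (simp only: mult_ac)
  also have "\<dots> = Q" unfolding constant_eq exp_Fs_0_half Q_def by simp
  finally have "(\<lambda>N. colored_jones_fig8 N (exp (\<xi> / of_nat N)) / (peak N * of_real (sqrt (real N)))) \<longlonglongrightarrow> Q"
    using sum_asymptotics by simp
  from tendsto_divide[OF tendsto_divide[OF this tendsto_const[of Q] Q0] J]
  have "(\<lambda>N. colored_jones_fig8 N (exp (\<xi> / of_nat N)) / (peak N * of_real (sqrt (real N))) / Q /
      (colored_jones_fig8 p (exp (a N)) / exp (of_nat (p * (p - 1)) * a N))) \<longlonglongrightarrow> 1"
    using Q0 by simp
  then show ?thesis
  proof (rule Lim_transform_eventually)
    show "\<forall>\<^sub>F N in sequentially.
      colored_jones_fig8 N (exp (\<xi> / of_nat N)) / (peak N * of_real (sqrt (real N))) / Q /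
        (colored_jones_fig8 p (exp (a N)) / exp (of_nat (p * (p - 1)) * a N)) =
      (colored_jones_fig8 N (exp (\<xi> / of_nat N))
         / colored_jones_fig8 p (exp (4 * of_nat N * (complex_of_real pi)\<^sup>2 / \<xi>)))
      / (csqrt (- complex_of_real pi) / (2 * sinh (complex_of_real u / 2))
         * csqrt (T_fig8 u) * csqrt (of_nat N / \<xi>) * exp (of_nat N / \<xi> * S_fig8 u))"
      using eventually_gt_at_top[of "0::nat"]
    proof eventually_elim
      case (elim N)
      have "csqrt (of_nat N / \<xi>) = of_real (sqrt (real N)) * csqrt (1 / \<xi>)"
      proof (rule csqrt_unique)
        show "(of_real (sqrt (real N)) * csqrt (1 / \<xi>))\<^sup>2 = of_nat N / \<xi>"
          by (simp add: power_mult_distrib flip: of_real_power)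
        show "0 < Re (of_real (sqrt (real N)) * csqrt (1 / \<xi>)) \<or>
          Re (of_real (sqrt (real N)) * csqrt (1 / \<xi>)) = 0 \<and> 0 \<le> Im (of_real (sqrt (real N)) * csqrt (1 / \<xi>))"
          using csqrt_principal[of "1 / \<xi>"] elim by (auto simp del: csqrt.simps)
      qed
      then have D: "csqrt (- complex_of_real pi) / (2 * sinh (complex_of_real u / 2))
         * csqrt (T_fig8 u) * csqrt (of_nat N / \<xi>) * exp (of_nat N / \<xi> * S_fig8 u) =
         Q * of_real (sqrt (real N)) * exp (of_nat N / \<xi> * S_fig8 u)"
        by (simp only: Q_def mult_ac)
      have A: "peak N = exp (of_nat N / \<xi> * S_fig8 u) * exp (of_nat (p * (p - 1)) * a N)"
        by (simp only: peak_eq a_def)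
      have "X / (E1 * E2 * s) / Q / (Y / E2) = X / Y / (Q * s * E1)" if "E2 \<noteq> 0" for X Y E1 E2 s :: complex
        using that by (simp add: field_simps)
      then show ?case unfolding D A a_def[symmetric] by (simp only: exp_not_eq_zero not_False_eq_True)
    qed
  qed
qed

end

theorem corollary1p7:
  fixes u :: real and p :: nat and \<xi> :: complex
  assumes "0 < u" and "u < arcosh (3/2)"
    and "p > 0"
    and "\<xi> = complex_of_real u + 2 * of_nat p * complex_of_real pi * \<i>"
  shows "(\<lambda>N::nat.
      (colored_jones_fig8 N (exp (\<xi> / of_nat N))
         / colored_jones_fig8 p (exp (4 * of_nat N * (complex_of_real pi)\<^sup>2 / \<xi>)))
      / (csqrt (- complex_of_real pi) / (2 * sinh (complex_of_real u / 2))
         * csqrt (T_fig8 u) * csqrt (of_nat N / \<xi>) * exp (of_nat N / \<xi> * S_fig8 u)))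
    \<longlonglongrightarrow> 1"
proof -
  have "cosh u < cosh (arcosh (3/2 :: real))" using assms(1,2) by (intro cosh_real_strict_mono) auto
  then interpret fig8 u p using assms by unfold_locales auto
  have "\<xi> = complex_of_real u + of_real (2 * pi * real p) * \<i>" unfolding assms(4) by simp
  then show ?thesis using colored_jones_ratio unfolding \<xi>_def by simp
qed

end
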